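(* Let $(F_j)_j\subset\mathcal A$ be a sequence such that $\lambda_*(F_j)\to 0$ as $j\to\infty$. Then $$\liminf_{j\to\infty}\mathcal Q_*(F_j)\ \ge\ \frac{64}{3}\pi^3\ >\ 16\pi^3 .$$
   Context: A convex body in $\mathbb R^3$ is a compact convex set with nonempty interior. $\mathcal A$ denotes the class of all convex bodies $F\subset\mathbb R^3$ with Lebesgue measure $|F|=4\pi/3$. $B=B_1(0)$ is the unit ball of $\mathbb R^3$ centered at the origin, $P(F)$ is the perimeter (surface area) of $F$ (so $P(B)=4\pi$), and $d_H$ is the Hausdorff distance. For $F\in\mathcal A$ define the isoperimetric deficit $\delta(F)=\frac{P(F)-P(B)}{P(B)}$, the Hausdorff asymmetry $\lambda_*(F)=\inf_{x\in\mathbb R^3} d_H(F,B+x)$, and $$\mathcal Q_*(F)=\frac{\delta(F)\,\log\!\left(\delta(F)+\frac1{\delta(F)}\right)P(F)^3}{\lambda_*(F)^2}$$ if $F$ is not a ball, while $\mathcal Q_*(F)=+\infty$ if $F$ is a ball. *)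

theory Defs
  imports "HOL-Analysis.Analysis"
begin

definition convex_body :: "(real^3) set \<Rightarrow> bool" where
  "convex_body F \<longleftrightarrow> convex F \<and> compact F \<and> interior F \<noteq> {}"

definition class_A :: "(real^3) set set" where
  "class_A = {F. convex_body F \<and> measure lebesgue F = 4 * pi / 3}"

definition unit_ball :: "(real^3) set" where
  "unit_ball = cball 0 1"

definition C1_compact_support :: "(real^'n \<Rightarrow> real^'n) \<Rightarrow> bool" where
  "C1_compact_support \<phi> \<longleftrightarrow>
     (\<forall>x. \<phi> differentiable (at x)) \<and>
     (\<forall>v. continuous_on UNIV (\<lambda>x. frechet_derivative \<phi> (at x) v)) \<and>
     compact (closure {x. \<phi> x \<noteq> 0})"

definition divergence :: "(real^'n \<Rightarrow> real^'n) \<Rightarrow> real^'n \<Rightarrow> real" where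
  "divergence \<phi> x = trace (matrix (frechet_derivative \<phi> (at x)))"

text \<open>The perimeter in the sense of De Giorgi, i.e. the total variation of the
  indicator function of the set.\<close>

definition perimeter :: "(real^'n) set \<Rightarrow> ereal" where
  "perimeter F =
     (SUP \<phi> \<in> {\<phi>. C1_compact_support \<phi> \<and> (\<forall>x. norm (\<phi> x) \<le> 1)}.
        ereal (LINT x:F|lebesgue. divergence \<phi> x))"

text \<open>Convex bodies have finite perimeter, so nothing is lost by passing to its real value.\<close>

definition P :: "(real^3) set \<Rightarrow> real" where
  "P F = real_of_ereal (perimeter F)"

text \<open>The Hausdorff distance of nonempty bounded sets; for other arguments the real-valued
  suprema may be meaningless.\<close>

definition hausdorff_dist :: "'a::metric_space set \<Rightarrow> 'a set \<Rightarrow> real" where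
  "hausdorff_dist A B = max (SUP x\<in>A. infdist x B) (SUP y\<in>B. infdist y A)"

definition iso_deficit :: "(real^3) set \<Rightarrow> real" where
  "iso_deficit F = (P F - P unit_ball) / P unit_ball"

definition hausdorff_asymmetry :: "(real^3) set \<Rightarrow> real" where
  "hausdorff_asymmetry F = (INF x. hausdorff_dist F ((\<lambda>y. y + x) ` unit_ball))"

definition is_ball :: "(real^3) set \<Rightarrow> bool" where
  "is_ball F \<longleftrightarrow> (\<exists>x r. r > 0 \<and> F = cball x r)"

definition Q_star :: "(real^3) set \<Rightarrow> ereal" where
  "Q_star F =
     (if is_ball F then \<infinity>
      else ereal (iso_deficit F * ln (iso_deficit F + 1 / iso_deficit F) * P F ^ 3
                  / (hausdorff_asymmetry F)\<^sup>2))"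

end

theory Submission
  imports Defs "HOL-Analysis.Analysis" "HOL-Real_Asymp.Real_Asymp"
begin

text \<open>
  Since t ln (t + 1/t) is increasing, only a lower bound for the perimeter is needed. Put the
  barycentre of F at the origin and let h be the Hausdorff distance from F to the unit ball; it is
  comparable to the asymmetry (asymmetry at most h, h at most 43 times the asymmetry). By convexity
  there is a unit vector e such that F either contains the point (1 + h) e (a spike) or lies in the
  half-space x . e at most 1 - h (a dent).

  Let a(z) be the area of the slice of F at height z in direction e, and let \<zeta> push a(z) dz
  forward to the same measure for the unit ball. Completing \<zeta> to a Knothe-type triangular map T
  from F into the ball and testing the perimeter with a mollification of T gives
  P(F) \<ge> \<integral> div T \<ge> \<integral> a (\<zeta>' + 2 / sqrt \<zeta>') dz, so the deficit P(F) - 4 \<pi> dominates a weighted square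
  norm of \<zeta>' - 1, the derivative of the gap \<zeta>(z) - z. The gap has mean zero because of the barycentre
  and is about h in absolute value at the spike or dent. Convexity controls a from below up to
  distance h from the tip, where the integral of 1/a is about ln (1/h) / \<pi>, and Cauchy-Schwarz
  yields a deficit \<delta> of about (3/16) h^2 / ln (1/h). As ln (1/\<delta>) is about 2 ln (1/h), the product
  \<delta> ln (1/\<delta>) is about (3/8) h^2, which is more than the required h^2 / 3.
\<close>

section \<open>Perimeter of convex bodies and similarities\<close>

text \<open>The target 64/3 pi^3 equals (4 pi)^3 / 3, so near the ball the claim is that \<delta> ln
  (\<delta> + 1/\<delta>) is at least a third of the squared asymmetry. The constant 3/16 arises
  because the excess p + 2 / sqrt p - 3 behaves like (3/4) (p - 1)^2 at p = 1: to leading order 4 pi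
  \<delta> >= (3/4) pi h^2 / ln (1/h). The obstacle is that 1/a need not be integrable up to the
  ends. The axis is therefore cut h/20 before the tip, where the gap is still 19/20 h, and at a
  distance of order h from the opposite end, where the part cut away has mass of order h^2 and
  cannot disturb the mean of the gap. Each end contributes half of the logarithm. For a dent the
  relevant range is p > 1, where the excess does not dominate (3/4) (p - 1)^2; there the estimate is
  made in the variable \<zeta>, with 1 - 1/p in place of p - 1. The factor 43 does not enter the
  constant: it only makes h small, and the last comparison uses asymmetry <= h.\<close>

lemma C1_compact_support_has_derivative:
  assumes "C1_compact_support \<phi>"
  shows "(\<phi> has_derivative frechet_derivative \<phi> (at x)) (at x)"
  using assms unfolding C1_compact_support_def by (simp add: frechet_derivative_works)

lemma C1_compact_support_continuous_entry:
  assumes "C1_compact_support \<phi>"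
  shows "continuous_on S (\<lambda>x. frechet_derivative \<phi> (at x) v $ i)"
proof -
  have "continuous_on UNIV (\<lambda>x. frechet_derivative \<phi> (at x) v)"
    using assms unfolding C1_compact_support_def by blast
  then show ?thesis
    by (intro continuous_on_component) (rule continuous_on_subset, auto)
qed

lemma divergence_eq_sum:
  "divergence \<phi> x = (\<Sum>i\<in>UNIV. frechet_derivative \<phi> (at x) (axis i 1) $ i)"
  by (simp add: divergence_def trace_def matrix_def)

lemma continuous_on_divergence:
  assumes "C1_compact_support \<phi>"
  shows "continuous_on S (divergence \<phi>)"
  unfolding divergence_eq_sum[abs_def]
  by (intro continuous_on_sum C1_compact_support_continuous_entry assms)

text \<open>The partial derivatives are continuous and vanish off the compact support, hence are
  bounded, and the mean value inequality applies. The constant makes x + t \<phi>(x) injective for t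
  < 1/L.\<close>

lemma C1_compact_support_lipschitz:
  fixes \<phi> :: "real^'n \<Rightarrow> real^'n"
  assumes "C1_compact_support \<phi>"
  obtains L where "L > 0" "\<And>x y. norm (\<phi> x - \<phi> y) \<le> L * norm (x - y)"
proof -
  let ?D = "\<lambda>x. frechet_derivative \<phi> (at x)"
  let ?K = "closure {x. \<phi> x \<noteq> 0}"
  have der: "(\<phi> has_derivative ?D x) (at x)" for x
    by (rule C1_compact_support_has_derivative[OF assms])
  have K: "compact ?K" using assms by (simp add: C1_compact_support_def)
  have zero: "?D x = (\<lambda>v. 0)" if "x \<notin> ?K" for x
  proof -
    have "open (- ?K)" "x \<in> - ?K" using that by auto
    moreover have "0 = \<phi> y" if "y \<in> - ?K" for y
      using closure_subset[of "{x. \<phi> x \<noteq> 0}"] that by auto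
    ultimately have "(\<phi> has_derivative (\<lambda>v. 0)) (at x)"
      by (rule has_derivative_transform_within_open[OF has_derivative_const])
    then show ?thesis by (rule has_derivative_unique[OF der])
  qed
  have "\<exists>M. \<forall>x. norm (?D x (axis j 1)) \<le> M" for j
  proof -
    have "continuous_on ?K (\<lambda>x. ?D x (axis j 1))"
      using assms unfolding C1_compact_support_def by (blast intro: continuous_on_subset)
    then have "bounded ((\<lambda>x. ?D x (axis j 1)) ` ?K)"
      using K compact_continuous_image compact_imp_bounded by blast
    then obtain M where M: "\<And>x. x \<in> ?K \<Longrightarrow> norm (?D x (axis j 1)) \<le> M" "M > 0"
      unfolding bounded_pos by auto
    have "norm (?D x (axis j 1)) \<le> M" for x
      using M zero[of x] by (cases "x \<in> ?K") auto
    then show ?thesis by blast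
  qed
  then obtain M where M: "\<And>j x. norm (?D x (axis j 1)) \<le> M j" by metis
  define L where "L = 1 + (\<Sum>j\<in>UNIV. \<bar>M j\<bar>)"
  have Lpos: "L > 0" unfolding L_def by (simp add: add_pos_nonneg sum_nonneg)
  have bd: "norm (?D x v) \<le> L * norm v" for x v
  proof -
    have lin: "linear (?D x)" using der has_derivative_linear by blast
    have "v = (\<Sum>j\<in>UNIV. v $ j *\<^sub>R axis j 1)"
      using basis_expansion[of v] by (simp add: scalar_mult_eq_scaleR)
    then have "?D x v = ?D x (\<Sum>j\<in>UNIV. v $ j *\<^sub>R axis j 1)" by simp
    also have "\<dots> = (\<Sum>j\<in>UNIV. v $ j *\<^sub>R ?D x (axis j 1))"
      by (simp add: linear_sum[OF lin] linear_scale[OF lin])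
    finally have "norm (?D x v) \<le> (\<Sum>j\<in>UNIV. norm (v $ j *\<^sub>R ?D x (axis j 1)))"
      by (simp only: norm_sum)
    also have "\<dots> \<le> (\<Sum>j\<in>UNIV. norm v * \<bar>M j\<bar>)"
    proof (rule sum_mono)
      fix j :: 'n
      have "\<bar>v $ j\<bar> \<le> norm v" by (rule component_le_norm_cart)
      moreover have "norm (?D x (axis j 1)) \<le> \<bar>M j\<bar>" using M[of x j] by linarith
      ultimately show "norm (v $ j *\<^sub>R ?D x (axis j 1)) \<le> norm v * \<bar>M j\<bar>"
        by (simp add: mult_mono)
    qed
    also have "\<dots> \<le> L * norm v" unfolding L_def by (simp add: sum_distrib_left[symmetric] algebra_simps)
    finally show ?thesis .
  qed
  have "norm (\<phi> x - \<phi> y) \<le> L * norm (x - y)" for x y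
  proof (rule differentiable_bound[of UNIV])
    show "\<And>z. z \<in> UNIV \<Longrightarrow> (\<phi> has_derivative ?D z) (at z within UNIV)" using der by simp
    show "\<And>z. z \<in> UNIV \<Longrightarrow> onorm (?D z) \<le> L" using bd by (intro onorm_le) auto
  qed auto
  with Lpos that show ?thesis by blast
qed

text \<open>Since r v lies in F, the vector x + t v is 1 + t/r times a convex combination of x and r
  v.\<close>

lemma convex_add_small:
  fixes F :: "'a::real_normed_vector set"
  assumes "convex F" "cball 0 r \<subseteq> F" "r > 0" "t \<ge> 0" "x \<in> F" "norm v \<le> 1"
  shows "x + t *\<^sub>R v \<in> (\<lambda>y. (1 + t / r) *\<^sub>R y) ` F"
proof
  have v: "r *\<^sub>R v \<in> F" using assms by (auto simp: subset_iff mult_le_cancel_left1)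
  let ?c = "1 + t / r"
  have c: "?c > 0" using assms by (simp add: add_pos_nonneg)
  have "1 / ?c + t / r / ?c = 1" using c by (simp add: add_divide_distrib[symmetric] del: divide_divide_eq_left)
  then have "(1 / ?c) *\<^sub>R x + (t / r / ?c) *\<^sub>R (r *\<^sub>R v) \<in> F"
    using assms v c by (intro convexD) auto
  moreover have "(1 + t / r) *\<^sub>R ((1 / ?c) *\<^sub>R x + (t / r / ?c) *\<^sub>R (r *\<^sub>R v)) = x + t *\<^sub>R v"
    using c assms(3) by (simp add: scaleR_right_distrib)
  ultimately show "x + t *\<^sub>R v = ?c *\<^sub>R ((1 / ?c) *\<^sub>R (x + t *\<^sub>R v))" "(1 / ?c) *\<^sub>R (x + t *\<^sub>R v) \<in> F"
    using c assms(3) by (auto simp: scaleR_right_distrib)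
qed


lemma absolutely_integrable_continuous_compact:
  fixes f :: "'a::euclidean_space \<Rightarrow> 'b::euclidean_space"
  assumes "compact S" "continuous_on S f"
  shows "f absolutely_integrable_on S"
proof -
  have i: "integrable lborel (\<lambda>x. indicator S x *\<^sub>R f x)"
    by (rule borel_integrable_compact[OF assms])
  show ?thesis
    unfolding set_integrable_def integrable_completion[OF borel_measurable_integrable[OF i]] by (rule i)
qed

(* The flow x + t \<phi>(x) maps F into (1 + t/r) F; comparing volumes to first order in t bounds the
   integral of div \<phi>. For the unit ball the bound is sharp. *)
lemma perimeter_convex_le:
  fixes F :: "(real^3) set"
  assumes "convex F" "compact F" "cball 0 r \<subseteq> F" "r > 0"
  shows "perimeter F \<le> ereal (3 * measure lebesgue F / r)"
  unfolding perimeter_def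
proof (rule SUP_least)
  fix \<phi> :: "real^3 \<Rightarrow> real^3"
  assume "\<phi> \<in> {\<phi>. C1_compact_support \<phi> \<and> (\<forall>x. norm (\<phi> x) \<le> 1)}"
  then have \<phi>: "C1_compact_support \<phi>" and le1: "\<And>x. norm (\<phi> x) \<le> 1" by auto
  obtain L where L: "L > 0" "\<And>x y. norm (\<phi> x - \<phi> y) \<le> L * norm (x - y)"
    using C1_compact_support_lipschitz[OF \<phi>] by blast
  let ?D = "\<lambda>x. frechet_derivative \<phi> (at x)"
  define A where "A x = matrix (?D x)" for x
  define V where "V = measure lebesgue F"
  have Fl: "F \<in> lmeasurable" using assms(2) by (rule lmeasurable_compact)
  have Fs: "F \<in> sets lebesgue" using Fl by (rule fmeasurableD)
  have cont: "continuous_on F (\<lambda>x. A x $ i $ j)" for i j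
    unfolding A_def matrix_def by (simp add: C1_compact_support_continuous_entry[OF \<phi>])
  \<comment> \<open>\<open>b\<close> is the sum of the principal 2 x 2 minors and \<open>c\<close>
    the determinant of the derivative matrix, so det (1 + t A) is an explicit cubic in t.\<close>
  define b where "b x = A x$1$1 * A x$2$2 - A x$1$2 * A x$2$1 + A x$1$1 * A x$3$3 - A x$1$3 * A x$3$1
      + A x$2$2 * A x$3$3 - A x$2$3 * A x$3$2" for x
  define c where "c x = det (A x)" for x
  have det: "det (mat 1 + t *\<^sub>R A x) = 1 + t * divergence \<phi> x + t^2 * b x + t^3 * c x" for t x
    unfolding b_def c_def divergence_def A_def[symmetric]
    unfolding det_3 trace_def sum_3 by (simp add: mat_def) algebra
  have cb: "continuous_on F b" "continuous_on F c"
    unfolding b_def c_def det_3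
    by (intro continuous_on_add continuous_on_diff continuous_on_mult cont)+
  note int = absolutely_integrable_continuous_compact[OF assms(2)]
  note intH = set_lebesgue_integral_eq_integral[OF int]
  define \<alpha> where "\<alpha> = integral F (divergence \<phi>)"
  define \<beta> where "\<beta> = integral F b"
  define \<gamma> where "\<gamma> = integral F c"
  have ha: "(divergence \<phi> has_integral \<alpha>) F" "(b has_integral \<beta>) F" "(c has_integral \<gamma>) F"
    unfolding \<alpha>_def \<beta>_def \<gamma>_def
    using intH(1)[OF continuous_on_divergence[OF \<phi>]] intH(1)[OF cb(1)] intH(1)[OF cb(2)]
    by (auto simp: has_integral_iff)
  have one: "((\<lambda>x. 1) has_integral V) F"
    using Fl lmeasurable_iff_integrable_on[of F] by (simp add: has_integral_iff V_def lmeasure_integral[OF Fl])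
  \<comment> \<open>The volume inequality after subtracting V and dividing by t; as t tends to 0
    only \<open>\<alpha>\<close> survives on the left.\<close>
  have main: "\<alpha> + t * \<beta> + t^2 * \<gamma> \<le> V * (3 / r + 3 * t / r^2 + t^2 / r^3)" if t: "0 < t" "t < 1 / L" for t
  proof -
    let ?f = "\<lambda>x. x + t *\<^sub>R \<phi> x"
    have der: "(?f has_derivative (\<lambda>v. v + t *\<^sub>R ?D x v)) (at x within F)" for x
      by (rule has_derivative_at_withinI[OF has_derivative_add[OF has_derivative_ident
          has_derivative_scaleR_right[OF C1_compact_support_has_derivative[OF \<phi>]]]])
    have inj: "inj_on ?f F"
    proof (rule inj_onI)
      fix x y assume "x + t *\<^sub>R \<phi> x = y + t *\<^sub>R \<phi> y"
      then have "x - y = t *\<^sub>R (\<phi> y - \<phi> x)" by (simp add: algebra_simps)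
      then have "norm (x - y) = t * norm (\<phi> y - \<phi> x)" using t by simp
      also have "\<dots> \<le> t * (L * norm (x - y))" using L(2)[of y x] t by (simp add: norm_minus_commute)
      finally have "norm (x - y) \<le> (t * L) * norm (x - y)" by simp
      moreover have "t * L < 1" using t L by (simp add: field_simps)
      ultimately show "x = y"
        using mult_strict_right_mono[of "t * L" 1 "norm (x - y)"] by fastforce
    qed
    have mat: "matrix (\<lambda>v. v + t *\<^sub>R ?D x v) = mat 1 + t *\<^sub>R A x" for x
      by (simp add: matrix_def A_def vec_eq_iff mat_def axis_def)
    have sub: "?f ` F \<subseteq> (\<lambda>y. (1 + t / r) *\<^sub>R y) ` F"
      using convex_add_small[OF assms(1,3,4)] le1 t by force
    have cmp: "compact (?f ` F)"
      by (rule compact_continuous_image[OF has_derivative_continuous_on[OF der] assms(2)])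
    have i1: "((\<lambda>x. \<bar>det (mat 1 + t *\<^sub>R A x)\<bar>) has_integral measure lebesgue (?f ` F)) F"
      using has_measure_differentiable_image[OF Fs der inj, of "measure lebesgue (?f ` F)"] lmeasurable_compact[OF cmp]
      by (simp add: mat)
    have i2: "((\<lambda>x. 1 + t * divergence \<phi> x + t^2 * b x + t^3 * c x) has_integral (V + t * \<alpha> + t^2 * \<beta> + t^3 * \<gamma>)) F"
      by (intro has_integral_add has_integral_mult_right ha one)
    have "V + t * \<alpha> + t^2 * \<beta> + t^3 * \<gamma> \<le> measure lebesgue (?f ` F)"
      by (rule has_integral_le[OF i2 i1]) (simp only: det abs_ge_self)
    also have "\<dots> \<le> measure lebesgue ((\<lambda>y. (1 + t / r) *\<^sub>R y) ` F)"
      using sub cmp assms(2) by (intro measure_mono_fmeasurable lmeasurable_compact compact_scaling)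
        (auto intro!: fmeasurableD lmeasurable_compact)
    also have "\<dots> = (1 + t / r)^3 * V"
      using measure_lebesgue_affine[of "1 + t / r" 0 F] t assms(4) by (simp add: V_def)
    finally have "t * (\<alpha> + t * \<beta> + t^2 * \<gamma>) \<le> t * (V * (3 / r + 3 * t / r^2 + t^2 / r^3))"
      using assms(4) by (simp add: power2_eq_square power3_eq_cube field_simps)
    then show ?thesis using t by simp
  qed
  have "\<alpha> \<le> V * (3 / r)"
  proof (rule tendsto_le[of "at_right 0"])
    show "((\<lambda>t. \<alpha> + t * \<beta> + t^2 * \<gamma>) \<longlongrightarrow> \<alpha>) (at_right 0)"
      by (auto intro!: tendsto_eq_intros)
    show "((\<lambda>t. V * (3 / r + 3 * t / r^2 + t^2 / r^3)) \<longlongrightarrow> V * (3 / r)) (at_right 0)"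
      using assms(4) by (auto intro!: tendsto_eq_intros)
    show "\<forall>\<^sub>F t in at_right 0. \<alpha> + t * \<beta> + t^2 * \<gamma> \<le> V * (3 / r + 3 * t / r^2 + t^2 / r^3)"
      using main L unfolding eventually_at_right_field by (intro exI[of _ "1 / L"]) auto
  qed auto
  moreover have "(LINT x:F|lebesgue. divergence \<phi> x) = \<alpha>"
    unfolding \<alpha>_def using intH(2)[OF continuous_on_divergence[OF \<phi>]] .
  ultimately show "ereal (LINT x:F|lebesgue. divergence \<phi> x) \<le> ereal (3 * measure lebesgue F / r)"
    by (simp add: V_def mult.commute)
qed

text \<open>The derivative of \<psi> is that of \<phi> conjugated by Q and divided by s, and the
  trace does not see the conjugation. Values are rotated but not scaled, so a bound by 1 on the norm
  is kept.\<close>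

lemma divergence_conjugate:
  fixes \<phi> :: "real^'n \<Rightarrow> real^'n" and c :: "real^'n" and Q :: "real^'n \<Rightarrow> real^'n"
  assumes "C1_compact_support \<phi>" "orthogonal_transformation Q" "s > 0"
  defines "\<psi> \<equiv> \<lambda>y. Q (\<phi> (inv Q ((1/s) *\<^sub>R (y - c))))"
  shows "C1_compact_support \<psi>"
    and "divergence \<psi> (s *\<^sub>R Q x + c) = divergence \<phi> x / s"
proof -
  let ?R = "inv Q"
  define e where "e y = ?R ((1/s) *\<^sub>R (y - c))" for y
  let ?D = "\<lambda>x. frechet_derivative \<phi> (at x)"
  have R: "orthogonal_transformation ?R" using assms(2) by (rule orthogonal_transformation_inv)
  have lin: "linear Q" "linear ?R" using assms(2) R orthogonal_transformation_linear by auto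
  have QR: "Q (?R v) = v" "?R (Q v) = v" for v
    using orthogonal_transformation_bij[OF assms(2)] by (auto simp: bij_is_inj bij_is_surj surj_f_inv_f)
  have e: "e (s *\<^sub>R Q x + c) = x" for x
    using assms(3) by (simp add: e_def QR)
  have der: "(\<psi> has_derivative (\<lambda>v. Q (?D (e y) (?R ((1/s) *\<^sub>R v))))) (at y)" for y
  proof -
    have 1: "((\<lambda>y. (1/s) *\<^sub>R (y - c)) has_derivative (\<lambda>v. (1/s) *\<^sub>R v)) (at y)"
      by (auto intro!: derivative_eq_intros)
    have 2: "(e has_derivative (\<lambda>v. ?R ((1/s) *\<^sub>R v))) (at y)"
      unfolding e_def by (rule linear_imp_has_derivative[OF lin(2), THEN has_derivative_compose[OF 1]])
    have 3: "((\<lambda>y. \<phi> (e y)) has_derivative (\<lambda>v. ?D (e y) (?R ((1/s) *\<^sub>R v)))) (at y)"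
      by (rule has_derivative_compose[OF 2 C1_compact_support_has_derivative[OF assms(1)]])
    show ?thesis
      unfolding \<psi>_def e_def[symmetric]
      by (rule has_derivative_compose[OF 3 linear_imp_has_derivative[OF lin(1)]])
  qed
  have fd: "frechet_derivative \<psi> (at y) = (\<lambda>v. Q (?D (e y) (?R ((1/s) *\<^sub>R v))))" for y
    using frechet_derivative_at[OF der] by simp
  have cont_e: "continuous_on UNIV e"
    unfolding e_def by (intro linear_continuous_on_compose[OF _ lin(2)] continuous_intros)
  show "C1_compact_support \<psi>"
    unfolding C1_compact_support_def
  proof (intro conjI allI)
    show "\<psi> differentiable at x" for x using der differentiableI by blast
    have "continuous_on UNIV (\<lambda>x. ?D (e x) w)" for w
    proof -
      have "continuous_on UNIV (\<lambda>x. ?D x w)"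
        using assms(1) unfolding C1_compact_support_def by blast
      from continuous_on_compose2[OF this cont_e] show ?thesis by simp
    qed
    then show "continuous_on UNIV (\<lambda>x. frechet_derivative \<psi> (at x) v)" for v
      unfolding fd by (intro linear_continuous_on_compose[OF _ lin(1)])
    have "bounded {x. \<phi> x \<noteq> 0}"
      using assms(1) unfolding C1_compact_support_def by (simp add: compact_closure)
    then have "bounded ((\<lambda>x. c + s *\<^sub>R Q x) ` {x. \<phi> x \<noteq> 0})"
      using bounded_linear_image[OF _ linear_conv_bounded_linear[THEN iffD1, OF lin(1)]]
      by (metis (no_types) bounded_scaling bounded_translation image_image)
    moreover have "{x. \<psi> x \<noteq> 0} \<subseteq> (\<lambda>x. c + s *\<^sub>R Q x) ` {x. \<phi> x \<noteq> 0}"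
    proof
      fix y assume "y \<in> {x. \<psi> x \<noteq> 0}"
      then have "\<phi> (e y) \<noteq> 0" using linear_0[OF lin(1)] by (auto simp: \<psi>_def e_def)
      moreover have "y = c + s *\<^sub>R Q (e y)" using assms(3) by (simp add: e_def QR)
      ultimately show "y \<in> (\<lambda>x. c + s *\<^sub>R Q x) ` {x. \<phi> x \<noteq> 0}" by blast
    qed
    ultimately show "compact (closure {x. \<psi> x \<noteq> 0})"
      by (simp add: compact_closure bounded_subset)
  qed
  have linD: "linear (?D x)"
    using C1_compact_support_has_derivative[OF assms(1)] has_derivative_linear by blast
  have "matrix ?R ** matrix Q = mat 1"
    using matrix_compose[OF lin(1) lin(2)] by (simp add: o_def QR matrix_id_mat_1[unfolded id_def])
  moreover have "(\<lambda>v. Q (?D x (?R ((1/s) *\<^sub>R v)))) = (\<lambda>v. (1/s) *\<^sub>R (Q \<circ> (?D x \<circ> ?R)) v)" 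
    by (simp add: fun_eq_iff linear_scale[OF lin(1)] linear_scale[OF lin(2)] linear_scale[OF linD])
  moreover have "matrix (\<lambda>v. (1/s) *\<^sub>R f v) = (1/s) *\<^sub>R matrix f" for f :: "real^'n \<Rightarrow> real^'n"
    by (simp add: matrix_def vec_eq_iff)
  moreover have "trace (a *\<^sub>R A) = a * trace A" for a and A :: "real^'n^'n"
    by (simp add: trace_def sum_distrib_left)
  moreover have "matrix (Q \<circ> (?D x \<circ> ?R)) = matrix Q ** (matrix (?D x) ** matrix ?R)"
    by (simp add: matrix_compose lin linD linear_compose)
  moreover have "trace (matrix Q ** (matrix (?D x) ** matrix ?R)) = trace (matrix (?D x) ** (matrix ?R ** matrix Q))"
    by (subst trace_mul_sym) (simp only: matrix_mul_assoc)
  ultimately show "divergence \<psi> (s *\<^sub>R Q x + c) = divergence \<phi> x / s"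
    unfolding divergence_def fd e by (simp add: o_def)
qed

lemma integral_similarity:
  fixes F :: "(real^3) set" and Q :: "real^3 \<Rightarrow> real^3" and f :: "real^3 \<Rightarrow> real"
  assumes "compact F" "orthogonal_transformation Q" "s > 0"
    and contf: "continuous_on ((\<lambda>x. s *\<^sub>R Q x + c) ` F) f"
  shows "compact ((\<lambda>x. s *\<^sub>R Q x + c) ` F)"
    and "integral ((\<lambda>x. s *\<^sub>R Q x + c) ` F) f = integral F (\<lambda>x. s^3 * f (s *\<^sub>R Q x + c))"
proof -
  let ?g = "\<lambda>x. s *\<^sub>R Q x + c"
  have lin: "linear Q" using assms(2) orthogonal_transformation_linear by auto
  have der: "(?g has_derivative (\<lambda>v. s *\<^sub>R Q v)) (at x within F)" for x
    using has_derivative_add_const[OF has_derivative_scaleR_right[OF linear_imp_has_derivative[OF lin]]] by blast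
  have inj: "inj_on ?g F"
    using orthogonal_transformation_inj[OF assms(2)] assms(3) by (auto simp: inj_on_def)
  show cg: "compact (?g ` F)"
    by (rule compact_continuous_image[OF has_derivative_continuous_on[OF der] assms(1)])
  have Fs: "F \<in> sets lebesgue" using assms(1) by (simp add: lmeasurable_compact fmeasurableD)
  have "matrix (\<lambda>v. s *\<^sub>R Q v) = s *\<^sub>R matrix Q" by (simp add: matrix_def vec_eq_iff)
  then have "det (matrix (\<lambda>v. s *\<^sub>R Q v)) = s^3 * det (matrix Q)"
    by (simp add: det_3 power3_eq_cube algebra_simps)
  then have det: "\<bar>det (matrix (\<lambda>v. s *\<^sub>R Q v))\<bar> = s^3"
    using assms(2,3) by (simp add: abs_mult)
  (* The library has the change of variables formula only for vector-valued functions. *)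
  let ?f = "\<lambda>y. vec (f y) :: real^1"
  have ai: "?f absolutely_integrable_on (?g ` F)"
    by (intro absolutely_integrable_continuous_compact[OF cg])
      (auto simp: vec_def intro!: continuous_on_vec_lambda contf)
  have aiF: "(\<lambda>x. s^3 *\<^sub>R ?f (?g x)) absolutely_integrable_on F"
    using absolutely_integrable_change_of_variables[OF Fs der inj, of ?f] ai det by simp
  have "integral (?g ` F) f = integral (?g ` F) ?f $ 1"
    using integral_component_eq_cart[of ?f "?g ` F" 1] ai
    by (simp add: set_lebesgue_integral_eq_integral(1))
  also have "\<dots> = integral F (\<lambda>x. s^3 *\<^sub>R ?f (?g x)) $ 1"
    using integral_change_of_variables[OF Fs der inj, of ?f] ai det by simp
  also have "\<dots> = integral F (\<lambda>x. s^3 * f (?g x))"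
    using integral_component_eq_cart[of "\<lambda>x. s^3 *\<^sub>R ?f (?g x)" F 1] aiF
    by (auto simp: set_lebesgue_integral_eq_integral(1))
  finally show "integral (?g ` F) f = integral F (\<lambda>x. s^3 * f (?g x))" .
qed

text \<open>Admissible fields are carried along by the similarity: the divergence loses a factor s
  while volume gains s^3. One inequality is enough, since the inverse similarity supplies the
  other.\<close>

lemma perimeter_similarity_le:
  fixes F :: "(real^3) set" and Q :: "real^3 \<Rightarrow> real^3"
  assumes "compact F" "orthogonal_transformation Q" "s > 0"
  shows "perimeter F \<le> ereal (1 / s^2) * perimeter ((\<lambda>x. s *\<^sub>R Q x + c) ` F)"
  unfolding perimeter_def[of F]
proof (rule SUP_least)
  fix \<phi> :: "real^3 \<Rightarrow> real^3"
  assume "\<phi> \<in> {\<phi>. C1_compact_support \<phi> \<and> (\<forall>x. norm (\<phi> x) \<le> 1)}"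
  then have \<phi>: "C1_compact_support \<phi>" and le1: "\<And>x. norm (\<phi> x) \<le> 1" by auto
  define \<psi> where "\<psi> = (\<lambda>y. Q (\<phi> (inv Q ((1/s) *\<^sub>R (y - c)))))"
  have D: "C1_compact_support \<psi>" "divergence \<psi> (s *\<^sub>R Q x + c) = divergence \<phi> x / s" for x
    unfolding \<psi>_def using divergence_conjugate[where \<phi>=\<phi> and Q=Q and s=s and c=c] \<phi> assms(2,3) by blast+
  let ?g = "\<lambda>x. s *\<^sub>R Q x + c"
  note sim = integral_similarity[OF assms continuous_on_divergence[OF D(1)]]
  have dI: "(LINT x:S|lebesgue. divergence \<theta> x) = integral S (divergence \<theta>)"
    if "C1_compact_support \<theta>" "compact S" for S and \<theta> :: "real^3 \<Rightarrow> real^3"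
    using set_lebesgue_integral_eq_integral(2)[OF absolutely_integrable_continuous_compact[OF that(2)]]
      continuous_on_divergence[OF that(1)] by blast
  have "integral (?g ` F) (divergence \<psi>) = integral F (\<lambda>x. s^3 * divergence \<psi> (?g x))"
    by (rule sim(2))
  also have "\<dots> = integral F (\<lambda>x. s^2 * divergence \<phi> x)"
    unfolding D(2) using assms(3) by (simp add: power2_eq_square power3_eq_cube)
  finally have "(LINT x:F|lebesgue. divergence \<phi> x) = 1 / s^2 * (LINT x:?g ` F|lebesgue. divergence \<psi> x)"
    using dI[OF \<phi> assms(1)] dI[OF D(1) sim(1)] assms(3) by simp
  moreover have "norm (\<psi> x) \<le> 1" for x
    using le1 assms(2) by (simp add: \<psi>_def orthogonal_transformation_norm)
  then have "ereal (LINT x:?g ` F|lebesgue. divergence \<psi> x) \<le> perimeter (?g ` F)"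
    unfolding perimeter_def using D(1) by (intro SUP_upper) auto
  then have "ereal (1 / s^2) * ereal (LINT x:?g ` F|lebesgue. divergence \<psi> x) \<le> ereal (1 / s^2) * perimeter (?g ` F)"
    by (rule ereal_mult_left_mono) simp
  ultimately show "ereal (LINT x:F|lebesgue. divergence \<phi> x) \<le> ereal (1 / s^2) * perimeter (?g ` F)"
    by simp
qed

section \<open>Mollifying coordinatewise monotone fields\<close>

text \<open>The kernel is a multiple of (max 0 (1 - |x|^2 / \<eta>^2))^2, the square making it C^1
  with gradient \<open>g\<close>. The quadratic Taylor estimate, uniform in x, takes the place of
  differentiation under the integral sign later.\<close>

lemma C1_bump:
  fixes \<eta> :: real
  assumes "\<eta> > 0"
  obtains \<rho> :: "'a::euclidean_space \<Rightarrow> real" and g :: "'a \<Rightarrow> 'a" and C G R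
  where "\<And>x. \<rho> x \<ge> 0" "\<And>x. norm x \<ge> \<eta> \<Longrightarrow> \<rho> x = 0"
    "\<And>x. \<rho> x \<le> R" "continuous_on UNIV \<rho>" "integrable lborel \<rho>" "integral\<^sup>L lborel \<rho> = 1"
    "continuous_on UNIV g" "\<And>x. norm (g x) \<le> G" "C \<ge> 0"
    "\<And>x h. norm h \<le> 1 \<Longrightarrow> \<bar>\<rho> (x + h) - \<rho> x - g x \<bullet> h\<bar> \<le> C * (norm h)\<^sup>2"
proof -
  define s where "s = 1 / \<eta>\<^sup>2"
  have s: "s > 0" using assms by (simp add: s_def)
  define b :: "'a \<Rightarrow> real" where "b x = max 0 (1 - s * (x \<bullet> x))" for x
  define r where "r x = (b x)\<^sup>2" for x
  have b0: "b x \<ge> 0" and b1: "b x \<le> 1" for x using s by (auto simp: b_def)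
  have bz: "b x = 0" if "norm x \<ge> \<eta>" for x
  proof -
    have "\<eta>\<^sup>2 \<le> x \<bullet> x" using that assms by (simp add: power2_norm_eq_inner[symmetric] power_mono)
    then show ?thesis using assms by (simp add: b_def s_def field_simps)
  qed
  have cb: "continuous_on UNIV b" unfolding b_def by (intro continuous_intros)
  have cr: "continuous_on UNIV r" unfolding r_def by (intro continuous_intros cb)
  have ri: "integrable lborel r"
  proof -
    have "integrable lborel (\<lambda>x. indicator (cball 0 \<eta>) x *\<^sub>R r x)"
      by (rule borel_integrable_compact) (auto intro: continuous_on_subset[OF cr])
    moreover have "(\<lambda>x. indicator (cball 0 \<eta>) x *\<^sub>R r x) = r"
      by (auto simp: fun_eq_iff indicator_def r_def bz)
    ultimately show ?thesis by simp
  qed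
  \<comment> \<open>Otherwise r vanishes almost everywhere, although it is positive on the whole
    open ball of radius \<eta>.\<close>
  have pos: "integral\<^sup>L lborel r > 0"
  proof (rule ccontr)
    assume "\<not> integral\<^sup>L lborel r > 0"
    moreover have "integral\<^sup>L lborel r \<ge> 0" by (simp add: r_def)
    ultimately have "AE x in lborel. r x = 0"
      using integral_nonneg_eq_0_iff_AE[OF ri] by (simp add: r_def)
    then have "AE x in lborel. x \<notin> ball (0::'a) \<eta>"
    proof (rule AE_mp, intro AE_I2 impI)
      fix x :: 'a assume "r x = 0"
      then have "s * (x \<bullet> x) \<ge> 1" by (auto simp: r_def b_def max_def split: if_splits)
      then have "norm x ^ 2 \<ge> \<eta>\<^sup>2"
        using assms by (simp add: s_def power2_norm_eq_inner field_simps)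
      then have "\<eta> \<le> norm x" by (rule power2_le_imp_le) simp
      then show "x \<notin> ball 0 \<eta>" by simp
    qed
    then have "ball (0::'a) \<eta> \<in> null_sets lborel"
      by (subst AE_iff_null_sets) auto
    then have "measure lborel (ball (0::'a) \<eta>) = 0"
      by (simp add: measure_def null_setsD1)
    then show False using content_ball_pos[OF assms, of "0::'a"] by simp
  qed
  define k where "k = 1 / integral\<^sup>L lborel r"
  have k: "k > 0" using pos by (simp add: k_def)
  define g where "g x = (- 4 * k * s * b x) *\<^sub>R x" for x
  define C where "C = k * ((s * (2 * \<eta> + 3))\<^sup>2 + 2 * s)"
  have Cn: "C \<ge> 0" unfolding C_def using k s by simp
  \<comment> \<open>Taylor estimate for (max 0 (1 - t))^2, whose derivative -2 max 0 (1 - t) is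
    2-Lipschitz; it is composed below with t = s |x|^2.\<close>
  have quad: "\<bar>(max 0 (1 - t'))\<^sup>2 - (max 0 (1 - t))\<^sup>2 + 2 * max 0 (1 - t) * (t' - t)\<bar> \<le> (t' - t)\<^sup>2" for t t' :: real
  proof -
    define u v where "u = max 0 (1 - t)" and "v = max 0 (1 - t')"
    have lip: "\<bar>v - u\<bar> \<le> \<bar>t' - t\<bar>" unfolding u_def v_def by (auto simp: max_def)
    have "v\<^sup>2 - u\<^sup>2 + 2 * u * (t' - t) = (v - u)\<^sup>2 + 2 * u * ((v - u) + (t' - t))"
      by (simp add: power2_eq_square algebra_simps)
    moreover have "0 \<le> 2 * u * ((v - u) + (t' - t)) \<and> (v - u)\<^sup>2 + 2 * u * ((v - u) + (t' - t)) \<le> (t' - t)\<^sup>2"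
    proof (cases "t \<le> 1 \<and> t' > 1")
      case True
      then have uv: "u = 1 - t" "v = 0" "t' - 1 \<ge> 0" "u \<ge> 0" by (auto simp: u_def v_def)
      have e: "(v - u) + (t' - t) = t' - 1" using uv by simp
      have "t' - t = u + (t' - 1)" using uv by simp
      then have "(t' - t)\<^sup>2 = u\<^sup>2 + 2 * u * (t' - 1) + (t' - 1)\<^sup>2"
        by (simp only: power2_sum)
      moreover have "(v - u)\<^sup>2 = u\<^sup>2" using uv(2) by simp
      moreover have "0 \<le> 2 * u * (t' - 1)" using uv by simp
      ultimately show ?thesis unfolding e using zero_le_power2[of "t' - 1"] by linarith
    next
      case False
      then have "u = 0 \<or> (v - u) + (t' - t) = 0" by (auto simp: u_def v_def)
      then show ?thesis using lip by (auto simp: abs_le_square_iff)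
    qed
    ultimately show ?thesis unfolding u_def v_def by (smt (verit) zero_le_power2)
  qed
  show ?thesis
  proof (rule that[of "\<lambda>x. k * r x" k g "4 * k * s * \<eta>" C])
    show "k * r x \<le> k" for x
      using b0[of x] b1[of x] k by (simp add: r_def mult_left_le power_le_one)
    show "k * r x \<ge> 0" for x using k by (simp add: r_def)
    show "k * r x = 0" if "norm x \<ge> \<eta>" for x using bz[OF that] by (simp add: r_def)
    show "continuous_on UNIV (\<lambda>x. k * r x)" by (intro continuous_intros cr)
    show "integrable lborel (\<lambda>x. k * r x)" using ri by simp
    show "integral\<^sup>L lborel (\<lambda>x. k * r x) = 1" using pos by (simp add: k_def)
    show "continuous_on UNIV g" unfolding g_def by (intro continuous_intros cb)
    show "norm (g x) \<le> 4 * k * s * \<eta>" for x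
    proof (cases "norm x \<ge> \<eta>")
      case True then show ?thesis using bz[OF True] k s assms by (simp add: g_def)
    next
      case False
      then have "b x * norm x \<le> 1 * \<eta>" using b0[of x] b1[of x] assms by (intro mult_mono) auto
      then show ?thesis using k s b0[of x] by (simp add: g_def abs_mult)
    qed
    show "C \<ge> 0" by (rule Cn)
    show "\<bar>k * r (x + h) - k * r x - g x \<bullet> h\<bar> \<le> C * (norm h)\<^sup>2" if h: "norm h \<le> 1" for x h :: 'a
    proof (cases "norm x \<ge> \<eta> + 1")
      \<comment> \<open>Both x and x + h lie outside the open ball of radius \<eta>, so every term
        vanishes.\<close>
      case True
      have "norm x \<le> norm (x + h) + norm h" using norm_triangle_ineq4[of "x + h" h] by simp
      then have "norm (x + h) \<ge> \<eta>" using h True by linarith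
      then show ?thesis using True Cn by (simp add: g_def r_def bz)
    next
      case False
      define t t' where "t = s * (x \<bullet> x)" and "t' = s * ((x + h) \<bullet> (x + h))"
      have d: "t' - t = s * (2 * (x \<bullet> h) + h \<bullet> h)"
        by (simp add: t_def t'_def algebra_simps inner_commute)
      have "\<bar>2 * (x \<bullet> h) + h \<bullet> h\<bar> \<le> 2 * (norm x * norm h) + norm h * norm h"
        using Cauchy_Schwarz_ineq2[of x h] dot_square_norm[of h] abs_triangle_ineq[of "2 * (x \<bullet> h)" "h \<bullet> h"]
        by (simp add: power2_eq_square abs_mult)
      \<comment> \<open>2 \<eta> + 3 is 2 (\<eta> + 1) + 1, from |x| < \<eta> + 1 and |h| <=
        1.\<close>
      also have "\<dots> \<le> (2 * \<eta> + 3) * norm h"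
      proof -
        have "norm x * norm h \<le> (\<eta> + 1) * norm h" using False by (intro mult_right_mono) auto
        moreover have "norm h * norm h \<le> 1 * norm h" using h by (intro mult_right_mono) auto
        ultimately show ?thesis by (simp add: algebra_simps)
      qed
      finally have "\<bar>t' - t\<bar> \<le> s * ((2 * \<eta> + 3) * norm h)"
        unfolding d using s by (simp add: abs_mult)
      then have sq: "(t' - t)\<^sup>2 \<le> (s * ((2 * \<eta> + 3) * norm h))\<^sup>2"
        by (metis abs_ge_zero power2_abs power_mono)
      define X where "X = r (x + h) - r x + 2 * b x * (t' - t)"
      have X: "\<bar>X\<bar> \<le> (t' - t)\<^sup>2"
        using quad[of t' t] by (simp add: X_def r_def b_def t_def t'_def)
      have Y: "0 \<le> 2 * b x * s * (h \<bullet> h)" "2 * b x * s * (h \<bullet> h) \<le> 2 * s * (norm h)\<^sup>2"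
        using b0[of x] b1[of x] s
        by (auto simp: power2_norm_eq_inner mult_right_mono mult_left_le_one_le mult.assoc)
      have "k * r (x + h) - k * r x - g x \<bullet> h = k * (X - 2 * b x * s * (h \<bullet> h))"
        unfolding X_def d g_def by (simp add: algebra_simps)
      then have "\<bar>k * r (x + h) - k * r x - g x \<bullet> h\<bar> = k * \<bar>X - 2 * b x * s * (h \<bullet> h)\<bar>"
        using k by (simp add: abs_mult)
      also have "\<dots> \<le> k * ((s * ((2 * \<eta> + 3) * norm h))\<^sup>2 + 2 * s * (norm h)\<^sup>2)"
        using X Y sq k by (intro mult_left_mono) linarith+
      also have "\<dots> = C * (norm h)\<^sup>2" by (simp add: C_def power2_eq_square algebra_simps)
      finally show ?thesis .
    qed
  qed
qed

text \<open>All smoothness comes from the kernel: its Taylor estimate is integrated against the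
  merely integrable T. The error bound is uniform in x, which later compares difference quotients of
  \<phi> with its divergence on a whole compact set.\<close>

lemma convolution_C1_quadratic:
  fixes \<rho> :: "'a::euclidean_space \<Rightarrow> real" and T :: "'a \<Rightarrow> 'b::euclidean_space"
  assumes T: "integrable lborel T"
    and \<rho>: "\<And>x. \<rho> x \<ge> 0" "continuous_on UNIV \<rho>" "\<And>x. \<rho> x \<le> R"
    and g: "continuous_on UNIV g" "\<And>x. norm (g x) \<le> G"
    and C: "\<And>x h. norm h \<le> 1 \<Longrightarrow> \<bar>\<rho> (x + h) - \<rho> x - g x \<bullet> h\<bar> \<le> C * (norm h)\<^sup>2"
  defines "\<phi> \<equiv> \<lambda>x. \<integral>y. \<rho> (x - y) *\<^sub>R T y \<partial>lborel"
    and "D \<equiv> \<lambda>x h. \<integral>y. (g (x - y) \<bullet> h) *\<^sub>R T y \<partial>lborel"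
  shows "integrable lborel (\<lambda>y. \<rho> (x - y) *\<^sub>R T y)" 
    and "norm h \<le> 1 \<Longrightarrow> norm (\<phi> (x + h) - \<phi> x - D x h) \<le> C * (\<integral>y. norm (T y) \<partial>lborel) * (norm h)\<^sup>2"
    and "(\<phi> has_derivative D x) (at x)"
    and "continuous_on UNIV (\<lambda>x. D x h)"
proof -
  have [measurable]: "\<rho> \<in> borel_measurable borel" "g \<in> borel_measurable borel"
    using \<rho>(2) g(1) by (auto intro: borel_measurable_continuous_onI)
  have [measurable]: "T \<in> borel_measurable borel" using T by (simp add: borel_measurable_integrable)
  have Gn: "G \<ge> 0" using g(2)[of 0] norm_ge_zero order_trans by blast
  have i1: "integrable lborel (\<lambda>y. \<rho> (x - y) *\<^sub>R T y)" for x
  proof (rule Bochner_Integration.integrable_bound)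
    show "integrable lborel (\<lambda>y. R *\<^sub>R T y)" using T by simp
    have "\<bar>\<rho> z\<bar> \<le> \<bar>R\<bar>" for z using \<rho>(1,3)[of z] by simp
    then show "AE y in lborel. norm (\<rho> (x - y) *\<^sub>R T y) \<le> norm (R *\<^sub>R T y)"
      by (intro AE_I2) (simp add: mult_right_mono)
  qed measurable
  then show "integrable lborel (\<lambda>y. \<rho> (x - y) *\<^sub>R T y)" for x .
  have i2: "integrable lborel (\<lambda>y. (g (x - y) \<bullet> h) *\<^sub>R T y)" for x h
  proof (rule Bochner_Integration.integrable_bound)
    show "integrable lborel (\<lambda>y. (G * norm h) *\<^sub>R T y)" using T by simp
    show "AE y in lborel. norm ((g (x - y) \<bullet> h) *\<^sub>R T y) \<le> norm ((G * norm h) *\<^sub>R T y)"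
    proof (rule AE_I2)
      fix y
      have "\<bar>g (x - y) \<bullet> h\<bar> \<le> G * norm h"
        using Cauchy_Schwarz_ineq2[of "g (x - y)" h] g(2)[of "x - y"]
        by (meson mult_right_mono norm_ge_zero order_trans)
      then show "norm ((g (x - y) \<bullet> h) *\<^sub>R T y) \<le> norm ((G * norm h) *\<^sub>R T y)"
        using Gn by (simp add: mult_right_mono)
    qed
  qed measurable
  have quad: "norm (\<phi> (x + h) - \<phi> x - D x h) \<le> C * (\<integral>y. norm (T y) \<partial>lborel) * (norm h)\<^sup>2" if h: "norm h \<le> 1" for x h
  proof -
    have "\<phi> (x + h) - \<phi> x - D x h = (\<integral>y. (\<rho> (x + h - y) - \<rho> (x - y) - g (x - y) \<bullet> h) *\<^sub>R T y \<partial>lborel)"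
      unfolding \<phi>_def D_def scaleR_diff_left
      by (simp add: Bochner_Integration.integral_diff i1 i2)
    also have "norm \<dots> \<le> (\<integral>y. (C * (norm h)\<^sup>2) * norm (T y) \<partial>lborel)"
    proof (rule Bochner_Integration.integral_norm_bound_integral)
      show "integrable lborel (\<lambda>y. (\<rho> (x + h - y) - \<rho> (x - y) - g (x - y) \<bullet> h) *\<^sub>R T y)"
        unfolding scaleR_diff_left by (intro Bochner_Integration.integrable_diff i1 i2)
      show "integrable lborel (\<lambda>y. (C * (norm h)\<^sup>2) * norm (T y))" using T by simp
      fix y
      have "\<bar>\<rho> (x + h - y) - \<rho> (x - y) - g (x - y) \<bullet> h\<bar> \<le> C * (norm h)\<^sup>2"
        using C[OF h, of "x - y"] by (simp add: algebra_simps)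
      then show "norm ((\<rho> (x + h - y) - \<rho> (x - y) - g (x - y) \<bullet> h) *\<^sub>R T y) \<le> (C * (norm h)\<^sup>2) * norm (T y)"
        by (simp add: mult_right_mono)
    qed
    finally show ?thesis by (simp add: mult_ac)
  qed
  then show "norm h \<le> 1 \<Longrightarrow> norm (\<phi> (x + h) - \<phi> x - D x h) \<le> C * (\<integral>y. norm (T y) \<partial>lborel) * (norm h)\<^sup>2" for x h .
  show "(\<phi> has_derivative D x) (at x)"
    unfolding has_derivative_at
  proof
    show "bounded_linear (D x)"
    proof (rule linear_conv_bounded_linear[THEN iffD1], rule linearI)
      show "D x (u + v) = D x u + D x v" for u v
        unfolding D_def inner_add_right scaleR_add_left by (simp add: i2)
      show "D x (c *\<^sub>R u) = c *\<^sub>R D x u" for c u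
        unfolding D_def using integral_scaleR_right[of lborel c "\<lambda>y. (g (x - y) \<bullet> u) *\<^sub>R T y"] i2 by simp
    qed
    define K where "K = C * (\<integral>y. norm (T y) \<partial>lborel)"
    show "(\<lambda>h. norm (\<phi> (x + h) - \<phi> x - D x h) / norm h) \<midarrow>0\<rightarrow> 0"
    proof (rule tendsto_sandwich[OF always_eventually])
      show "\<forall>h. 0 \<le> norm (\<phi> (x + h) - \<phi> x - D x h) / norm h" by simp
      have "norm (\<phi> (x + h) - \<phi> x - D x h) / norm h \<le> K * norm h" if "h \<noteq> 0" "norm h < 1" for h
        using quad[of h x] that by (simp add: K_def field_simps power2_eq_square)
      then show "\<forall>\<^sub>F h in at 0. norm (\<phi> (x + h) - \<phi> x - D x h) / norm h \<le> K * norm h"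
        unfolding eventually_at by (intro exI[of _ 1]) auto
      show "(\<lambda>h. K * norm h) \<midarrow>0\<rightarrow> 0" by (auto intro!: tendsto_eq_intros)
    qed auto
  qed
  show "continuous_on UNIV (\<lambda>x. D x h)"
    unfolding continuous_on_eq_continuous_at[OF open_UNIV] continuous_at_sequentially
  proof (intro ballI allI impI)
    fix x :: 'a and X assume X: "X \<longlonglongrightarrow> x"
    show "((\<lambda>x. D x h) \<circ> X) \<longlonglongrightarrow> D x h"
      unfolding D_def o_def
    proof (rule integral_dominated_convergence)
      show "integrable lborel (\<lambda>y. norm ((G * norm h) *\<^sub>R T y))" using T by simp
      show "AE y in lborel. (\<lambda>n. (g (X n - y) \<bullet> h) *\<^sub>R T y) \<longlonglongrightarrow> (g (x - y) \<bullet> h) *\<^sub>R T y"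
      proof (rule AE_I2)
        fix y
        have "isCont g (x - y)" using g(1) by (simp add: continuous_on_eq_continuous_at)
        then have "(\<lambda>n. g (X n - y)) \<longlonglongrightarrow> g (x - y)"
          by (rule isCont_tendsto_compose) (intro tendsto_intros X)
        then show "(\<lambda>n. (g (X n - y) \<bullet> h) *\<^sub>R T y) \<longlonglongrightarrow> (g (x - y) \<bullet> h) *\<^sub>R T y"
          by (intro tendsto_intros)
      qed
      show "AE y in lborel. norm ((g (X n - y) \<bullet> h) *\<^sub>R T y) \<le> norm ((G * norm h) *\<^sub>R T y)" for n
      proof (rule AE_I2)
        fix y
        have "\<bar>g (X n - y) \<bullet> h\<bar> \<le> G * norm h"
          using Cauchy_Schwarz_ineq2[of "g (X n - y)" h] g(2)[of "X n - y"]
          by (meson mult_right_mono norm_ge_zero order_trans)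
        then show "norm ((g (X n - y) \<bullet> h) *\<^sub>R T y) \<le> norm ((G * norm h) *\<^sub>R T y)"
          using Gn by (simp add: mult_right_mono)
      qed
    qed measurable
  qed
qed

section \<open>Translations, reflections and convolutions under the Lebesgue integral\<close>

lemma nn_integral_lborel_translate:
  fixes f :: "'a::euclidean_space \<Rightarrow> ennreal"
  assumes [measurable]: "f \<in> borel_measurable borel"
  shows "(\<integral>\<^sup>+x. f (x + c) \<partial>lborel) = (\<integral>\<^sup>+x. f x \<partial>lborel)"
proof -
  have "(\<integral>\<^sup>+x. f x \<partial>lborel) = (\<integral>\<^sup>+x. f x \<partial>distr lborel borel ((+) c))"
    by (simp add: lborel_distr_plus)
  also have "\<dots> = (\<integral>\<^sup>+x. f (c + x) \<partial>lborel)"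
    by (rule nn_integral_distr) auto
  finally show ?thesis by (simp add: add.commute)
qed

lemma integral_lborel_translate:
  fixes f :: "'a::euclidean_space \<Rightarrow> 'b::{banach, second_countable_topology}"
  assumes [measurable]: "f \<in> borel_measurable borel"
  shows "integrable lborel (\<lambda>x. f (x + c)) \<longleftrightarrow> integrable lborel f"
    and "(\<integral>x. f (x + c) \<partial>lborel) = (\<integral>x. f x \<partial>lborel)"
  using integrable_distr_eq[of "(+) c" lborel borel f] integral_distr[of "(+) c" lborel borel f]
  by (simp_all add: lborel_distr_plus add.commute)

lemma integral_lborel_reflect:
  fixes f :: "'a::euclidean_space \<Rightarrow> 'b::{banach, second_countable_topology}"
  assumes [measurable]: "f \<in> borel_measurable borel"
  shows "integrable lborel (\<lambda>x. f (c - x)) \<longleftrightarrow> integrable lborel f"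
    and "(\<integral>x. f (c - x) \<partial>lborel) = (\<integral>x. f x \<partial>lborel)"
proof -
  have "distr lborel borel (\<lambda>y. c - y) = (lborel :: 'a measure)"
    by (subst lborel_affine[of "-1" c]) (auto simp: density_1)
  then show "integrable lborel (\<lambda>x. f (c - x)) \<longleftrightarrow> integrable lborel f"
    and "(\<integral>x. f (c - x) \<partial>lborel) = (\<integral>x. f x \<partial>lborel)"
    using integrable_distr_eq[of "\<lambda>y. c - y" lborel borel f] integral_distr[of "\<lambda>y. c - y" lborel borel f]
    by simp_all
qed

text \<open>By Tonelli: the unit mass of \<rho> spreads the value at a point of K' over distance
  less than \<eta> only, so none of it leaves K.\<close>

lemma nn_integral_convolution_ge:
  fixes q :: "'a::euclidean_space \<Rightarrow> ennreal" and \<rho> :: "'a \<Rightarrow> real"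
  assumes [measurable]: "q \<in> borel_measurable borel" "\<rho> \<in> borel_measurable borel" "K \<in> sets borel" "K' \<in> sets borel"
    and \<rho>: "\<And>x. norm x \<ge> \<eta> \<Longrightarrow> \<rho> x = 0" "(\<integral>\<^sup>+y. ennreal (\<rho> y) \<partial>lborel) = 1"
    and K: "\<And>x y. x \<in> K' \<Longrightarrow> norm y < \<eta> \<Longrightarrow> x + y \<in> K"
  shows "(\<integral>\<^sup>+x\<in>K'. q x \<partial>lborel) \<le> (\<integral>\<^sup>+x\<in>K. (\<integral>\<^sup>+y. ennreal (\<rho> (x - y)) * q y \<partial>lborel) \<partial>lborel)"
proof -
  have "(\<integral>\<^sup>+x\<in>K'. q x \<partial>lborel) = (\<integral>\<^sup>+y. q y * indicator K' y * (\<integral>\<^sup>+x. ennreal (\<rho> x) \<partial>lborel) \<partial>lborel)"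
    by (simp add: \<rho>)
  also have "\<dots> \<le> (\<integral>\<^sup>+y. (\<integral>\<^sup>+x. ennreal (\<rho> (x - y)) * q y * indicator K x \<partial>lborel) \<partial>lborel)"
  proof (rule nn_integral_mono)
    fix y :: 'a
    have "q y * indicator K' y * (\<integral>\<^sup>+x. ennreal (\<rho> x) \<partial>lborel)
        = (\<integral>\<^sup>+x. q y * indicator K' y * ennreal (\<rho> x) \<partial>lborel)"
      by (simp add: nn_integral_cmult)
    also have "\<dots> \<le> (\<integral>\<^sup>+x. ennreal (\<rho> x) * q y * indicator K (x + y) \<partial>lborel)"
    proof (rule nn_integral_mono)
      fix x :: 'a
      show "q y * indicator K' y * ennreal (\<rho> x) \<le> ennreal (\<rho> x) * q y * indicator K (x + y)"
        using \<rho>(1)[of x] K[of y x]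
        by (cases "norm x < \<eta>") (auto simp: indicator_def mult.commute add.commute)
    qed
    also have "\<dots> = (\<integral>\<^sup>+x. ennreal (\<rho> (x - y)) * q y * indicator K x \<partial>lborel)"
      using nn_integral_lborel_translate[of "\<lambda>x. ennreal (\<rho> (x - y)) * q y * indicator K x" y] by simp
    finally show "q y * indicator K' y * (\<integral>\<^sup>+x. ennreal (\<rho> x) \<partial>lborel)
        \<le> (\<integral>\<^sup>+x. ennreal (\<rho> (x - y)) * q y * indicator K x \<partial>lborel)" .
  qed
  also have "\<dots> = (\<integral>\<^sup>+x. (\<integral>\<^sup>+y. ennreal (\<rho> (x - y)) * q y * indicator K x \<partial>lborel) \<partial>lborel)"
    by (rule lborel_pair.Fubini') (simp add: split_beta)
  also have "\<dots> = (\<integral>\<^sup>+x\<in>K. (\<integral>\<^sup>+y. ennreal (\<rho> (x - y)) * q y \<partial>lborel) \<partial>lborel)"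
    by (simp add: nn_integral_multc)
  finally show ?thesis .
qed

lemma borel_measurable_vec_nth [measurable (raw)]:
  fixes f :: "'a \<Rightarrow> real^'n"
  assumes "f \<in> borel_measurable M"
  shows "(\<lambda>x. f x $ i) \<in> borel_measurable M"
  using borel_measurable_inner[OF assms borel_measurable_const[of "axis i 1"]] by (simp add: inner_axis)

(* The perimeter is tested with mollifications of T; monotonicity makes the difference quotients
   nonnegative, so that Fatou applies and T need not be continuous. *)
lemma perimeter_ge_nn_integral_partials:
  fixes T :: "real^'n \<Rightarrow> real^'n" and d :: "'n \<Rightarrow> real^'n \<Rightarrow> real"
  assumes T[measurable]: "T \<in> borel_measurable borel" and bT: "bounded {x. T x \<noteq> 0}" and T1: "\<And>x. norm (T x) \<le> 1"
    and K: "compact K" and \<eta>: "\<eta> > 0"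
    and K'[measurable]: "K' \<in> sets borel" and KK': "\<And>x y. x \<in> K' \<Longrightarrow> norm y < \<eta> \<Longrightarrow> x + y \<in> K"
    and \<tau>: "\<tau> > 0"
    and mono: "\<And>x y t i. x \<in> K \<Longrightarrow> norm y < \<eta> \<Longrightarrow> 0 < t \<Longrightarrow> t < \<tau> \<Longrightarrow>
      T (x + y) $ i \<le> T (x + y + t *\<^sub>R axis i 1) $ i"
    and deriv: "\<And>x i. x \<in> K' \<Longrightarrow> ((\<lambda>t. T (x + t *\<^sub>R axis i 1) $ i) has_real_derivative d i x) (at 0)"
    and p: "perimeter K \<le> ereal p"
  shows "(\<integral>\<^sup>+x\<in>K'. ennreal (\<Sum>i\<in>UNIV. d i x) \<partial>lborel) \<le> ennreal p"
proof -
  obtain \<rho> :: "real^'n \<Rightarrow> real" and g C G R where \<rho>: "\<And>x. \<rho> x \<ge> 0" "\<And>x. norm x \<ge> \<eta> \<Longrightarrow> \<rho> x = 0"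
    "\<And>x. \<rho> x \<le> R" "continuous_on UNIV \<rho>" "integrable lborel \<rho>" "integral\<^sup>L lborel \<rho> = 1"
    and g: "continuous_on UNIV g" "\<And>x. norm (g x) \<le> G" and C: "C \<ge> 0"
    "\<And>x h. norm h \<le> 1 \<Longrightarrow> \<bar>\<rho> (x + h) - \<rho> x - g x \<bullet> h\<bar> \<le> C * (norm h)\<^sup>2"
    by (rule C1_bump[OF \<eta>]) (rule that; assumption)
  have [measurable]: "\<rho> \<in> borel_measurable borel"
    using \<rho>(4) by (rule borel_measurable_continuous_onI)
  obtain r where r: "\<And>x. T x \<noteq> 0 \<Longrightarrow> norm x \<le> r"
    using bT unfolding bounded_iff by auto
  have Ti: "integrable lborel T"
  proof (rule Bochner_Integration.integrable_bound)
    show "integrable lborel (indicat_real (cball (0::real^'n) r))"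
      by (intro integrable_real_indicator) (use emeasure_bounded_finite[OF bounded_cball] in \<open>auto simp: top.not_eq_extremum\<close>)
    show "AE x in lborel. norm (T x) \<le> norm (indicat_real (cball 0 r) x)"
    proof (rule AE_I2)
      fix x show "norm (T x) \<le> norm (indicat_real (cball 0 r) x)"
        using T1[of x] r[of x] by (cases "T x = 0") (auto simp: indicator_def)
    qed
  qed measurable
  note conv = convolution_C1_quadratic[OF Ti \<rho>(1,4,3) g C(2)]
  define \<phi> where "\<phi> = (\<lambda>x. \<integral>y. \<rho> (x - y) *\<^sub>R T y \<partial>lborel)"
  define D where "D = (\<lambda>x h. \<integral>y. (g (x - y) \<bullet> h) *\<^sub>R T y \<partial>lborel)"
  have quad: "norm (\<phi> (x + h) - \<phi> x - D x h) \<le> C * (\<integral>y. norm (T y) \<partial>lborel) * (norm h)\<^sup>2" if "norm h \<le> 1" for x h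
    unfolding \<phi>_def D_def by (rule conv(2)[OF _ that]) simp_all
  have der: "(\<phi> has_derivative D x) (at x)" for x
    unfolding \<phi>_def D_def by (rule conv(3)) simp_all
  have Dc: "continuous_on UNIV (\<lambda>x. D x h)" for h
    unfolding D_def by (rule conv(4)) simp_all
  have int: "integrable lborel (\<lambda>y. \<rho> (x - y) *\<^sub>R T y)" for x
    by (rule conv(1)) simp_all
  have fd: "frechet_derivative \<phi> (at x) = D x" for x
    using frechet_derivative_at[OF der] by simp
  have supp: "norm x \<le> r + \<eta>" if "\<phi> x \<noteq> 0" for x
  proof (rule ccontr)
    assume a: "\<not> norm x \<le> r + \<eta>"
    have z: "\<rho> (x - y) *\<^sub>R T y = 0" for y
    proof (cases "T y = 0")
      case False
      then have "norm y \<le> r" by (rule r)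
      then have "norm (x - y) \<ge> \<eta>" using a norm_triangle_ineq2[of x y] by linarith
      then show ?thesis using \<rho>(2) by simp
    qed simp
    have "\<phi> x = 0" unfolding \<phi>_def z by simp
    then show False using that by simp
  qed
  have \<phi>: "C1_compact_support \<phi>"
    unfolding C1_compact_support_def
  proof (intro conjI allI)
    show "\<phi> differentiable at x" for x using der differentiableI by blast
    show "continuous_on UNIV (\<lambda>x. frechet_derivative \<phi> (at x) v)" for v unfolding fd by (rule Dc)
    have "bounded {x. \<phi> x \<noteq> 0}" unfolding bounded_iff using supp by blast
    then show "compact (closure {x. \<phi> x \<noteq> 0})" by (simp add: compact_closure)
  qed
  have \<rho>int: "integrable lborel (\<lambda>y. \<rho> (x - y))" "(\<integral>y. \<rho> (x - y) \<partial>lborel) = 1" for x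
    using integral_lborel_reflect[of \<rho> x] \<rho>(5,6) by simp_all
  have \<phi>1: "norm (\<phi> x) \<le> 1" for x
  proof -
    have "norm (\<phi> x) \<le> (\<integral>y. \<rho> (x - y) \<partial>lborel)"
      unfolding \<phi>_def
    proof (rule Bochner_Integration.integral_norm_bound_integral[OF int \<rho>int(1)])
      fix y show "norm (\<rho> (x - y) *\<^sub>R T y) \<le> \<rho> (x - y)"
        using T1[of y] \<rho>(1)[of "x - y"] by (simp add: mult_left_le)
    qed
    then show ?thesis using \<rho>int(2) by simp
  qed
  define m where "m = real CARD('n)"
  define A where "A = C * (\<integral>y. norm (T y) \<partial>lborel)"
  \<comment> \<open>\<open>q t\<close> is the divergence of T with difference quotients of step t in
    place of derivatives; \<open>c\<close> below is the same expression for \<phi>.\<close>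
  define q where "q t x = (\<Sum>i\<in>UNIV. (T (x + t *\<^sub>R axis i 1) $ i - T x $ i) / t)" for t x
  have qm[measurable]: "q t \<in> borel_measurable borel" for t unfolding q_def by measurable
  define I where "I = (LINT x:K|lebesgue. divergence \<phi> x)"
  have Ip: "I \<le> p"
  proof -
    have "ereal I \<le> perimeter K"
      unfolding perimeter_def I_def using \<phi> \<phi>1 by (intro SUP_upper) auto
    then show ?thesis using p by (meson ereal_less_eq(3) order_trans)
  qed
  have step: "(\<integral>\<^sup>+x\<in>K'. ennreal (q t x) \<partial>lborel) \<le> ennreal (I + m * A * t * measure lborel K)"
    if t: "0 < t" "t < \<tau>" "t \<le> 1" for t
  proof -
    define c where "c x = (\<Sum>i\<in>UNIV. (\<phi> (x + t *\<^sub>R axis i 1) $ i - \<phi> x $ i) / t)" for x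
    \<comment> \<open>The uniform quadratic estimate costs A t per coordinate.\<close>
    have c_le: "c x \<le> divergence \<phi> x + m * A * t" for x
    proof -
      have "(\<phi> (x + t *\<^sub>R axis i 1) $ i - \<phi> x $ i) / t \<le> D x (axis i 1) $ i + A * t" for i
      proof -
        have lin: "linear (D x)" using der has_derivative_linear by blast
        have "(\<phi> (x + t *\<^sub>R axis i 1) - \<phi> x - D x (t *\<^sub>R axis i 1)) $ i
            \<le> norm (\<phi> (x + t *\<^sub>R axis i 1) - \<phi> x - D x (t *\<^sub>R axis i 1))"
          using component_le_norm_cart[of _ i] abs_le_D1 by blast
        also have "\<dots> \<le> A * t\<^sup>2"
          using quad[of "t *\<^sub>R axis i 1" x] t by (simp add: A_def norm_axis_1)
        finally show ?thesis
          using t by (simp add: linear_scale[OF lin] field_simps power2_eq_square)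
      qed
      then have "c x \<le> (\<Sum>i\<in>UNIV. D x (axis i 1) $ i + A * t)"
        unfolding c_def by (intro sum_mono)
      then show ?thesis by (simp add: divergence_eq_sum fd sum.distrib m_def)
    qed
    \<comment> \<open>Difference quotients commute with convolution, so \<open>c\<close> is the
      mollification of \<open>q t\<close>.\<close>
    have qint: "integrable lborel (\<lambda>y. \<rho> (x - y) * q t y)"
      and c_eq: "c x = (\<integral>y. \<rho> (x - y) * q t y \<partial>lborel)" for x
    proof -
      have Tint: "integrable lborel (\<lambda>y. \<rho> (x - y) * T y $ i)" for x i
      proof -
        have "integrable lborel (\<lambda>y. (\<rho> (x - y) *\<^sub>R T y) \<bullet> axis i 1)"
          by (intro integrable_inner_left int)
        then show ?thesis by (simp add: inner_axis)
      qed
      have \<phi>i: "\<phi> x $ i = (\<integral>y. \<rho> (x - y) * T y $ i \<partial>lborel)" for x i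
      proof -
        have "(\<integral>y. (\<rho> (x - y) *\<^sub>R T y) \<bullet> axis i 1 \<partial>lborel) = \<phi> x \<bullet> axis i 1"
          unfolding \<phi>_def by (intro integral_inner_left int)
        then show ?thesis by (simp add: inner_axis)
      qed
      have shift: "integrable lborel (\<lambda>y. \<rho> (x - y) * T (y + t *\<^sub>R axis i 1) $ i)"
        "\<phi> (x + t *\<^sub>R axis i 1) $ i = (\<integral>y. \<rho> (x - y) * T (y + t *\<^sub>R axis i 1) $ i \<partial>lborel)" for i
        using integral_lborel_translate[of "\<lambda>y. \<rho> (x + t *\<^sub>R axis i 1 - y) * T y $ i" "t *\<^sub>R axis i 1"]
          Tint[of "x + t *\<^sub>R axis i 1" i]
        by (simp_all add: \<phi>i)
      have e: "\<rho> (x - y) * q t y = (\<Sum>i\<in>UNIV. (\<rho> (x - y) * T (y + t *\<^sub>R axis i 1) $ i - \<rho> (x - y) * T y $ i) / t)" for y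
        by (simp add: q_def sum_distrib_left right_diff_distrib)
      show "integrable lborel (\<lambda>y. \<rho> (x - y) * q t y)"
        unfolding e by (intro Bochner_Integration.integrable_sum integrable_divide_zero impI
            Bochner_Integration.integrable_diff shift Tint)
      have "(\<integral>y. \<rho> (x - y) * q t y \<partial>lborel) = (\<Sum>i\<in>UNIV. \<integral>y. (\<rho> (x - y) * T (y + t *\<^sub>R axis i 1) $ i - \<rho> (x - y) * T y $ i) / t \<partial>lborel)"
        unfolding e by (intro Bochner_Integration.integral_sum integrable_divide_zero impI
            Bochner_Integration.integrable_diff shift Tint)
      also have "\<dots> = c x"
        unfolding c_def using shift Tint
        by (simp add: Bochner_Integration.integral_diff \<phi>i[of x])
      finally show "c x = (\<integral>y. \<rho> (x - y) * q t y \<partial>lborel)" by simp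
    qed
    \<comment> \<open>The kernel sees only points within \<eta> of x, which is where T is assumed
      monotone.\<close>
    have nn: "0 \<le> \<rho> (x - y) * q t y" if "x \<in> K" for x y
    proof (cases "norm (y - x) < \<eta>")
      case True
      have "0 \<le> q t y"
        unfolding q_def
      proof (rule sum_nonneg)
        fix i :: 'n
        show "0 \<le> (T (y + t *\<^sub>R axis i 1) $ i - T y $ i) / t"
          using mono[OF that True t(1,2), of i] t(1) by simp
      qed
      then show ?thesis using \<rho>(1) by simp
    next
      case False
      then show ?thesis using \<rho>(2)[of "x - y"] by (simp add: norm_minus_commute)
    qed
    have c_enn: "ennreal (c x) = (\<integral>\<^sup>+y. ennreal (\<rho> (x - y)) * ennreal (q t y) \<partial>lborel)" "0 \<le> c x" if "x \<in> K" for x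
    proof -
      have "ennreal (c x) = (\<integral>\<^sup>+y. ennreal (\<rho> (x - y) * q t y) \<partial>lborel)"
        unfolding c_eq by (rule nn_integral_eq_integral[OF qint, symmetric]) (simp add: nn that)
      then show "ennreal (c x) = (\<integral>\<^sup>+y. ennreal (\<rho> (x - y)) * ennreal (q t y) \<partial>lborel)"
        using \<rho>(1) by (simp add: ennreal_mult')
      show "0 \<le> c x" unfolding c_eq by (intro Bochner_Integration.integral_nonneg) (simp add: nn that)
    qed
    have Km[measurable]: "K \<in> sets borel" using K by (simp add: borel_compact)
    have "(\<integral>\<^sup>+y. ennreal (\<rho> y) \<partial>lborel) = 1"
      using nn_integral_eq_integral[OF \<rho>(5)] \<rho>(1,6) by simp
    then have "(\<integral>\<^sup>+x\<in>K'. ennreal (q t x) \<partial>lborel)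
        \<le> (\<integral>\<^sup>+x\<in>K. (\<integral>\<^sup>+y. ennreal (\<rho> (x - y)) * ennreal (q t y) \<partial>lborel) \<partial>lborel)"
      by (intro nn_integral_convolution_ge[where \<eta>=\<eta>] \<rho>(2) KK') auto
    also have "\<dots> \<le> (\<integral>\<^sup>+x. ennreal (indicator K x *\<^sub>R (divergence \<phi> x + m * A * t)) \<partial>lborel)"
      using c_le by (intro nn_integral_mono) (auto simp: indicator_def c_enn(1)[symmetric] intro: ennreal_leI)
    also have "\<dots> = ennreal (\<integral>x. indicator K x *\<^sub>R (divergence \<phi> x + m * A * t) \<partial>lborel)"
    proof (rule nn_integral_eq_integral)
      show "integrable lborel (\<lambda>x. indicator K x *\<^sub>R (divergence \<phi> x + m * A * t))"
        by (rule borel_integrable_compact[OF K]) (intro continuous_intros continuous_on_divergence[OF \<phi>])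
      have "0 \<le> divergence \<phi> x + m * A * t" if "x \<in> K" for x
        using c_enn(2)[OF that] c_le[of x] by linarith
      then show "AE x in lborel. 0 \<le> indicator K x *\<^sub>R (divergence \<phi> x + m * A * t)"
        by (auto simp: indicator_def)
    qed
    also have "(\<integral>x. indicator K x *\<^sub>R (divergence \<phi> x + m * A * t) \<partial>lborel) = I + m * A * t * measure lborel K"
    proof -
      have i: "integrable lborel (\<lambda>x. indicator K x *\<^sub>R divergence \<phi> x)"
        by (rule borel_integrable_compact[OF K continuous_on_divergence[OF \<phi>]])
      have j: "integrable lborel (\<lambda>x. indicator K x *\<^sub>R (m * A * t))"
        by (rule borel_integrable_compact[OF K]) (intro continuous_intros)
      have "I = (\<integral>x. indicator K x *\<^sub>R divergence \<phi> x \<partial>lborel)"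
        unfolding I_def set_lebesgue_integral_def using integral_completion[OF borel_measurable_integrable[OF i]] .
      then show ?thesis
        unfolding scaleR_add_right using Bochner_Integration.integral_add[OF i j] by simp
    qed
    finally show ?thesis .
  qed
  \<comment> \<open>Fatou along t = 1 / (n + 1): on K' the quotients converge pointwise to the
    partial derivatives.\<close>
  have "(\<integral>\<^sup>+x\<in>K'. ennreal (\<Sum>i\<in>UNIV. d i x) \<partial>lborel)
      \<le> (\<integral>\<^sup>+x. liminf (\<lambda>n. ennreal (q (1 / Suc n) x) * indicator K' x) \<partial>lborel)"
  proof (rule nn_integral_mono)
    fix x :: "real^'n"
    show "ennreal (\<Sum>i\<in>UNIV. d i x) * indicator K' x \<le> liminf (\<lambda>n. ennreal (q (1 / Suc n) x) * indicator K' x)"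
    proof (cases "x \<in> K'")
      case True
      have lim0: "filterlim (\<lambda>n. 1 / real (Suc n)) (at 0) sequentially"
        using LIMSEQ_inverse_real_of_nat by (intro filterlim_atI) (auto simp: inverse_eq_divide)
      have "(\<lambda>n. (T (x + (1 / real (Suc n)) *\<^sub>R axis i 1) $ i - T x $ i) / (1 / real (Suc n))) \<longlonglongrightarrow> d i x" for i
        using filterlim_compose[OF deriv[OF True, of i, unfolded DERIV_def] lim0] by simp
      then have "(\<lambda>n. q (1 / real (Suc n)) x) \<longlonglongrightarrow> (\<Sum>i\<in>UNIV. d i x)"
        unfolding q_def by (intro tendsto_sum)
      then have "(\<lambda>n. ennreal (q (1 / real (Suc n)) x)) \<longlonglongrightarrow> ennreal (\<Sum>i\<in>UNIV. d i x)"
        by (rule tendsto_ennrealI)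
      then show ?thesis using True lim_imp_Liminf[OF sequentially_bot] by fastforce
    qed simp
  qed
  also have "\<dots> \<le> liminf (\<lambda>n. \<integral>\<^sup>+x\<in>K'. ennreal (q (1 / Suc n) x) \<partial>lborel)"
    by (rule nn_integral_liminf) measurable
  also have "\<dots> \<le> liminf (\<lambda>n. ennreal (I + m * A * (1 / Suc n) * measure lborel K))"
  proof (rule Liminf_mono)
    have "\<forall>\<^sub>F n in sequentially. 1 / real (Suc n) < \<tau>"
      using LIMSEQ_inverse_real_of_nat \<tau> by (auto simp: inverse_eq_divide dest: order_tendstoD(2))
    then show "\<forall>\<^sub>F n in sequentially. (\<integral>\<^sup>+x\<in>K'. ennreal (q (1 / Suc n) x) \<partial>lborel)
        \<le> ennreal (I + m * A * (1 / Suc n) * measure lborel K)"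
      by eventually_elim (intro step, auto)
  qed
  also have "\<dots> = ennreal I"
  proof (rule lim_imp_Liminf[OF sequentially_bot], rule tendsto_ennrealI)
    have "(\<lambda>n. I + m * A * inverse (real (Suc n)) * measure lborel K) \<longlonglongrightarrow> I + m * A * 0 * measure lborel K"
      by (intro tendsto_intros LIMSEQ_inverse_real_of_nat)
    then show "(\<lambda>n. I + m * A * (1 / real (Suc n)) * measure lborel K) \<longlonglongrightarrow> I"
      by (simp add: inverse_eq_divide)
  qed
  also have "\<dots> \<le> ennreal p" using Ip by (rule ennreal_leI)
  finally show ?thesis .
qed

section \<open>Slices of convex sets\<close>

definition slice :: "(real \<times> 'b) set \<Rightarrow> real \<Rightarrow> 'b set" where
  "slice C z = {p. (z, p) \<in> C}"

definition slice_vol :: "(real \<times> 'b::euclidean_space) set \<Rightarrow> real \<Rightarrow> real" where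
  "slice_vol C z = measure lborel (slice C z)"

text \<open>The distribution function of the first coordinate under the uniform probability on C. It
  is applied to the body and again to its planar slices.\<close>

definition slice_cdf :: "(real \<times> 'b::euclidean_space) set \<Rightarrow> real \<Rightarrow> real" where
  "slice_cdf C z = measure lborel (C \<inter> {x. fst x < z}) / measure lborel C"

lemma open_slice: "open C \<Longrightarrow> open (slice C z)"
  for C :: "(real \<times> 'b::topological_space) set"
  unfolding slice_def using open_vimage[of C "Pair z"] by (simp add: vimage_def continuous_on_Pair)

lemma convex_slice: "convex C \<Longrightarrow> convex (slice C z)"
  for C :: "(real \<times> 'b::real_vector) set"
proof (rule convexI)
  fix x y u v assume C: "convex C" and xy: "x \<in> slice C z" "y \<in> slice C z" and uv: "0 \<le> u" "0 \<le> v" "u + v = (1::real)"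
  have "u *\<^sub>R (z, x) + v *\<^sub>R (z, y) \<in> C"
    using C xy uv unfolding slice_def by (intro convexD) auto
  moreover have "u *\<^sub>R (z, x) + v *\<^sub>R (z, y) = (z, u *\<^sub>R x + v *\<^sub>R y)"
    using uv by (simp add: distrib_right[symmetric])
  ultimately show "u *\<^sub>R x + v *\<^sub>R y \<in> slice C z" by (simp add: slice_def)
qed

lemma bounded_slice: "bounded C \<Longrightarrow> bounded (slice C z)"
  for C :: "(real \<times> 'b::real_normed_vector) set"
  unfolding slice_def by (rule bounded_subset[OF bounded_snd]) force+

lemma slice_nonempty: "slice C z \<noteq> {} \<longleftrightarrow> z \<in> fst ` C"
  by (force simp: slice_def)

lemma measure_open_pos:
  fixes S :: "'a::euclidean_space set"
  assumes "open S" "bounded S" "S \<noteq> {}"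
  shows "measure lborel S > 0"
proof -
  obtain x e where e: "e > 0" "ball x e \<subseteq> S" using assms by (meson ex_in_conv openE)
  have "0 < measure lborel (ball x e)" by (rule content_ball_pos[OF e(1)])
  also have "\<dots> \<le> measure lborel S"
    using e assms emeasure_bounded_finite[OF assms(2)]
    by (intro measure_mono_fmeasurable) (auto simp: fmeasurable_def)
  finally show ?thesis .
qed

lemma open_convex_bounded_real_eq_interval:
  fixes S :: "real set"
  assumes o: "open S" and c: "convex S" and bS: "bounded S" and ne: "S \<noteq> {}"
  obtains \<alpha> \<beta> where "\<alpha> < \<beta>" "S = {\<alpha><..<\<beta>}"
proof -
  have b: "bdd_below S" "bdd_above S"
    using bS by (auto intro: bounded_imp_bdd_below bounded_imp_bdd_above)
  have eq: "S = {Inf S<..<Sup S}"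
  proof
    show "S \<subseteq> {Inf S<..<Sup S}"
    proof
      fix z assume "z \<in> S"
      then obtain e where e: "e > 0" "cball z e \<subseteq> S" using o open_contains_cball by blast
      then have "z - e \<in> S" "z + e \<in> S" by (auto simp: subset_iff dist_real_def)
      then have "Inf S \<le> z - e" "z + e \<le> Sup S" using b by (auto intro: cInf_lower cSup_upper)
      then show "z \<in> {Inf S<..<Sup S}" using e(1) by auto
    qed
    show "{Inf S<..<Sup S} \<subseteq> S"
    proof
      fix z assume z: "z \<in> {Inf S<..<Sup S}"
      obtain u w where u: "u \<in> S" "u < z" and w: "w \<in> S" "z < w"
        using z cInf_less_iff[OF ne b(1), of z] less_cSup_iff[OF ne b(2), of z] by auto
      have "closed_segment u w \<subseteq> S" using c u w convex_contains_segment by blast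
      then show "z \<in> S" using u w by (auto simp: closed_segment_eq_real_ivl)
    qed
  qed
  with ne that show ?thesis by (metis greaterThanLessThan_empty_iff not_le)
qed

lemma fst_image_eq_interval:
  fixes C :: "(real \<times> 'b::real_normed_vector) set"
  assumes "open C" "convex C" "bounded C" "C \<noteq> {}"
  obtains \<alpha> \<beta> where "\<alpha> < \<beta>" "fst ` C = {\<alpha><..<\<beta>}"
proof (rule open_convex_bounded_real_eq_interval)
  show "open (fst ` C)" using assms(1) by (rule open_image_fst)
  show "convex (fst ` C)" using assms(2) by (rule convex_linear_image[OF linear_fst])
  show "bounded (fst ` C)" using assms(3) by (rule bounded_fst)
qed (use assms(4) that in auto)

text \<open>The cone over a slice with apex (s, c) stays in C, and its section at relative height t
  is the slice shrunk by 1 - t. The apex may be a boundary point, such as the tip of a spike. This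
  comparison is used where one might expect the Brunn-Minkowski inequality.\<close>

lemma slice_vol_scale:
  fixes C :: "(real \<times> 'b::euclidean_space) set"
  assumes "open C" "convex C" "bounded C" "(s, c) \<in> closure C" "0 \<le> t" "t < 1"
  shows "(1 - t) ^ DIM('b) * slice_vol C z \<le> slice_vol C ((1 - t) * z + t * s)"
proof -
  let ?f = "\<lambda>p. (1 - t) *\<^sub>R p + t *\<^sub>R c"
  have sub: "?f ` slice C z \<subseteq> slice C ((1 - t) * z + t * s)"
  proof
    fix q assume "q \<in> ?f ` slice C z"
    then obtain p where p: "(z, p) \<in> C" "q = ?f p" by (auto simp: slice_def)
    have "(s, c) - (1 - t) *\<^sub>R ((s, c) - (z, p)) \<in> interior C"
      using assms p by (intro mem_interior_closure_convex_shrink) (auto simp: interior_open)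
    moreover have "(s, c) - (1 - t) *\<^sub>R ((s, c) - (z, p)) = ((1 - t) * z + t * s, q)"
      using p(2) by (simp add: algebra_simps)
    ultimately show "q \<in> slice C ((1 - t) * z + t * s)"
      using assms(1) by (simp add: slice_def interior_open)
  qed
  have ls: "slice C z' \<in> lmeasurable" for z'
    by (intro lmeasurable_open open_slice bounded_slice assms)
  have op: "open (?f ` slice C z)"
    using open_affinity[OF open_slice[OF assms(1)], of "1 - t" "t *\<^sub>R c" z] assms(6) by (simp add: add.commute)
  have "(1 - t) ^ DIM('b) * measure lebesgue (slice C z) = measure lebesgue (?f ` slice C z)"
    using measure_lebesgue_affine[of "1 - t" "t *\<^sub>R c" "slice C z"] assms(5,6) by simp
  also have "\<dots> \<le> measure lebesgue (slice C ((1 - t) * z + t * s))"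
    using op sub ls by (intro measure_mono_fmeasurable) auto
  finally show ?thesis
    unfolding slice_vol_def by (simp add: measure_completion open_slice assms(1))
qed

lemma slice_vol_ratio:
  fixes C :: "(real \<times> 'b::euclidean_space) set"
  assumes "open C" "convex C" "bounded C" "(s, c) \<in> closure C" "z \<le> z' \<and> z' < s \<or> s < z' \<and> z' \<le> z"
  shows "((s - z') / (s - z)) ^ DIM('b) * slice_vol C z \<le> slice_vol C z'"
proof -
  define t where "t = (z' - z) / (s - z)"
  have sz: "s - z \<noteq> 0" using assms(5) by auto
  have t: "0 \<le> t" "t < 1" using assms(5) by (auto simp: t_def divide_simps)
  have "1 - t = (s - z') / (s - z)" using sz by (simp add: t_def field_simps)
  moreover have "(1 - t) * z + t * s = z + t * (s - z)" by (simp add: algebra_simps)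
  then have "(1 - t) * z + t * s = z'" using sz by (simp add: t_def)
  ultimately show ?thesis using slice_vol_scale[OF assms(1-4) t, of z] by simp
qed

lemma slice_vol_pos:
  fixes C :: "(real \<times> 'b::euclidean_space) set"
  assumes "open C" "bounded C" "z \<in> fst ` C"
  shows "slice_vol C z > 0"
  unfolding slice_vol_def using assms
  by (intro measure_open_pos open_slice bounded_slice) (simp_all add: slice_nonempty)

text \<open>Points of C at heights u < z < w serve as apexes of cones; on either side of z the cone
  comparisons squeeze the slice volume between two multiples of \<open>slice_vol C z\<close> whose
  factors tend to 1.\<close>

lemma isCont_slice_vol:
  fixes C :: "(real \<times> 'b::euclidean_space) set"
  assumes "open C" "convex C" "bounded C" "z \<in> fst ` C"
  shows "isCont (slice_vol C) z"
proof -
  obtain \<alpha> \<beta> where ab: "\<alpha> < \<beta>" "fst ` C = {\<alpha><..<\<beta>}"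
    using fst_image_eq_interval[OF assms(1-3)] assms(4) by blast
  let ?n = "DIM('b)" and ?a = "slice_vol C"
  define u w where "u = (\<alpha> + z) / 2" and "w = (z + \<beta>) / 2"
  have uw: "\<alpha> < u" "u < z" "z < w" "w < \<beta>" using ab assms(4) by (auto simp: u_def w_def)
  then have "u \<in> fst ` C" "w \<in> fst ` C" using ab by auto
  then obtain cu cw where "(u, cu) \<in> C" "(w, cw) \<in> C" by force
  then have cu: "(u, cu) \<in> closure C" and cw: "(w, cw) \<in> closure C"
    using closure_subset by blast+
  note R = slice_vol_ratio[OF assms(1-3)]
  have r: "((w - x) / (w - z)) ^ ?n * ?a z \<le> ?a x" "?a x \<le> ?a z * ((x - u) / (z - u)) ^ ?n" if "z < x" "x < w" for x
  proof -
    show "((w - x) / (w - z)) ^ ?n * ?a z \<le> ?a x" using that by (intro R[OF cw]) auto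
    have "((u - z) / (u - x)) ^ ?n * ?a x \<le> ?a z" using that uw by (intro R[OF cu]) auto
    moreover have "(u - z) / (u - x) = 1 / ((x - u) / (z - u))" using that uw by (simp add: divide_simps) (simp add: algebra_simps)
    ultimately show "?a x \<le> ?a z * ((x - u) / (z - u)) ^ ?n"
      using that uw by (simp add: power_divide divide_simps mult.commute)
  qed
  have l: "((x - u) / (z - u)) ^ ?n * ?a z \<le> ?a x" "?a x \<le> ?a z * ((w - x) / (w - z)) ^ ?n" if "u < x" "x < z" for x
  proof -
    have "((u - x) / (u - z)) ^ ?n * ?a z \<le> ?a x" using that by (intro R[OF cu]) auto
    moreover have "(u - x) / (u - z) = (x - u) / (z - u)" using that uw by (simp add: divide_simps) (simp add: algebra_simps)
    ultimately show "((x - u) / (z - u)) ^ ?n * ?a z \<le> ?a x" by simp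
    have "((w - z) / (w - x)) ^ ?n * ?a x \<le> ?a z" using that uw by (intro R[OF cw]) auto
    then show "?a x \<le> ?a z * ((w - x) / (w - z)) ^ ?n"
      using that uw by (simp add: power_divide divide_simps mult.commute)
  qed
  have lim: "((\<lambda>x. ((w - x) / (w - z)) ^ ?n) \<longlongrightarrow> 1) F" "((\<lambda>x. ((x - u) / (z - u)) ^ ?n) \<longlongrightarrow> 1) F"
    if "F \<le> at z" for F
  proof -
    have id: "((\<lambda>x. x) \<longlongrightarrow> z) F" using tendsto_mono[OF that tendsto_ident_at] .
    have "((\<lambda>x. ((w - x) / (w - z)) ^ ?n) \<longlongrightarrow> ((w - z) / (w - z)) ^ ?n) F"
      using uw by (intro tendsto_intros id) auto
    then show "((\<lambda>x. ((w - x) / (w - z)) ^ ?n) \<longlongrightarrow> 1) F" using uw by simp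
    have "((\<lambda>x. ((x - u) / (z - u)) ^ ?n) \<longlongrightarrow> ((z - u) / (z - u)) ^ ?n) F"
      using uw by (intro tendsto_intros id) auto
    then show "((\<lambda>x. ((x - u) / (z - u)) ^ ?n) \<longlongrightarrow> 1) F" using uw by simp
  qed
  have "(?a \<longlongrightarrow> ?a z) (at_right z)"
  proof (rule tendsto_sandwich)
    show "\<forall>\<^sub>F x in at_right z. ((w - x) / (w - z)) ^ ?n * ?a z \<le> ?a x"
      "\<forall>\<^sub>F x in at_right z. ?a x \<le> ?a z * ((x - u) / (z - u)) ^ ?n"
      unfolding eventually_at_right_field using r uw by blast+
    show "((\<lambda>x. ((w - x) / (w - z)) ^ ?n * ?a z) \<longlongrightarrow> ?a z) (at_right z)"
      using tendsto_mult[OF lim(1) tendsto_const, of "at_right z" "?a z"] by (simp add: at_le)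
    show "((\<lambda>x. ?a z * ((x - u) / (z - u)) ^ ?n) \<longlongrightarrow> ?a z) (at_right z)"
      using tendsto_mult[OF tendsto_const lim(2), of "at_right z" "?a z"] by (simp add: at_le)
  qed
  moreover have "(?a \<longlongrightarrow> ?a z) (at_left z)"
  proof (rule tendsto_sandwich)
    show "\<forall>\<^sub>F x in at_left z. ((x - u) / (z - u)) ^ ?n * ?a z \<le> ?a x"
      "\<forall>\<^sub>F x in at_left z. ?a x \<le> ?a z * ((w - x) / (w - z)) ^ ?n"
      unfolding eventually_at_left_field using l uw by blast+
    show "((\<lambda>x. ((x - u) / (z - u)) ^ ?n * ?a z) \<longlongrightarrow> ?a z) (at_left z)"
      using tendsto_mult[OF lim(2) tendsto_const, of "at_left z" "?a z"] by (simp add: at_le)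
    show "((\<lambda>x. ?a z * ((w - x) / (w - z)) ^ ?n) \<longlongrightarrow> ?a z) (at_left z)"
      using tendsto_mult[OF tendsto_const lim(1), of "at_left z" "?a z"] by (simp add: at_le)
  qed
  ultimately show ?thesis by (simp add: isCont_def filterlim_split_at)
qed

section \<open>Slice volume as the density of the slice distribution function\<close>

lemma fmeasurable_lborel_bounded:
  fixes A :: "'a::euclidean_space set"
  assumes "A \<in> sets borel" "bounded A"
  shows "A \<in> fmeasurable lborel"
  using assms emeasure_bounded_finite[OF assms(2)] by (simp add: fmeasurable_def)

lemma measurable_section_measure:
  fixes Q :: "('c::euclidean_space \<times> 'b::euclidean_space) set"
  assumes "open Q"
  shows "(\<lambda>c. measure lborel (Pair c -` Q)) \<in> borel_measurable borel"
proof -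
  have "sets (borel \<Otimes>\<^sub>M (lborel :: 'b measure)) = sets (borel \<Otimes>\<^sub>M borel)"
    by (rule sets_pair_measure_cong) simp_all
  also have "\<dots> = sets (borel :: ('c \<times> 'b) measure)" by (simp only: borel_prod)
  finally have "Q \<in> sets (borel \<Otimes>\<^sub>M lborel)" using assms borel_open by blast
  from lborel.measurable_emeasure_Pair[OF this]
  show ?thesis unfolding measure_def by measurable
qed

lemma slice_vol_measurable [measurable]:
  fixes C :: "(real \<times> 'b::euclidean_space) set"
  assumes "open C"
  shows "slice_vol C \<in> borel_measurable borel"
  using measurable_section_measure[OF assms] by (simp add: slice_vol_def[abs_def] slice_def vimage_def)

lemma slab_sets [measurable]:
  fixes C :: "(real \<times> 'b::euclidean_space) set"
  assumes "C \<in> sets borel"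
  shows "C \<inter> {x. w \<le> fst x \<and> fst x < z} \<in> sets borel" "C \<inter> {x. fst x < z} \<in> sets borel"
proof -
  have 1: "{x::real \<times> 'b. w \<le> fst x} \<in> sets borel" for w
    by (intro borel_closed closed_Collect_le continuous_intros)
  have 2: "{x::real \<times> 'b. fst x < z} \<in> sets borel" for z
    by (intro borel_open open_Collect_less continuous_intros)
  have "C \<inter> {x. w \<le> fst x \<and> fst x < z} = C \<inter> ({x. w \<le> fst x} \<inter> {x. fst x < z})" by auto
  also have "\<dots> \<in> sets borel" using assms 1 2 by blast
  finally show "C \<inter> {x. w \<le> fst x \<and> fst x < z} \<in> sets borel" .
  show "C \<inter> {x. fst x < z} \<in> sets borel" using assms 2 by blast
qed

lemma emeasure_slab:
  fixes C :: "(real \<times> 'b::euclidean_space) set"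
  assumes "open C" "bounded C"
  shows "emeasure lborel (C \<inter> {x. w \<le> fst x \<and> fst x < z}) = (\<integral>\<^sup>+t. ennreal (slice_vol C t) * indicator {w..<z} t \<partial>lborel)"
proof -
  have m: "C \<inter> {x. w \<le> fst x \<and> fst x < z} \<in> sets (lborel \<Otimes>\<^sub>M lborel)"
    unfolding lborel_prod using slab_sets(1)[OF borel_open[OF assms(1)]] by simp
  have "emeasure lborel (C \<inter> {x. w \<le> fst x \<and> fst x < z})
      = (\<integral>\<^sup>+t. emeasure lborel (Pair t -` (C \<inter> {x. w \<le> fst x \<and> fst x < z})) \<partial>lborel)"
    unfolding lborel_prod[symmetric] by (rule lborel.emeasure_pair_measure_alt[OF m])
  also have "\<dots> = (\<integral>\<^sup>+t. ennreal (slice_vol C t) * indicator {w..<z} t \<partial>lborel)"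
  proof (rule nn_integral_cong)
    fix t :: real
    have "Pair t -` (C \<inter> {x. w \<le> fst x \<and> fst x < z}) = (if t \<in> {w..<z} then slice C t else {})"
      by (auto simp: slice_def)
    moreover have "emeasure lborel (slice C t) = ennreal (slice_vol C t)"
      using emeasure_bounded_finite[OF bounded_slice[OF assms(2)], of t]
      by (simp add: slice_vol_def emeasure_eq_ennreal_measure)
    ultimately show "emeasure lborel (Pair t -` (C \<inter> {x. w \<le> fst x \<and> fst x < z})) = ennreal (slice_vol C t) * indicator {w..<z} t"
      by simp
  qed
  finally show ?thesis .
qed

lemma slice_vol_bounded:
  fixes C :: "(real \<times> 'b::euclidean_space) set"
  assumes "open C" "bounded C"
  obtains M where "M > 0" "\<And>z. slice_vol C z \<le> M"
proof -
  obtain r where r: "r > 0" "\<And>x. x \<in> C \<Longrightarrow> norm x \<le> r" using assms(2) unfolding bounded_pos by auto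
  have "slice_vol C z \<le> measure lborel (cball (0::'b) r)" for z
    unfolding slice_vol_def
  proof (rule measure_mono_fmeasurable)
    show "slice C z \<subseteq> cball 0 r"
    proof
      fix p assume "p \<in> slice C z"
      then have "norm (z, p) \<le> r" using r(2) by (auto simp: slice_def)
      then show "p \<in> cball 0 r" using norm_snd_le[of p z] by simp
    qed
    show "slice C z \<in> sets lborel" using open_slice[OF assms(1)] by simp
    show "cball 0 r \<in> fmeasurable lborel"
      by (rule fmeasurable_lborel_bounded) simp_all
  qed
  moreover have "measure lborel (cball (0::'b) r) \<ge> 0" by simp
  ultimately have "\<And>z. slice_vol C z \<le> measure lborel (cball (0::'b) r) + 1" by (smt (verit, best))
  then show ?thesis using that[of "measure lborel (cball (0::'b) r) + 1"] by (simp add: add_nonneg_pos)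
qed

lemma slice_cdf_diff:
  fixes C :: "(real \<times> 'b::euclidean_space) set"
  assumes "open C" "bounded C" "C \<noteq> {}" "w \<le> z"
  shows "slice_cdf C z - slice_cdf C w = measure lborel (C \<inter> {x. w \<le> fst x \<and> fst x < z}) / measure lborel C"
proof -
  have fin: "D \<in> fmeasurable lborel" if "D \<subseteq> C" "D \<in> sets borel" for D
    using emeasure_bounded_finite[OF bounded_subset[OF assms(2) that(1)]] that(2) by (simp add: fmeasurable_def)
  note m = slab_sets[OF borel_open[OF assms(1)]]
  have "C \<inter> {x. fst x < z} = (C \<inter> {x. fst x < w}) \<union> (C \<inter> {x. w \<le> fst x \<and> fst x < z})"
    using assms(4) by auto
  then have "measure lborel (C \<inter> {x. fst x < z}) = measure lborel (C \<inter> {x. fst x < w}) + measure lborel (C \<inter> {x. w \<le> fst x \<and> fst x < z})"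
    by (simp only:) (rule measure_Union, use m in \<open>auto intro!: fmeasurableD2 fin\<close>)
  then show ?thesis unfolding slice_cdf_def by (simp add: diff_divide_distrib[symmetric])
qed

lemma slice_cdf_mono:
  fixes C :: "(real \<times> 'b::euclidean_space) set"
  assumes "open C" "bounded C" "C \<noteq> {}" "w \<le> z"
  shows "slice_cdf C w \<le> slice_cdf C z"
proof -
  have "0 \<le> slice_cdf C z - slice_cdf C w" unfolding slice_cdf_diff[OF assms] by simp
  then show ?thesis by simp
qed

text \<open>The slice volumes are bounded by some M, so the function is Lipschitz with constant M /
  V. This covers the endpoints of the projection, where the slice volume may jump.\<close>

lemma continuous_slice_cdf:
  fixes C :: "(real \<times> 'b::euclidean_space) set"
  assumes "open C" "bounded C" "C \<noteq> {}"
  shows "continuous_on UNIV (slice_cdf C)"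
proof -
  obtain M where M: "M > 0" "\<And>z. slice_vol C z \<le> M" using slice_vol_bounded[OF assms(1,2)] by blast
  define V where "V = measure lborel C"
  have V: "V > 0" unfolding V_def by (rule measure_open_pos[OF assms])
  have *: "\<bar>slice_cdf C z - slice_cdf C w\<bar> \<le> M / V * \<bar>z - w\<bar>" if "w \<le> z" for w z
  proof -
    have "emeasure lborel (C \<inter> {x. w \<le> fst x \<and> fst x < z}) \<le> (\<integral>\<^sup>+t. ennreal M * indicator {w..<z} t \<partial>lborel)"
      unfolding emeasure_slab[OF assms(1,2)]
      by (intro nn_integral_mono mult_right_mono ennreal_leI M) simp
    also have "\<dots> = ennreal (M * (z - w))"
      using that M(1) by (simp add: nn_integral_cmult ennreal_mult)
    finally have "measure lborel (C \<inter> {x. w \<le> fst x \<and> fst x < z}) \<le> M * (z - w)"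
      unfolding measure_def using M(1) that by (simp add: enn2real_leI)
    then show ?thesis
      using slice_cdf_diff[OF assms that] V that by (simp add: V_def[symmetric] divide_right_mono)
  qed
  have "(M / V)-lipschitz_on UNIV (slice_cdf C)"
  proof (rule lipschitz_onI)
    show "dist (slice_cdf C x) (slice_cdf C y) \<le> M / V * dist x y" for x y
      using *[of x y] *[of y x] by (cases "x \<le> y") (auto simp: dist_real_def abs_minus_commute)
    show "0 \<le> M / V" using M V by simp
  qed
  then show ?thesis by (rule lipschitz_on_continuous_on)
qed

lemma slice_cdf_ends:
  fixes C :: "(real \<times> 'b::euclidean_space) set"
  assumes "open C" "bounded C" "C \<noteq> {}" "fst ` C = {\<alpha><..<\<beta>}"
  shows "slice_cdf C \<alpha> = 0" "slice_cdf C \<beta> = 1" 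
    and "z \<in> {\<alpha><..<\<beta>} \<Longrightarrow> 0 < slice_cdf C z \<and> slice_cdf C z < 1"
proof -
  have V: "measure lborel C > 0" by (rule measure_open_pos[OF assms(1-3)])
  have f: "fst x \<in> {\<alpha><..<\<beta>}" if "x \<in> C" for x using that assms(4) by blast
  have "C \<inter> {x. fst x < \<alpha>} = {}" using f by fastforce
  then show "slice_cdf C \<alpha> = 0" by (simp add: slice_cdf_def)
  have "C \<inter> {x. fst x < \<beta>} = C" using f by fastforce
  then show "slice_cdf C \<beta> = 1" using V by (simp add: slice_cdf_def)
  assume z: "z \<in> {\<alpha><..<\<beta>}"
  have o: "open (C \<inter> {x. fst x < z})" "open (C \<inter> {x. z < fst x})"
    using assms(1) by (auto intro!: open_Int open_Collect_less continuous_intros)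
  have "(\<alpha> + z) / 2 \<in> fst ` C" "(z + \<beta>) / 2 \<in> fst ` C" using z unfolding assms(4) by auto
  then have ne: "C \<inter> {x. fst x < z} \<noteq> {}" "C \<inter> {x. z < fst x} \<noteq> {}"
    using z by force+
  have p: "measure lborel (C \<inter> {x. fst x < z}) > 0" "measure lborel (C \<inter> {x. z < fst x}) > 0"
    by (intro measure_open_pos o ne bounded_Int disjI1 assms(2))+
  have fin: "D \<in> fmeasurable lborel" if "open D" "D \<subseteq> C" for D
    using emeasure_bounded_finite[OF bounded_subset[OF assms(2) that(2)]] that(1) by (simp add: fmeasurable_def)
  have "measure lborel (C \<inter> {x. fst x < z}) + measure lborel (C \<inter> {x. z < fst x})
      = measure lborel ((C \<inter> {x. fst x < z}) \<union> (C \<inter> {x. z < fst x}))"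
    by (rule measure_Union[symmetric]) (use o in \<open>auto intro!: fmeasurableD2 fin\<close>)
  also have "\<dots> \<le> measure lborel C"
    by (rule measure_mono_fmeasurable) (use o fin[OF assms(1)] in auto)
  finally have "measure lborel (C \<inter> {x. fst x < z}) < measure lborel C" using p by linarith
  then show "0 < slice_cdf C z \<and> slice_cdf C z < 1" using p V by (simp add: slice_cdf_def)
qed

text \<open>The fundamental theorem is applied on an interval [u, w] inside the projection, because
  continuity of the slice volume is available only there.\<close>

lemma slice_cdf_has_derivative:
  fixes C :: "(real \<times> 'b::euclidean_space) set"
  assumes "open C" "convex C" "bounded C" "z \<in> fst ` C"
  shows "(slice_cdf C has_real_derivative slice_vol C z / measure lborel C) (at z)"
proof -
  have ne: "C \<noteq> {}" using assms(4) by auto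
  obtain \<alpha> \<beta> where ab: "\<alpha> < \<beta>" "fst ` C = {\<alpha><..<\<beta>}"
    using fst_image_eq_interval[OF assms(1-3) ne] by blast
  define u w where "u = (\<alpha> + z) / 2" and "w = (z + \<beta>) / 2"
  have uw: "\<alpha> < u" "u < z" "z < w" "w < \<beta>" using ab assms(4) by (auto simp: u_def w_def)
  define V where "V = measure lborel C"
  have V: "V > 0" unfolding V_def by (rule measure_open_pos[OF assms(1,3) ne])
  have cont: "isCont (slice_vol C) x" if "x \<in> {u..w}" for x
    using that uw by (intro isCont_slice_vol assms) (auto simp: ab)
  then have cont_on: "continuous_on {u..w} (slice_vol C)" by (simp add: continuous_at_imp_continuous_on)
  define G where "G x = integral {u..x} (slice_vol C)" for x
  have derG: "(G has_real_derivative slice_vol C x) (at x within {u..w})" if "x \<in> {u..w}" for x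
    unfolding G_def using integral_has_real_derivative[OF cont_on that] .
  have eq: "slice_cdf C u + G x / V = slice_cdf C x" if "x \<in> {u<..<w}" for x
  proof -
    have "emeasure lborel (C \<inter> {y. u \<le> fst y \<and> fst y < x}) = (\<integral>\<^sup>+t. ennreal (slice_vol C t) * indicator {u..x} t \<partial>lborel)"
      unfolding emeasure_slab[OF assms(1,3)]
      by (rule nn_integral_cong_AE, rule AE_mp[OF AE_lborel_singleton[of x]])
        (auto simp: indicator_def)
    also have "\<dots> = ennreal (G x)"
    proof -
      have "(slice_vol C has_integral G x) {u..x}"
        unfolding G_def using that
        by (intro integrable_integral integrable_continuous_real continuous_on_subset[OF cont_on]) auto
      from nn_integral_has_integral_lebesgue[OF _ this] show ?thesis
        by (simp add: slice_vol_def ennreal_mult'' mult.commute ennreal_indicator)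
    qed
    finally have e: "emeasure lborel (C \<inter> {y. u \<le> fst y \<and> fst y < x}) = ennreal (G x)" .
    have "G x \<ge> 0" unfolding G_def slice_vol_def
      using that by (intro integral_nonneg integrable_continuous_real continuous_on_subset[OF cont_on[unfolded slice_vol_def[abs_def]]]) auto
    then have "measure lborel (C \<inter> {y. u \<le> fst y \<and> fst y < x}) = G x"
      using e by (simp add: measure_def)
    then show ?thesis
      using slice_cdf_diff[OF assms(1,3) ne, of u x] that V by (simp add: V_def field_simps)
  qed
  have "(G has_real_derivative slice_vol C z) (at z)"
    using derG[of z] uw at_within_interior[of z "{u..w}"] by simp
  then have "((\<lambda>x. slice_cdf C u + G x / V) has_real_derivative slice_vol C z / V) (at z)"
    using V by (auto intro!: derivative_eq_intros)
  then show ?thesis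
    unfolding V_def[symmetric]
    by (rule has_field_derivative_transform_within_open[of _ _ _ "{u<..<w}"]) (use uw eq in auto)
qed

text \<open>A strictly increasing continuous function on a compact interval has a continuous
  inverse; clamping its argument to [0, 1] extends it to the line. The derivative formula is
  confined to the open interval, as the density may vanish at the ends.\<close>

lemma cdf_inverse:
  fixes G g :: "real \<Rightarrow> real"
  assumes cont: "continuous_on {-1..1} G" and ends: "G (-1) = 0" "G 1 = 1"
    and der: "\<And>x. -1 < x \<Longrightarrow> x < 1 \<Longrightarrow> (G has_real_derivative g x) (at x)"
    and pos: "\<And>x. -1 < x \<Longrightarrow> x < 1 \<Longrightarrow> g x > 0"
  obtains N where "continuous_on UNIV N" "N 0 = -1" "N 1 = 1" "mono N" "\<And>t. -1 \<le> N t \<and> N t \<le> 1"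
    "\<And>t. 0 < t \<Longrightarrow> t < 1 \<Longrightarrow> -1 < N t \<and> N t < 1 \<and> (N has_real_derivative 1 / g (N t)) (at t)"
proof -
  have inc: "G x < G y" if "-1 \<le> x" "x < y" "y \<le> 1" for x y
  proof (rule DERIV_pos_imp_increasing_open[OF that(2)])
    show "\<exists>y. (G has_real_derivative y) (at z) \<and> 0 < y" if "x < z" "z < y" for z
      using der[of z] pos[of z] that \<open>-1 \<le> x\<close> \<open>y \<le> 1\<close> by (intro exI[of _ "g z"]) auto
    show "continuous_on {x..y} G" using that by (intro continuous_on_subset[OF cont]) auto
  qed
  have inj: "inj_on G {-1..1}"
    by (rule linorder_inj_onI) (use inc in fastforce)+
  have img: "G ` {-1..1} = {0..1}"
  proof
    show "G ` {-1..1} \<subseteq> {0..1}"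
    proof
      fix t assume "t \<in> G ` {-1..1}"
      then obtain x where x: "-1 \<le> x" "x \<le> 1" "t = G x" by auto
      then have "G (-1) \<le> G x" "G x \<le> G 1"
        using inc[of "-1" x] inc[of x 1] by (cases "x = -1"; cases "x = 1"; force)+
      then show "t \<in> {0..1}" using ends x by simp
    qed
    show "{0..1} \<subseteq> G ` {-1..1}"
    proof
      fix t :: real assume "t \<in> {0..1}"
      then obtain x where "-1 \<le> x" "x \<le> 1" "G x = t"
        using IVT'[of G "-1" t 1] cont ends by auto
      then show "t \<in> G ` {-1..1}" by auto
    qed
  qed
  define N0 where "N0 = the_inv_into {-1..1} G"
  define N where "N t = N0 (max 0 (min 1 t))" for t
  have N0: "N0 t \<in> {-1..1}" "G (N0 t) = t" if "t \<in> {0..1}" for t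
    using that the_inv_into_into[OF inj _ subset_refl, of t] f_the_inv_into_f[OF inj, of t]
    by (auto simp: N0_def img)
  have N0c: "continuous_on {0..1} N0"
    unfolding N0_def img[symmetric] by (rule continuous_on_inv_into[OF cont compact_Icc inj])
  have N0G: "N0 (G x) = x" if "x \<in> {-1..1}" for x
    unfolding N0_def by (rule the_inv_into_f_f[OF inj that])
  have N0mono: "N0 s \<le> N0 t" if "s \<in> {0..1}" "t \<in> {0..1}" "s \<le> t" for s t
  proof (rule ccontr)
    assume "\<not> N0 s \<le> N0 t"
    then have "G (N0 t) < G (N0 s)" using N0(1)[OF that(1)] N0(1)[OF that(2)] by (intro inc) auto
    then show False using N0(2) that by auto
  qed
  show ?thesis
  proof (rule that[of N])
    show Nc: "continuous_on UNIV N"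
      unfolding N_def by (rule continuous_on_compose2[OF N0c]) (auto intro!: continuous_intros)
    show "N 0 = -1" using N0G[of "-1"] ends by (simp add: N_def)
    show "N 1 = 1" using N0G[of 1] ends by (simp add: N_def)
    show "mono N" unfolding N_def by (intro monoI N0mono) auto
    show "-1 \<le> N t \<and> N t \<le> 1" for t
      using N0(1)[of "max 0 (min 1 t)"] by (simp add: N_def)
    fix t :: real assume t: "0 < t" "t < 1"
    have NG: "G (N y) = y" if "0 < y" "y < 1" for y
      using that N0(2)[of y] by (simp add: N_def)
    have b: "-1 < N t \<and> N t < 1"
      using NG[OF t] ends t N0(1)[of t] by (auto simp: N_def less_le)
    have "(N has_real_derivative inverse (g (N t))) (at t)"
    proof (rule DERIV_inverse_function[of G _ N t 0 1])
      show "(G has_real_derivative g (N t)) (at (N t))" using b der by blast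
      show "g (N t) \<noteq> 0" using b pos[of "N t"] by simp
      show "isCont N t" using Nc by (simp add: continuous_on_eq_continuous_at)
    qed (use t NG in auto)
    then show "-1 < N t \<and> N t < 1 \<and> (N has_real_derivative 1 / g (N t)) (at t)"
      using b by (simp add: inverse_eq_divide)
  qed
qed

section \<open>A Knothe-type rearrangement onto the ball\<close>

text \<open>(2 + 3 x - x^3) / 4 is the fraction of the unit ball below height x, with density pi (1
  - x^2) over 4 pi / 3.\<close>

lemma ball_cdf_inverse:
  obtains N :: "real \<Rightarrow> real" where "continuous_on UNIV N" "N 0 = -1" "N 1 = 1" "mono N" "\<And>t. -1 \<le> N t \<and> N t \<le> 1"
    "\<And>t. 0 < t \<Longrightarrow> t < 1 \<Longrightarrow> -1 < N t \<and> N t < 1 \<and> (N has_real_derivative 1 / (3 / 4 * (1 - (N t)\<^sup>2))) (at t)"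
proof (rule cdf_inverse[of "\<lambda>x. (2 + 3 * x - x ^ 3) / 4" "\<lambda>x. 3 / 4 * (1 - x\<^sup>2)"])
  show "continuous_on {-1..1} (\<lambda>x::real. (2 + 3 * x - x ^ 3) / 4)" by (intro continuous_intros) auto
  show "((\<lambda>x. (2 + 3 * x - x ^ 3) / 4) has_real_derivative 3 / 4 * (1 - x\<^sup>2)) (at x)" for x :: real
    by (auto intro!: derivative_eq_intros simp: field_simps)
  show "3 / 4 * (1 - x\<^sup>2) > 0" if "-1 < x" "x < 1" for x :: real
    using abs_square_less_1[of x] that by auto
qed (use that in auto)

text \<open>The function inverted is the fraction of the unit disc to the left of x; its density is
  the chord length 2 sqrt (1 - x^2) over pi.\<close>

lemma disc_cdf_inverse:
  obtains N :: "real \<Rightarrow> real" where "continuous_on UNIV N" "mono N" "\<And>t. -1 \<le> N t \<and> N t \<le> 1"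
    "\<And>t. 0 < t \<Longrightarrow> t < 1 \<Longrightarrow> -1 < N t \<and> N t < 1 \<and> (N has_real_derivative 1 / (2 / pi * sqrt (1 - (N t)\<^sup>2))) (at t)"
proof (rule cdf_inverse[of "\<lambda>x. 1 / 2 + (x * sqrt (1 - x\<^sup>2) + arcsin x) / pi" "\<lambda>x. 2 / pi * sqrt (1 - x\<^sup>2)"])
  show "continuous_on {-1..1} (\<lambda>x. 1 / 2 + (x * sqrt (1 - x\<^sup>2) + arcsin x) / pi)"
    by (intro continuous_intros) auto
  show "((\<lambda>x. 1 / 2 + (x * sqrt (1 - x\<^sup>2) + arcsin x) / pi) has_real_derivative 2 / pi * sqrt (1 - x\<^sup>2)) (at x)"
    if "-1 < x" "x < 1" for x
  proof -
    have pos: "1 - x\<^sup>2 > 0" using abs_square_less_1[of x] that by auto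
    define s where "s = sqrt (1 - x\<^sup>2)"
    have s: "s > 0" "s * s = 1 - x * x" using pos by (auto simp: s_def power2_eq_square)
    have "((\<lambda>x. sqrt (1 - x\<^sup>2)) has_real_derivative (- x / s)) (at x)"
      unfolding s_def using pos by (auto intro!: derivative_eq_intros simp: field_simps)
    then have "((\<lambda>x. x * sqrt (1 - x\<^sup>2)) has_real_derivative (s + x * (- x / s))) (at x)"
      using DERIV_mult[OF DERIV_ident] by (fastforce simp: s_def algebra_simps)
    moreover have "(arcsin has_real_derivative 1 / s) (at x)"
      unfolding s_def using DERIV_arcsin[OF that] by (simp add: inverse_eq_divide)
    ultimately have "((\<lambda>x. x * sqrt (1 - x\<^sup>2) + arcsin x) has_real_derivative (s + x * (- x / s)) + 1 / s) (at x)"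
      by (rule DERIV_add)
    moreover have "(s + x * (- x / s)) + 1 / s = 2 * s" using s by (simp add: field_simps)
    ultimately have "((\<lambda>x. x * sqrt (1 - x\<^sup>2) + arcsin x) has_real_derivative 2 * s) (at x)" by (simp only:)
    from DERIV_add[OF DERIV_const DERIV_cdivide[OF this, of pi], of "1 / 2"] show ?thesis
      by (simp add: s_def)
  qed
  show "2 / pi * sqrt (1 - x\<^sup>2) > 0" if "-1 < x" "x < 1" for x :: real
    using abs_square_less_1[of x] that by auto
qed (use that in auto)

text \<open>The last coordinate of the rearrangement lives on a chord, where the distribution
  function is affine.\<close>

lemma interval_cdf:
  fixes I :: "real set"
  assumes "open I" "convex I" "bounded I" "x \<in> I"
  defines "c \<equiv> \<lambda>x. measure lborel (I \<inter> {..<x}) / measure lborel I"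
  shows "0 < c x \<and> c x < 1" and "(c has_real_derivative 1 / measure lborel I) (at x)" and "measure lborel I > 0"
proof -
  obtain a b where ab: "a < b" "I = {a<..<b}"
    using open_convex_bounded_real_eq_interval[OF assms(1-3)] assms(4) by blast
  have "I \<inter> {..<y} = {a<..<y}" if "y \<in> {a<..<b}" for y using that ab by auto
  then have c: "c y = (y - a) / (b - a)" if "y \<in> {a<..<b}" for y
    using that ab unfolding c_def by simp
  show "0 < c x \<and> c x < 1" unfolding c[OF assms(4)[unfolded ab(2)]] using assms(4) ab by auto
  show "measure lborel I > 0" using ab by simp
  have "((\<lambda>y. (y - a) / (b - a)) has_real_derivative 1 / measure lborel I) (at x)"
    using ab by (auto intro!: derivative_eq_intros)
  then show "(c has_real_derivative 1 / measure lborel I) (at x)"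
    by (rule has_field_derivative_transform_within_open[of _ _ _ "{a<..<b}"]) (use assms(4) ab c in auto)
qed

lemma interval_cdf_mono:
  fixes I :: "real set"
  assumes "open I" "bounded I" "x \<le> y"
  shows "measure lborel (I \<inter> {..<x}) / measure lborel I \<le> measure lborel (I \<inter> {..<y}) / measure lborel I"
proof (rule divide_right_mono)
  show "measure lborel (I \<inter> {..<x}) \<le> measure lborel (I \<inter> {..<y})"
    using assms by (intro measure_mono_fmeasurable fmeasurable_lborel_bounded bounded_Int) auto
qed simp

text \<open>Nested pairs match iterated slicing: \<open>slice\<close> first fixes the height z, a
  second \<open>slice\<close> fixes y, and x is left on an interval.\<close>

definition pt :: "real \<times> real \<times> real \<Rightarrow> real^3" where
  "pt = (\<lambda>(z, y, x). \<chi> i. if i = 1 then z else if i = 2 then y else x)"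

lemma pt_nth [simp]: "pt (z, y, x) $ 1 = z" "pt (z, y, x) $ 2 = y" "pt (z, y, x) $ 3 = x"
  by (simp_all add: pt_def)

lemma pt_coords [simp]: "pt (v $ 1, v $ 2, v $ 3) = v"
  by (simp add: vec_eq_iff forall_3)

lemma linear_pt: "linear pt"
  by (rule linearI) (auto simp: vec_eq_iff forall_3)

lemma continuous_on_pt: "continuous_on S pt"
  by (rule linear_continuous_on[OF linear_pt[unfolded linear_conv_bounded_linear]])

lemma emeasure_lborel_Times:
  fixes A :: "'a::euclidean_space set" and B :: "'b::euclidean_space set"
  assumes "A \<in> sets borel" "B \<in> sets borel"
  shows "emeasure lborel (A \<times> B) = emeasure lborel A * emeasure lborel B"
  unfolding lborel_prod[symmetric] using assms by (intro lborel.emeasure_pair_measure_Times) simp_all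

lemma distr_lborel_pt: "distr lborel borel pt = lborel"
proof (rule lborel_eqI[symmetric])
  fix l u :: "real^3" assume lu: "\<And>b. b \<in> Basis \<Longrightarrow> l \<bullet> b \<le> u \<bullet> b"
  have le: "l $ i \<le> u $ i" for i using lu[of "axis i 1"] by (auto simp: inner_axis axis_in_Basis_iff)
  have m: "pt \<in> borel_measurable lborel" using continuous_on_pt by (simp add: borel_measurable_continuous_onI)
  have "pt -` box l u = {l$1<..<u$1} \<times> ({l$2<..<u$2} \<times> {l$3<..<u$3})"
    by (auto simp: mem_box_cart forall_3)
  then have "emeasure (distr lborel borel pt) (box l u) = emeasure lborel ({l$1<..<u$1} \<times> ({l$2<..<u$2} \<times> {l$3<..<u$3}))"
    by (subst emeasure_distr) (use m in auto)
  also have "\<dots> = ennreal (u$1 - l$1) * (ennreal (u$2 - l$2) * ennreal (u$3 - l$3))"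
  proof -
    have "emeasure lborel ({l$2<..<u$2} \<times> {l$3<..<u$3}) = ennreal (u$2 - l$2) * ennreal (u$3 - l$3)"
      by (subst emeasure_lborel_Times) (simp_all add: le)
    moreover have "{l$2<..<u$2} \<times> {l$3<..<u$3} \<in> sets borel"
      by (intro borel_open open_Times) simp_all
    ultimately show ?thesis
      by (subst emeasure_lborel_Times) (simp_all add: le)
  qed
  also have "\<dots> = ennreal (\<Prod>i\<in>UNIV. u $ i - l $ i)"
  proof -
    have p: "(\<Prod>i\<in>UNIV. u $ i - l $ i) = (u$1 - l$1) * ((u$2 - l$2) * (u$3 - l$3))"
      unfolding UNIV_3 by simp
    have nn: "0 \<le> u $ i - l $ i" for i using le[of i] by simp
    show ?thesis
      unfolding p ennreal_mult[OF nn mult_nonneg_nonneg[OF nn nn]] ennreal_mult[OF nn nn] ..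
  qed
  also have "(\<Prod>i\<in>UNIV. u $ i - l $ i) = (\<Prod>b\<in>Basis. (u - l) \<bullet> b)"
  proof -
    have B: "(Basis :: (real^3) set) = (\<lambda>i. axis i 1) ` UNIV" by (auto simp: Basis_vec_def)
    show ?thesis unfolding B
      by (subst prod.reindex) (auto simp: inj_on_def axis_eq_axis inner_axis)
  qed
  finally show "emeasure (distr lborel borel pt) (box l u) = ennreal (\<Prod>b\<in>Basis. (u - l) \<bullet> b)" .
qed simp

(* With p = \<zeta>', the two remaining partial derivatives of the rearrangement have product 1/p, so by AM-GM
   its divergence is at least p + 2 / sqrt p, which is 3 in the case of equality. *)
definition defect :: "real \<Rightarrow> real" where
  "defect p = p + 2 / sqrt p - 3"

text \<open>With r = sqrt p this exhibits the sign and the double zero at p = 1.\<close>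

lemma defect_eq:
  assumes "0 < p"
  shows "defect p = (sqrt p - 1)\<^sup>2 * (sqrt p + 2) / sqrt p"
proof -
  define r where "r = sqrt p"
  have r: "r > 0" "p = r * r" using assms by (auto simp: r_def)
  show ?thesis
    unfolding defect_def r_def[symmetric] using r by (simp add: field_simps power2_eq_square)
qed

lemma defect_nonneg: "0 < p \<Longrightarrow> 0 \<le> defect p"
  by (simp add: defect_eq)

text \<open>After cancelling (r - 1)^2 with r = sqrt p, the claim is 3 r (1 + r)^2 <= 4 (r + 2),
  with equality at r = 1. So 4/3 is sharp, and the estimate fails for every p > 1.\<close>

lemma defect_ge_below:
  assumes "0 < p" "p \<le> 1"
  shows "(1 - p)\<^sup>2 \<le> 4 / 3 * defect p"
proof -
  define r where "r = sqrt p"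
  have r: "0 < r" "r \<le> 1" "p = r\<^sup>2" using assms by (auto simp: r_def)
  have "(1 + r)\<^sup>2 * r \<le> 2\<^sup>2 * r" using r by (intro mult_right_mono power_mono) auto
  moreover have "3 * X \<le> 4 * (r + 2)" if "X \<le> 2\<^sup>2 * r" for X using that r by simp
  ultimately have "3 * ((1 + r)\<^sup>2 * r) \<le> 4 * (r + 2)" by blast
  then have "(r - 1)\<^sup>2 * (3 * ((1 + r)\<^sup>2 * r)) \<le> (r - 1)\<^sup>2 * (4 * (r + 2))"
    by (intro mult_left_mono) auto
  moreover have "(1 - p)\<^sup>2 = (r - 1)\<^sup>2 * (1 + r)\<^sup>2" by (simp add: r power2_eq_square algebra_simps)
  ultimately show ?thesis
    unfolding defect_eq[OF assms(1)] r_def[symmetric] using r by (simp add: field_simps)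
qed

text \<open>The same sharp constant is recovered for p >= 1 when p is replaced by 1/p, the
  derivative of the inverse of the height map.\<close>

lemma defect_ge_above:
  assumes "1 \<le> p"
  shows "(1 - 1 / p)\<^sup>2 \<le> 4 / 3 * defect p"
proof -
  define r where "r = sqrt p"
  have r: "1 \<le> r" "p = r\<^sup>2" using assms by (auto simp: r_def)
  have "(r + 1)\<^sup>2 \<le> (2 * r)\<^sup>2" using r by (intro power_mono) auto
  moreover have "r\<^sup>2 * 1 \<le> r\<^sup>2 * r" using r by (intro mult_left_mono) auto
  moreover have "r\<^sup>2 * r * 3 \<le> r\<^sup>2 * r * (r + 2)" using r by (intro mult_left_mono) auto
  ultimately have "3 * (r + 1)\<^sup>2 \<le> 4 * (r\<^sup>2 * r * (r + 2))" by (simp add: power_mult_distrib)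
  then have *: "(r - 1)\<^sup>2 * (3 * (r + 1)\<^sup>2) \<le> (r - 1)\<^sup>2 * (4 * (r\<^sup>2 * r * (r + 2)))"
    by (intro mult_left_mono) auto
  have "(1 - 1 / p)\<^sup>2 = (r - 1)\<^sup>2 * (r + 1)\<^sup>2 / r ^ 4"
    using r by (simp add: field_simps power2_eq_square power4_eq_xxxx)
  moreover have "4 / 3 * defect p = (r - 1)\<^sup>2 * (4 * (r\<^sup>2 * r * (r + 2))) / 3 / r ^ 4"
    unfolding defect_eq[OF less_le_trans[OF zero_less_one assms]] r_def[symmetric]
    using r by (simp add: field_simps power2_eq_square power4_eq_xxxx)
  moreover have "(r - 1)\<^sup>2 * (r + 1)\<^sup>2 / r ^ 4 \<le> (r - 1)\<^sup>2 * (4 * (r\<^sup>2 * r * (r + 2))) / 3 / r ^ 4"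
    using * by (intro divide_right_mono) auto
  ultimately show ?thesis by (simp only:)
qed

text \<open>The mass balance a(z) dz = pi (1 - \<zeta>^2) d\<zeta> solved for the derivative of
  \<zeta>.\<close>

definition transport_rate :: "(real \<times> real \<times> real) set \<Rightarrow> (real \<Rightarrow> real) \<Rightarrow> real \<Rightarrow> real" where
  "transport_rate U \<zeta> z = slice_vol U z / (pi * (1 - (\<zeta> z)\<^sup>2))"

text \<open>The ends of the projection are recognised by the values 0 and 1 of
  \<open>slice_cdf\<close>, so no endpoints need to be named.\<close>

definition slice_transport :: "(real \<times> real \<times> real) set \<Rightarrow> (real \<Rightarrow> real) \<Rightarrow> bool" where
  "slice_transport U \<zeta> \<longleftrightarrow> continuous_on UNIV \<zeta> \<and> mono \<zeta>
    \<and> (\<forall>z. (slice_cdf U z = 0 \<longrightarrow> \<zeta> z = -1) \<and> (slice_cdf U z = 1 \<longrightarrow> \<zeta> z = 1))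
    \<and> (\<forall>z\<in>fst ` U. -1 < \<zeta> z \<and> \<zeta> z < 1 \<and> (\<zeta> has_real_derivative transport_rate U \<zeta> z) (at z))"

lemma transport_rate_pos:
  assumes "open U" "bounded U" "slice_transport U \<zeta>" "z \<in> fst ` U"
  shows "0 < transport_rate U \<zeta> z"
  using assms slice_vol_pos[OF assms(1,2,4)] abs_square_less_1[of "\<zeta> z"]
  by (auto simp: transport_rate_def slice_transport_def)

lemma sum_ge_two_sqrt:
  fixes a b :: real
  assumes "0 \<le> a" "0 \<le> b"
  shows "2 * sqrt (a * b) \<le> a + b"
  using arith_geo_mean_sqrt[OF assms] by simp

lemma slice_point_facts:
  fixes U :: "(real \<times> real \<times> real) set"
  assumes "open U" "convex U" "bounded U" "(z, y, x) \<in> U"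
  shows "open (slice U z)" "convex (slice U z)" "bounded (slice U z)" "z \<in> fst ` U" "y \<in> fst ` slice U z"
    "open (slice (slice U z) y)" "convex (slice (slice U z) y)" "bounded (slice (slice U z) y)"
    "x \<in> slice (slice U z) y" "slice U z \<noteq> {}"
  using assms(4) by (force intro!: open_slice convex_slice bounded_slice assms simp: slice_def)+

text \<open>Heights are matched by mass with heights of the ball, then within each slice the
  y-coordinate with that of the disc, and each remaining segment is mapped affinely onto a chord.
  Every coordinate increases in its own variable, and \<open>d\<close> collects the diagonal of the
  triangular derivative. Its entries have product 1, so AM-GM on the last two gives the bound on
  their sum.\<close>

lemma knothe_rearrangement:
  fixes U :: "(real \<times> real \<times> real) set"
  assumes U: "open U" "convex U" "bounded U" "U \<noteq> {}" and V: "measure lborel U = 4 * pi / 3"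
  obtains \<zeta> :: "real \<Rightarrow> real" and T :: "real^3 \<Rightarrow> real^3" and d :: "3 \<Rightarrow> real^3 \<Rightarrow> real" where
    "slice_transport U \<zeta>"
    "T \<in> borel_measurable borel" "\<And>x. norm (T x) \<le> 1" "\<And>x. (x$1, x$2, x$3) \<notin> U \<Longrightarrow> T x = 0"
    "\<And>x t i. (x$1, x$2, x$3) \<in> U \<Longrightarrow> 0 < t \<Longrightarrow> ((x + t *\<^sub>R axis i 1)$1, (x + t *\<^sub>R axis i 1)$2, (x + t *\<^sub>R axis i 1)$3) \<in> U
      \<Longrightarrow> T x $ i \<le> T (x + t *\<^sub>R axis i 1) $ i"
    "\<And>x i. (x$1, x$2, x$3) \<in> U \<Longrightarrow> ((\<lambda>t. T (x + t *\<^sub>R axis i 1) $ i) has_real_derivative d i x) (at 0)"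
    "\<And>x. (x$1, x$2, x$3) \<in> U \<Longrightarrow> 3 + defect (transport_rate U \<zeta> (x$1)) \<le> (\<Sum>i\<in>UNIV. d i x)"
proof -
  obtain N :: "real \<Rightarrow> real" where N: "continuous_on UNIV N" "N 0 = -1" "N 1 = 1" "mono N" "\<And>t. -1 \<le> N t \<and> N t \<le> 1"
    "\<And>t. 0 < t \<Longrightarrow> t < 1 \<Longrightarrow> -1 < N t \<and> N t < 1 \<and> (N has_real_derivative 1 / (3 / 4 * (1 - (N t)\<^sup>2))) (at t)"
    by (rule ball_cdf_inverse) (rule that; assumption)
  obtain M :: "real \<Rightarrow> real" where M: "continuous_on UNIV M" "mono M" "\<And>t. -1 \<le> M t \<and> M t \<le> 1"
    "\<And>t. 0 < t \<Longrightarrow> t < 1 \<Longrightarrow> -1 < M t \<and> M t < 1 \<and> (M has_real_derivative 1 / (2 / pi * sqrt (1 - (M t)\<^sup>2))) (at t)"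
    by (rule disc_cdf_inverse) (rule that; assumption)
  define \<zeta> where "\<zeta> z = N (slice_cdf U z)" for z
  define \<sigma> where "\<sigma> z y = M (slice_cdf (slice U z) y)" for z y
  define I where "I z y = slice (slice U z) y" for z y
  define \<tau> where "\<tau> z y x = 2 * (measure lborel (I z y \<inter> {..<x}) / measure lborel (I z y)) - 1" for z y x
  define cU where "cU x \<longleftrightarrow> (x$1, x$2, x$3) \<in> U" for x :: "real^3"
  \<comment> \<open>The factors are the radius of the disc of the ball at height \<zeta> and the
    half chord of that disc at the relative position \<sigma>. Thus 1 - |T|^2 = (1 - \<zeta>^2) (1 -
    \<sigma>^2) (1 - \<tau>^2).\<close>
  define T where "T x = (if cU x then pt (\<zeta> (x$1), sqrt (1 - (\<zeta> (x$1))\<^sup>2) * \<sigma> (x$1) (x$2),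
      sqrt (1 - (\<zeta> (x$1))\<^sup>2) * sqrt (1 - (\<sigma> (x$1) (x$2))\<^sup>2) * \<tau> (x$1) (x$2) (x$3)) else 0)" for x
  define d :: "3 \<Rightarrow> real^3 \<Rightarrow> real" where "d i x = 
     (if i = 1 then transport_rate U \<zeta> (x$1)
      else if i = 2 then sqrt (1 - (\<zeta> (x$1))\<^sup>2) * (slice_vol (slice U (x$1)) (x$2) / slice_vol U (x$1) * (1 / (2 / pi * sqrt (1 - (\<sigma> (x$1) (x$2))\<^sup>2))))
      else sqrt (1 - (\<zeta> (x$1))\<^sup>2) * sqrt (1 - (\<sigma> (x$1) (x$2))\<^sup>2) * (2 / slice_vol (slice U (x$1)) (x$2)))" for i x
  have \<zeta>b: "-1 \<le> \<zeta> z \<and> \<zeta> z \<le> 1" for z unfolding \<zeta>_def by (rule N(5))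
  have \<sigma>b: "-1 \<le> \<sigma> z y \<and> \<sigma> z y \<le> 1" for z y unfolding \<sigma>_def by (rule M(3))
  have \<zeta>c: "continuous_on UNIV \<zeta>"
    unfolding \<zeta>_def by (rule continuous_on_compose2[OF N(1) continuous_slice_cdf[OF U(1,3,4)]]) simp
  have \<zeta>f: "-1 < \<zeta> z \<and> \<zeta> z < 1 \<and> (\<zeta> has_real_derivative transport_rate U \<zeta> z) (at z)" if z: "z \<in> fst ` U" for z
  proof -
    obtain \<alpha> \<beta> where ab: "fst ` U = {\<alpha><..<\<beta>}" by (rule fst_image_eq_interval[OF U]) (rule that)
    have c: "0 < slice_cdf U z" "slice_cdf U z < 1"
      using slice_cdf_ends(3)[OF U(1,3,4) ab] z ab by auto
    note Nc = N(6)[OF c]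
    have dN: "(N has_real_derivative 1 / (3 / 4 * (1 - (\<zeta> z)\<^sup>2))) (at (slice_cdf U z))"
      using Nc unfolding \<zeta>_def by (elim conjE)
    have "(\<zeta> has_real_derivative (1 / (3 / 4 * (1 - (\<zeta> z)\<^sup>2))) * (slice_vol U z / (4 * pi / 3))) (at z)"
      using DERIV_chain2[OF dN slice_cdf_has_derivative[OF U(1-3) z]] unfolding V \<zeta>_def[abs_def] .
    \<comment> \<open>The equal volumes of body and ball cancel here, leaving the quotient of the
      two slice areas.\<close>
    moreover have "(1 / (3 / 4 * c)) * (a / (4 * pi / 3)) = a / (pi * c)" for a c :: real
      by (cases "c = 0") (auto simp: field_simps)
    ultimately have "(\<zeta> has_real_derivative transport_rate U \<zeta> z) (at z)"
      unfolding transport_rate_def by (simp only:)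
    then show ?thesis using Nc unfolding \<zeta>_def by (elim conjE, intro conjI)
  qed
  have \<sigma>f: "-1 < \<sigma> z y \<and> \<sigma> z y < 1 \<and> (\<sigma> z has_real_derivative
      slice_vol (slice U z) y / slice_vol U z * (1 / (2 / pi * sqrt (1 - (\<sigma> z y)\<^sup>2)))) (at y)"
    if "(z, y, x) \<in> U" for z y x
  proof -
    note S = slice_point_facts[OF U(1-3) that]
    obtain \<alpha> \<beta> where ab: "fst ` slice U z = {\<alpha><..<\<beta>}" by (rule fst_image_eq_interval[OF S(1-3,10)]) (rule that)
    have c: "0 < slice_cdf (slice U z) y" "slice_cdf (slice U z) y < 1"
      using slice_cdf_ends(3)[OF S(1,3,10) ab] S(5) ab by auto
    note Mc = M(4)[OF c]
    have dM: "(M has_real_derivative 1 / (2 / pi * sqrt (1 - (\<sigma> z y)\<^sup>2))) (at (slice_cdf (slice U z) y))"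
      using Mc unfolding \<sigma>_def by (elim conjE)
    have "(\<sigma> z has_real_derivative (1 / (2 / pi * sqrt (1 - (\<sigma> z y)\<^sup>2))) * (slice_vol (slice U z) y / slice_vol U z)) (at y)"
      using DERIV_chain2[OF dM slice_cdf_has_derivative[OF S(1-3,5)]] unfolding slice_vol_def[of U] \<sigma>_def[abs_def] .
    then show ?thesis using Mc by (simp add: \<sigma>_def mult.commute)
  qed
  have \<tau>f: "-1 < \<tau> z y x \<and> \<tau> z y x < 1 \<and> (\<tau> z y has_real_derivative 2 / slice_vol (slice U z) y) (at x)
      \<and> slice_vol (slice U z) y > 0 \<and> slice_vol U z > 0"
    if "(z, y, x) \<in> U" for z y x
  proof -
    note S = slice_point_facts[OF U(1-3) that, folded I_def]
    note C = interval_cdf[OF S(6-9)]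
    have "(\<tau> z y has_real_derivative 2 * (1 / measure lborel (I z y)) - 0) (at x)"
      unfolding \<tau>_def by (intro DERIV_diff DERIV_cmult C(2) DERIV_const)
    moreover have "-1 < \<tau> z y x" "\<tau> z y x < 1" using C(1) unfolding \<tau>_def by linarith+
    ultimately show ?thesis
      using C(3) slice_vol_pos[OF U(1,3) S(4)] by (simp add: slice_vol_def[of "slice U z"] I_def)
  qed
  \<comment> \<open>T is cut off to 0 outside U; along each axis its formula still holds for all
    small t, which is enough for derivatives at 0.\<close>
  have opn: "open {t. cU (x + t *\<^sub>R axis i 1)}" for x and i :: 3
    unfolding cU_def by (intro open_vimage[OF U(1), unfolded vimage_def] continuous_intros)
  have nn: "0 \<le> sqrt (1 - (\<zeta> z)\<^sup>2)" "0 \<le> sqrt (1 - (\<sigma> z y)\<^sup>2)" for z y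
    using \<zeta>b[of z] \<sigma>b[of z y] by (auto simp: abs_square_le_1 abs_le_iff)
  have T1: "norm (T x) \<le> 1" for x
  proof (cases "cU x")
    case True
    then have u: "(x$1, x$2, x$3) \<in> U" by (simp add: cU_def)
    define A B C where "A = (\<zeta> (x$1))\<^sup>2" and "B = (\<sigma> (x$1) (x$2))\<^sup>2" and "C = (\<tau> (x$1) (x$2) (x$3))\<^sup>2"
    have ABC: "A \<le> 1" "B \<le> 1" "C \<le> 1"
      using \<zeta>b[of "x$1"] \<sigma>b[of "x$1" "x$2"] \<tau>f[OF u]
      by (auto simp: A_def B_def C_def abs_square_le_1 abs_le_iff)
    have "(norm (T x))\<^sup>2 = A + (1 - A) * B + (1 - A) * (1 - B) * C"
      using True ABC by (simp add: T_def power2_norm_eq_inner inner_vec_def sum_3 power_mult_distrib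
          power2_eq_square[symmetric] A_def B_def C_def)
    also have "\<dots> = 1 - (1 - A) * (1 - B) * (1 - C)" by (simp add: algebra_simps)
    also have "\<dots> \<le> 1" using ABC by simp
    finally show ?thesis by (simp add: abs_square_le_1)
  qed (simp add: T_def)
  have Tm: "T \<in> borel_measurable borel"
  proof -
    have [measurable]: "(\<lambda>x::real^3. x $ i) \<in> borel_measurable borel" for i
      by (rule borel_measurable_vec_nth) simp
    have \<zeta>m[measurable]: "\<zeta> \<in> borel_measurable borel" using \<zeta>c by (rule borel_measurable_continuous_onI)
    have Mm[measurable]: "M \<in> borel_measurable borel" using M(1) by (rule borel_measurable_continuous_onI)
    \<comment> \<open>Joint measurability in all parameters: the measures inside \<sigma> and \<tau>
      are section measures of open sets in a product space.\<close>
    have "open {((z, y), p). (z, p) \<in> U \<and> fst p < y}"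
    proof -
      have "{((z, y), p). (z, p) \<in> U \<and> fst p < y} = {v. (fst (fst v), snd v) \<in> U} \<inter> {v. fst (snd v) < snd (fst v)}"
        by auto
      moreover have "open {v :: (real \<times> real) \<times> (real \<times> real). (fst (fst v), snd v) \<in> U}"
        by (intro open_vimage[OF U(1), unfolded vimage_def] continuous_intros)
      moreover have "open {v :: (real \<times> real) \<times> (real \<times> real). fst (snd v) < snd (fst v)}"
        by (intro open_Collect_less continuous_intros)
      ultimately show ?thesis by auto
    qed
    note 1 = measurable_section_measure[OF this]
    have e1: "Pair c -` {((z, y), p). (z, p) \<in> U \<and> fst p < y} = slice U (fst c) \<inter> {p. fst p < snd c}" for c
      by (cases c) (auto simp: slice_def)
    have 1: "(\<lambda>c. measure lborel (slice U (fst c) \<inter> {p. fst p < snd c})) \<in> borel_measurable borel"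
      using 1 unfolding e1 .
    have \<sigma>m: "(\<lambda>c. \<sigma> (fst c) (snd c)) \<in> borel_measurable borel"
    proof -
      have "fst \<in> borel_measurable (borel :: (real \<times> real) measure)"
        by (intro borel_measurable_continuous_onI continuous_intros)
      from measurable_compose[OF this slice_vol_measurable[OF U(1)]]
      show ?thesis unfolding \<sigma>_def slice_cdf_def slice_vol_def[symmetric]
        by (rule measurable_compose[OF borel_measurable_divide[OF 1] Mm])
    qed
    have "open {((z, y, x), t). (z, y, t) \<in> U \<and> t < x}"
    proof -
      have "{((z, y, x), t). (z, y, t) \<in> U \<and> t < x} = {v. (fst (fst v), fst (snd (fst v)), snd v) \<in> U} \<inter> {v. snd v < snd (snd (fst v))}"
        by auto
      moreover have "open {v :: (real \<times> real \<times> real) \<times> real. (fst (fst v), fst (snd (fst v)), snd v) \<in> U}"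
        by (intro open_vimage[OF U(1), unfolded vimage_def] continuous_intros)
      moreover have "open {v :: (real \<times> real \<times> real) \<times> real. snd v < snd (snd (fst v))}"
        by (intro open_Collect_less continuous_intros)
      ultimately show ?thesis by auto
    qed
    note 2 = measurable_section_measure[OF this]
    have e2: "Pair c -` {((z, y, x), t). (z, y, t) \<in> U \<and> t < x} = I (fst c) (fst (snd c)) \<inter> {..<snd (snd c)}" for c
      by (cases c) (auto simp: slice_def I_def)
    have 2: "(\<lambda>c. measure lborel (I (fst c) (fst (snd c)) \<inter> {..<snd (snd c)})) \<in> borel_measurable borel"
      using 2 unfolding e2 .
    have "open {v :: (real \<times> real) \<times> real. (fst (fst v), snd (fst v), snd v) \<in> U}"
      by (intro open_vimage[OF U(1), unfolded vimage_def] continuous_intros)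
    note 3 = measurable_section_measure[OF this]
    have e3: "Pair c -` {v. (fst (fst v), snd (fst v), snd v) \<in> U} = I (fst c) (snd c)" for c
      by (cases c) (auto simp: slice_def I_def)
    have 3: "(\<lambda>c. measure lborel (I (fst c) (snd c))) \<in> borel_measurable borel"
      using 3 unfolding e3 .
    have pm: "(\<lambda>x::real^3. (x$1, x$2)) \<in> borel_measurable borel" "(\<lambda>x::real^3. (x$1, x$2, x$3)) \<in> borel_measurable borel"
      by (intro borel_measurable_continuous_onI continuous_intros)+
    have [measurable]: "(\<lambda>x::real^3. \<sigma> (x$1) (x$2)) \<in> borel_measurable borel"
      using measurable_compose[OF pm(1) \<sigma>m] by simp
    have [measurable]: "(\<lambda>x::real^3. measure lborel (I (x$1) (x$2) \<inter> {..<x$3})) \<in> borel_measurable borel"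
      using measurable_compose[OF pm(2) 2] by simp
    have [measurable]: "(\<lambda>x::real^3. measure lborel (I (x$1) (x$2))) \<in> borel_measurable borel"
      using measurable_compose[OF pm(1) 3] by simp
    have [measurable]: "(\<lambda>x::real^3. \<tau> (x$1) (x$2) (x$3)) \<in> borel_measurable borel"
      unfolding \<tau>_def by measurable
    have "(\<lambda>x::real^3. pt (\<zeta> (x$1), sqrt (1 - (\<zeta> (x$1))\<^sup>2) * \<sigma> (x$1) (x$2),
      sqrt (1 - (\<zeta> (x$1))\<^sup>2) * sqrt (1 - (\<sigma> (x$1) (x$2))\<^sup>2) * \<tau> (x$1) (x$2) (x$3))) \<in> borel_measurable borel"
    proof (rule measurable_compose[OF _ borel_measurable_continuous_onI[OF continuous_on_pt]])
      show "(\<lambda>x::real^3. (\<zeta> (x$1), sqrt (1 - (\<zeta> (x$1))\<^sup>2) * \<sigma> (x$1) (x$2),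
        sqrt (1 - (\<zeta> (x$1))\<^sup>2) * sqrt (1 - (\<sigma> (x$1) (x$2))\<^sup>2) * \<tau> (x$1) (x$2) (x$3))) \<in> borel_measurable borel"
        by (intro borel_measurable_Pair) measurable
    qed
    moreover have "{x. cU x} \<in> sets borel"
      unfolding cU_def by (intro borel_open open_vimage[OF U(1), unfolded vimage_def] continuous_intros)
    ultimately show ?thesis unfolding T_def by (intro measurable_If) simp_all
  qed
  have Tmono: "T x $ i \<le> T (x + t *\<^sub>R axis i 1) $ i"
    if "cU x" "0 < t" "cU (x + t *\<^sub>R axis i 1)" for x t i
  proof -
    have u: "(x$1, x$2, x$3) \<in> U" using that by (simp add: cU_def)
    note S = slice_point_facts[OF U(1-3) u]
    consider "i = 1" | "i = 2" | "i = 3" using exhaust_3 by blast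
    then show ?thesis
    proof cases
      case 1
      then show ?thesis
        using that monoD[OF N(4) slice_cdf_mono[OF U(1,3,4)], of "x$1" "x$1 + t"] by (simp add: T_def \<zeta>_def axis_def)
    next
      case 2
      have "\<sigma> (x$1) (x$2) \<le> \<sigma> (x$1) (x$2 + t)"
        unfolding \<sigma>_def using that by (intro monoD[OF M(2)] slice_cdf_mono S) simp
      then show ?thesis using 2 that nn by (simp add: T_def axis_def mult_left_mono)
    next
      case 3
      have "\<tau> (x$1) (x$2) (x$3) \<le> \<tau> (x$1) (x$2) (x$3 + t)"
        unfolding \<tau>_def I_def using that interval_cdf_mono[OF S(6,8), of "x$3" "x$3 + t"] by simp
      then show ?thesis using 3 that nn by (simp add: T_def axis_def mult_left_mono)
    qed
  qed
  have Td: "((\<lambda>t. T (x + t *\<^sub>R axis i 1) $ i) has_real_derivative d i x) (at 0)" if "cU x" for x i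
  proof -
    have u: "(x$1, x$2, x$3) \<in> U" using that by (simp add: cU_def)
    note S = slice_point_facts[OF U(1-3) u]
    have m0: "0 \<in> {t. cU (x + t *\<^sub>R axis i 1)}" using that by simp
    consider "i = 1" | "i = 2" | "i = 3" using exhaust_3 by blast
    then show ?thesis
    proof cases
      case 1
      have "((\<lambda>t. \<zeta> (t + x$1)) has_real_derivative d i x) (at 0)"
        using \<zeta>f[OF S(4)] 1 DERIV_shift[of \<zeta> "d i x" 0 "x$1"] by (simp add: d_def)
      then show ?thesis
        by (rule has_field_derivative_transform_within_open[OF _ opn m0])
          (simp add: T_def 1 axis_def add.commute)
    next
      case 2
      have "((\<lambda>t. \<sigma> (x$1) (t + x$2)) has_real_derivative slice_vol (slice U (x$1)) (x$2) / slice_vol U (x$1) * (1 / (2 / pi * sqrt (1 - (\<sigma> (x$1) (x$2))\<^sup>2)))) (at 0)"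
        using \<sigma>f[OF u] DERIV_shift[of "\<sigma> (x$1)" _ 0 "x$2"] by simp
      from DERIV_cmult[OF this, of "sqrt (1 - (\<zeta> (x$1))\<^sup>2)"]
      have "((\<lambda>t. sqrt (1 - (\<zeta> (x$1))\<^sup>2) * \<sigma> (x$1) (t + x$2)) has_real_derivative d i x) (at 0)"
        using 2 by (simp add: d_def)
      then show ?thesis
        by (rule has_field_derivative_transform_within_open[OF _ opn m0])
          (simp add: T_def 2 axis_def add.commute)
    next
      case 3
      have "((\<lambda>t. \<tau> (x$1) (x$2) (t + x$3)) has_real_derivative 2 / slice_vol (slice U (x$1)) (x$2)) (at 0)"
        using \<tau>f[OF u] DERIV_shift[of "\<tau> (x$1) (x$2)" _ 0 "x$3"] by simp
      from DERIV_cmult[OF this, of "sqrt (1 - (\<zeta> (x$1))\<^sup>2) * sqrt (1 - (\<sigma> (x$1) (x$2))\<^sup>2)"]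
      have "((\<lambda>t. sqrt (1 - (\<zeta> (x$1))\<^sup>2) * sqrt (1 - (\<sigma> (x$1) (x$2))\<^sup>2) * \<tau> (x$1) (x$2) (t + x$3)) has_real_derivative d i x) (at 0)"
        using 3 by (simp add: d_def)
      then show ?thesis
        by (rule has_field_derivative_transform_within_open[OF _ opn m0])
          (simp add: T_def 3 axis_def add.commute)
    qed
  qed
  have dsum: "3 + defect (transport_rate U \<zeta> (x$1)) \<le> (\<Sum>i\<in>UNIV. d i x)" if "cU x" for x
  proof -
    have u: "(x$1, x$2, x$3) \<in> U" using that by (simp add: cU_def)
    note S = slice_point_facts[OF U(1-3) u]
    define a l r s where "a = slice_vol U (x$1)" and "l = slice_vol (slice U (x$1)) (x$2)"
      and "r = sqrt (1 - (\<zeta> (x$1))\<^sup>2)" and "s = sqrt (1 - (\<sigma> (x$1) (x$2))\<^sup>2)"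
    have pos: "a > 0" "l > 0" using \<tau>f[OF u] by (auto simp: a_def l_def)
    have rs: "r > 0" "s > 0"
      using \<zeta>f[OF S(4)] \<sigma>f[OF u] by (auto simp: r_def s_def abs_square_less_1 abs_less_iff)
    have r2: "1 - (\<zeta> (x$1))\<^sup>2 = r\<^sup>2" using \<zeta>b[of "x$1"] by (simp add: r_def abs_square_le_1 abs_le_iff)
    have d: "d 1 x = a / (pi * r\<^sup>2)" "d 2 x = r * (l / a * (1 / (2 / pi * s)))" "d 3 x = r * s * (2 / l)"
      using rs(1) by (simp_all add: d_def transport_rate_def a_def l_def r_def[symmetric] s_def r2)
    have "2 * sqrt (d 2 x * d 3 x) \<le> d 2 x + d 3 x"
      unfolding d using pos rs by (intro sum_ge_two_sqrt) auto
    moreover have "d 2 x * d 3 x = pi * r\<^sup>2 / a"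
      unfolding d using pos rs by (simp add: field_simps power2_eq_square)
    moreover have "2 / sqrt (a / (pi * r\<^sup>2)) = 2 * sqrt (pi * r\<^sup>2 / a)"
      by (simp add: real_sqrt_divide)
    ultimately show ?thesis
      unfolding sum_3 transport_rate_def defect_def r2 a_def[symmetric] d(1) by simp
  qed
  show ?thesis
  proof (rule that[of \<zeta> T d])
    have "mono \<zeta>" unfolding \<zeta>_def
      by (intro monoI monoD[OF N(4)] slice_cdf_mono[OF U(1,3,4)])
    then show "slice_transport U \<zeta>"
      using \<zeta>c \<zeta>f N(2,3) by (auto simp: slice_transport_def \<zeta>_def)
    show "T x = 0" if "(x$1, x$2, x$3) \<notin> U" for x using that by (simp add: T_def cU_def)
  qed (use Tm T1 Tmono Td dsum in \<open>simp_all only: cU_def\<close>)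
qed

section \<open>From the rearrangement to a lower bound for the perimeter\<close>

lemma perimeter_finite:
  fixes F :: "(real^3) set"
  assumes "convex F" "compact F" "0 \<in> interior F"
  shows "perimeter F = ereal (P F)" "0 \<le> P F"
proof -
  obtain r where r: "r > 0" "cball 0 r \<subseteq> F"
    using assms(3) by (meson interior_subset mem_interior_cball subset_trans)
  have up: "perimeter F \<le> ereal (3 * measure lebesgue F / r)"
    by (rule perimeter_convex_le[OF assms(1,2) r(2,1)])
  have c0: "C1_compact_support (\<lambda>x::real^3. 0 :: real^3)"
    by (simp add: C1_compact_support_def)
  have "ereal (LINT x:F|lebesgue. divergence (\<lambda>x::real^3. 0 :: real^3) x) \<le> perimeter F"
    unfolding perimeter_def using c0 by (intro SUP_upper) auto
  moreover have "divergence (\<lambda>x::real^3. 0 :: real^3) x = 0" for x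
    by (simp add: divergence_eq_sum)
  ultimately have lo: "0 \<le> perimeter F" by (simp add: zero_ereal_def)
  show "perimeter F = ereal (P F)" "0 \<le> P F"
    using up lo unfolding P_def by (cases "perimeter F"; simp)+
qed

text \<open>Passing to the interior makes all slices open and costs no volume, since the frontier of
  a convex set is negligible.\<close>

lemma coordinate_body:
  fixes F :: "(real^3) set"
  assumes "convex F" "compact F" "0 \<in> interior F"
  defines "U \<equiv> {p. pt p \<in> interior F}"
  shows "open U" "convex U" "bounded U" "0 \<in> U" "measure lborel U = measure lebesgue F"
    and "(x$1, x$2, x$3) \<in> U \<longleftrightarrow> x \<in> interior F"
proof -
  have pm: "pt \<in> borel_measurable borel" using continuous_on_pt by (rule borel_measurable_continuous_onI)
  show "open U"
    unfolding U_def by (rule open_vimage[OF open_interior continuous_on_pt, unfolded vimage_def])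
  show "convex U"
    unfolding U_def using convex_linear_vimage[OF linear_pt convex_interior[OF assms(1)]] by (simp add: vimage_def)
  show "0 \<in> U" unfolding U_def using assms(3) linear_0[OF linear_pt] by simp
  show cr: "(x$1, x$2, x$3) \<in> U \<longleftrightarrow> x \<in> interior F" for x by (simp add: U_def)
  have "U \<subseteq> (\<lambda>x. (x$1, x$2, x$3)) ` F"
  proof
    fix p assume "p \<in> U"
    then have "pt p \<in> F" using interior_subset by (auto simp: U_def)
    moreover have "p = (pt p $ 1, pt p $ 2, pt p $ 3)" by (cases p) simp
    ultimately show "p \<in> (\<lambda>x. (x$1, x$2, x$3)) ` F" by blast
  qed
  moreover have "bounded ((\<lambda>x::real^3. (x$1, x$2, x$3)) ` F)"
    by (intro compact_imp_bounded compact_continuous_image assms(2) continuous_intros)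
  ultimately show "bounded U" by (rule bounded_subset[rotated])
  have "emeasure lborel U = emeasure (distr lborel borel pt) (interior F)"
    using pm by (subst emeasure_distr) (auto simp: U_def vimage_def)
  then have "measure lborel U = measure lborel (interior F)"
    by (simp add: distr_lborel_pt measure_def)
  also have "\<dots> = measure lebesgue (interior F)" by simp
  also have "\<dots> = measure lebesgue F"
    by (intro measure_interior negligible_convex_frontier assms compact_imp_bounded)
  finally show "measure lborel U = measure lebesgue F" .
qed

lemma nn_integral_coordinate_body:
  fixes S :: "(real^3) set" and f :: "real \<Rightarrow> ennreal"
  assumes "open U" "bounded U" and U: "\<And>x. (x$1, x$2, x$3) \<in> U \<longleftrightarrow> x \<in> S"
    and [measurable]: "f \<in> borel_measurable borel" "S \<in> sets borel"
  shows "(\<integral>\<^sup>+x\<in>S. f (x$1) \<partial>lborel) = (\<integral>\<^sup>+z. f z * ennreal (slice_vol U z) \<partial>lborel)"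
proof -
  have pm[measurable]: "pt \<in> borel_measurable borel" using continuous_on_pt by (rule borel_measurable_continuous_onI)
  have [measurable]: "(\<lambda>x::real^3. x $ i) \<in> borel_measurable borel" for i
    by (rule borel_measurable_vec_nth) simp
  have [measurable]: "U \<in> sets borel" using assms(1) by simp
  have [measurable]: "(fst :: real \<times> real \<times> real \<Rightarrow> real) \<in> borel_measurable borel"
    by (intro borel_measurable_continuous_onI continuous_intros)
  have "(\<integral>\<^sup>+x\<in>S. f (x$1) \<partial>lborel) = (\<integral>\<^sup>+x\<in>S. f (x$1) \<partial>distr lborel borel pt)"
    by (simp add: distr_lborel_pt)
  also have "\<dots> = (\<integral>\<^sup>+p. f (pt p $ 1) * indicator S (pt p) \<partial>lborel)"
    by (rule nn_integral_distr) measurable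
  also have "\<dots> = (\<integral>\<^sup>+p. f (fst p) * indicator U p \<partial>lborel)"
  proof (rule nn_integral_cong)
    fix p :: "real \<times> real \<times> real"
    have "pt p \<in> S \<longleftrightarrow> p \<in> U" using U[of "pt p"] by (cases p) simp
    moreover have "pt p $ 1 = fst p" by (cases p) simp
    ultimately show "f (pt p $ 1) * indicator S (pt p) = f (fst p) * indicator U p" by (simp add: indicator_def)
  qed
  also have "\<dots> = (\<integral>\<^sup>+p. f (fst p) * indicator U p \<partial>(lborel \<Otimes>\<^sub>M lborel))"
    by (simp add: lborel_prod)
  also have "\<dots> = (\<integral>\<^sup>+z. \<integral>\<^sup>+q. f (fst (z, q)) * indicator U (z, q) \<partial>lborel \<partial>lborel)"
  proof (rule lborel.nn_integral_fst[symmetric])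
    have "(\<lambda>p. f (fst p) * indicator U p) \<in> borel_measurable (lborel :: (real \<times> real \<times> real) measure)"
      by measurable
    then show "(\<lambda>p. f (fst p) * indicator U p) \<in> borel_measurable (lborel \<Otimes>\<^sub>M lborel)"
      by (simp only: lborel_prod)
  qed
  also have "\<dots> = (\<integral>\<^sup>+z. f z * ennreal (slice_vol U z) \<partial>lborel)"
  proof (rule nn_integral_cong)
    fix z :: real
    have "(\<integral>\<^sup>+q. f (fst (z, q)) * indicator U (z, q) \<partial>lborel) = (\<integral>\<^sup>+q. f z * indicator (slice U z) q \<partial>lborel)"
      by (intro nn_integral_cong) (simp add: slice_def indicator_def)
    also have "\<dots> = f z * emeasure lborel (slice U z)"
      using open_slice[OF assms(1)] by (simp add: nn_integral_cmult)
    also have "emeasure lborel (slice U z) = ennreal (slice_vol U z)"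
      using emeasure_bounded_finite[OF bounded_slice[OF assms(2)], of z]
      by (simp add: slice_vol_def emeasure_eq_ennreal_measure)
    finally show "(\<integral>\<^sup>+q. f (fst (z, q)) * indicator U (z, q) \<partial>lborel) = f z * ennreal (slice_vol U z)" .
  qed
  finally show ?thesis .
qed

text \<open>The rearrangement is controlled only inside the body, while mollifying needs room. So
  the perimeter of s F is tested for s < 1, which is at most that of F, the partial derivatives are
  integrated over s^2 F, and finally s tends to 1.\<close>

lemma perimeter_ge_transport:
  fixes F :: "(real^3) set"
  assumes F: "convex F" "compact F" "0 \<in> interior F" and V: "measure lebesgue F = 4 * pi / 3"
  defines "U \<equiv> {p. pt p \<in> interior F}"
  obtains \<zeta> :: "real \<Rightarrow> real" where
    "slice_transport U \<zeta>"
    "(\<integral>\<^sup>+z. ennreal (3 + defect (transport_rate U \<zeta> z)) * ennreal (slice_vol U z) \<partial>lborel) \<le> ennreal (P F)"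
proof -
  note CB = coordinate_body[OF F, folded U_def]
  have ne: "U \<noteq> {}" using CB(4) by blast
  obtain \<zeta> :: "real \<Rightarrow> real" and T :: "real^3 \<Rightarrow> real^3" and d :: "3 \<Rightarrow> real^3 \<Rightarrow> real" where
    \<zeta>: "slice_transport U \<zeta>"
    and T: "T \<in> borel_measurable borel" "\<And>x. norm (T x) \<le> 1" "\<And>x. (x$1, x$2, x$3) \<notin> U \<Longrightarrow> T x = 0"
    "\<And>x t i. (x$1, x$2, x$3) \<in> U \<Longrightarrow> 0 < t \<Longrightarrow> ((x + t *\<^sub>R axis i 1)$1, (x + t *\<^sub>R axis i 1)$2, (x + t *\<^sub>R axis i 1)$3) \<in> U
      \<Longrightarrow> T x $ i \<le> T (x + t *\<^sub>R axis i 1) $ i"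
    "\<And>x i. (x$1, x$2, x$3) \<in> U \<Longrightarrow> ((\<lambda>t. T (x + t *\<^sub>R axis i 1) $ i) has_real_derivative d i x) (at 0)"
    "\<And>x. (x$1, x$2, x$3) \<in> U \<Longrightarrow> 3 + defect (transport_rate U \<zeta> (x$1)) \<le> (\<Sum>i\<in>UNIV. d i x)"
    by (rule knothe_rearrangement[OF CB(1-3) ne CB(5)[unfolded V]]) (rule that; assumption)
  note T' = T(3-6)[unfolded CB(6)]
  define \<kappa> where "\<kappa> z = 3 + defect (transport_rate U \<zeta> z)" for z
  have [measurable]: "\<zeta> \<in> borel_measurable borel"
    using \<zeta> unfolding slice_transport_def by (intro borel_measurable_continuous_onI) blast
  have [measurable]: "slice_vol U \<in> borel_measurable borel" by (rule slice_vol_measurable[OF CB(1)])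
  have \<kappa>m[measurable]: "\<kappa> \<in> borel_measurable borel" unfolding \<kappa>_def defect_def transport_rate_def by measurable
  have [measurable]: "(\<lambda>x::real^3. x $ i) \<in> borel_measurable borel" for i
    by (rule borel_measurable_vec_nth) simp
  obtain r where r: "r > 0" "ball 0 r \<subseteq> interior F"
    using F(3) open_interior open_contains_ball by blast
  have bT: "bounded {x. T x \<noteq> 0}"
    by (rule bounded_subset[OF compact_imp_bounded[OF F(2)]]) (use T'(1) interior_subset in blast)
  \<comment> \<open>By convexity s F keeps distance at least (1 - s) r from the complement of the
    interior.\<close>
  have cone: "s *\<^sub>R f + w \<in> interior F" if "0 < s" "s < 1" "f \<in> F" "norm w < (1 - s) * r" for s f w
  proof -
    define w' where "w' = (1 / (1 - s)) *\<^sub>R w"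
    have "norm w' < r" using that by (simp add: w'_def field_simps)
    then have "w' \<in> interior F" using r(2) by auto
    then have "f - (1 - s) *\<^sub>R (f - w') \<in> interior F"
      using that by (intro mem_interior_convex_shrink F(1)) auto
    moreover have "f - (1 - s) *\<^sub>R (f - w') = s *\<^sub>R f + w" using that by (simp add: w'_def algebra_simps)
    ultimately show ?thesis by simp
  qed
  have main: "(\<integral>\<^sup>+x\<in>(\<lambda>x. s\<^sup>2 *\<^sub>R x) ` F. ennreal (\<kappa> (x$1)) \<partial>lborel) \<le> ennreal (P F)" if s: "0 < s" "s < 1" for s
  proof -
    let ?K = "(\<lambda>x. s *\<^sub>R x) ` F" and ?K' = "(\<lambda>x. s\<^sup>2 *\<^sub>R x) ` F"
    \<comment> \<open>Adding y to s^2 f stays in s F when |y / s| < (1 - s) r, which dictates this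
      radius. The step bound (1 - s) ((1 - s) r) used below for \<tau> is what then remains of the
      room (1 - s) r around s F.\<close>
    let ?\<eta> = "s * ((1 - s) * r)"
    have cK: "compact ?K" "compact ?K'" using F(2) by (auto intro: compact_scaling)
    have K'm: "?K' \<in> sets borel" using cK(2) by (simp add: borel_compact)
    have K'int: "x \<in> interior F" if "x \<in> ?K'" for x
    proof -
      obtain f where f: "f \<in> F" "x = s\<^sup>2 *\<^sub>R f" using \<open>x \<in> ?K'\<close> by auto
      have "0 < s\<^sup>2" "s\<^sup>2 < 1" using s by (auto simp: abs_square_less_1)
      then show ?thesis using cone[of "s\<^sup>2" f 0] f r(1) by simp
    qed
    have p: "perimeter ?K \<le> ereal (P F)"
    proof -
      have "perimeter ?K \<le> ereal (1 / (1 / s)\<^sup>2) * perimeter ((\<lambda>x. (1 / s) *\<^sub>R id x + 0) ` ?K)"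
        by (rule perimeter_similarity_le[OF cK(1)]) (use s in auto)
      also have "(\<lambda>x. (1 / s) *\<^sub>R id x + 0) ` ?K = F" using s by (simp add: image_image)
      also have "ereal (1 / (1 / s)\<^sup>2) * perimeter F = ereal (s\<^sup>2 * P F)"
        by (simp add: perimeter_finite(1)[OF F] power_divide)
      also have "\<dots> \<le> ereal (P F)"
        using perimeter_finite(2)[OF F] s by (simp add: mult_left_le_one_le power_le_one)
      finally show ?thesis .
    qed
    have "(\<integral>\<^sup>+x\<in>?K'. ennreal (\<kappa> (x$1)) \<partial>lborel) \<le> (\<integral>\<^sup>+x\<in>?K'. ennreal (\<Sum>i\<in>UNIV. d i x) \<partial>lborel)"
      using T'(4) K'int by (intro nn_integral_mono) (auto simp: \<kappa>_def indicator_def intro!: ennreal_leI)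
    also have "\<dots> \<le> ennreal (P F)"
    proof (rule perimeter_ge_nn_integral_partials[where \<eta>="?\<eta>" and \<tau>="(1 - s) * ((1 - s) * r)", OF T(1) bT T(2) cK(1) _ K'm _ _ _ _ p])
      show "0 < ?\<eta>" "0 < (1 - s) * ((1 - s) * r)" using s r(1) by auto
      show "x + y \<in> ?K" if "x \<in> ?K'" "norm y < ?\<eta>" for x y
      proof -
        obtain f where f: "f \<in> F" "x = s\<^sup>2 *\<^sub>R f" using \<open>x \<in> ?K'\<close> by auto
        have "norm ((1 / s) *\<^sub>R y) < (1 - s) * r" using that(2) s by (simp add: field_simps)
        then have "s *\<^sub>R f + (1 / s) *\<^sub>R y \<in> F" using cone[OF s f(1)] interior_subset by blast
        moreover have "x + y = s *\<^sub>R (s *\<^sub>R f + (1 / s) *\<^sub>R y)"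
          using s by (simp add: f(2) power2_eq_square scaleR_add_right)
        ultimately show ?thesis by blast
      qed
      show "T (x + y) $ i \<le> T (x + y + t *\<^sub>R axis i 1) $ i"
        if "x \<in> ?K" "norm y < ?\<eta>" "0 < t" "t < (1 - s) * ((1 - s) * r)" for x y t i
      proof -
        obtain f where f: "f \<in> F" "x = s *\<^sub>R f" using \<open>x \<in> ?K\<close> by auto
        have sum: "s * ((1 - s) * r) + (1 - s) * ((1 - s) * r) = (1 - s) * r" by (simp add: algebra_simps)
        have "0 < (1 - s) * ((1 - s) * r)" using s r(1) by simp
        then have "norm y < (1 - s) * r" using that sum by linarith
        then have 1: "x + y \<in> interior F" using cone[OF s f(1)] f(2) by simp
        have "norm (y + t *\<^sub>R axis i 1) \<le> norm y + t"
          using norm_triangle_ineq[of y "t *\<^sub>R axis i 1"] that(3) by (simp add: norm_axis_1)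
        then have "norm (y + t *\<^sub>R axis i 1) < (1 - s) * r" using that sum by linarith
        then have 2: "x + y + t *\<^sub>R axis i 1 \<in> interior F" using cone[OF s f(1)] f(2) by (simp add: add.assoc)
        show ?thesis by (rule T'(2)[OF 1 that(3) 2])
      qed
      show "((\<lambda>t. T (x + t *\<^sub>R axis i 1) $ i) has_real_derivative d i x) (at 0)" if "x \<in> ?K'" for x i
        by (rule T'(3)[OF K'int[OF that]])
    qed
    finally show ?thesis .
  qed
  \<comment> \<open>The shift by 2 keeps s 0 positive.\<close>
  define s where "s n = 1 - inverse (real (Suc (Suc n)))" for n
  have s: "0 < s n" "s n < 1" for n by (auto simp: s_def inverse_less_1_iff)
  have "s \<longlonglongrightarrow> 1 - 0"
    unfolding s_def by (intro tendsto_diff tendsto_const LIMSEQ_Suc[OF LIMSEQ_inverse_real_of_nat])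
  then have s1: "s \<longlonglongrightarrow> 1" by simp
  \<comment> \<open>Fatou again: each interior point eventually belongs to the shrunken
    bodies.\<close>
  have "(\<integral>\<^sup>+x\<in>interior F. ennreal (\<kappa> (x$1)) \<partial>lborel)
      \<le> (\<integral>\<^sup>+x. liminf (\<lambda>n. ennreal (\<kappa> (x$1)) * indicator ((\<lambda>x. (s n)\<^sup>2 *\<^sub>R x) ` F) x) \<partial>lborel)"
  proof (rule nn_integral_mono)
    fix x :: "real^3"
    show "ennreal (\<kappa> (x$1)) * indicator (interior F) x \<le> liminf (\<lambda>n. ennreal (\<kappa> (x$1)) * indicator ((\<lambda>x. (s n)\<^sup>2 *\<^sub>R x) ` F) x)"
    proof (cases "x \<in> interior F")
      case True
      have "(\<lambda>n. (1 / (s n)\<^sup>2) *\<^sub>R x) \<longlonglongrightarrow> (1 / 1\<^sup>2) *\<^sub>R x" by (intro tendsto_intros s1) simp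
      then have "\<forall>\<^sub>F n in sequentially. (1 / (s n)\<^sup>2) *\<^sub>R x \<in> interior F"
        using True open_interior by (intro topological_tendstoD) auto
      then have "\<forall>\<^sub>F n in sequentially. ennreal (\<kappa> (x$1)) \<le> ennreal (\<kappa> (x$1)) * indicator ((\<lambda>x. (s n)\<^sup>2 *\<^sub>R x) ` F) x"
      proof eventually_elim
        case (elim n)
        have "x = (s n)\<^sup>2 *\<^sub>R ((1 / (s n)\<^sup>2) *\<^sub>R x)" using s(1)[of n] by simp
        then have "x \<in> (\<lambda>x. (s n)\<^sup>2 *\<^sub>R x) ` F" using elim interior_subset by blast
        then show ?case by simp
      qed
      then show ?thesis using True by (simp add: Liminf_bounded)
    qed simp
  qed
  also have "\<dots> \<le> liminf (\<lambda>n. \<integral>\<^sup>+x\<in>(\<lambda>x. (s n)\<^sup>2 *\<^sub>R x) ` F. ennreal (\<kappa> (x$1)) \<partial>lborel)"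
  proof (rule nn_integral_liminf)
    fix n
    have [measurable]: "(\<lambda>x. (s n)\<^sup>2 *\<^sub>R x) ` F \<in> sets borel"
      using F(2) by (intro borel_compact compact_scaling)
    show "(\<lambda>x. ennreal (\<kappa> (x$1)) * indicator ((\<lambda>x. (s n)\<^sup>2 *\<^sub>R x) ` F) x) \<in> borel_measurable lborel"
      by measurable
  qed
  also have "\<dots> \<le> liminf (\<lambda>n::nat. ennreal (P F))"
    using main[OF s] by (intro Liminf_mono always_eventually allI)
  also have "\<dots> = ennreal (P F)" by (simp add: Liminf_const)
  finally have fin: "(\<integral>\<^sup>+z. ennreal (\<kappa> z) * ennreal (slice_vol U z) \<partial>lborel) \<le> ennreal (P F)"
    by (subst (asm) nn_integral_coordinate_body[OF CB(1,3,6)]) auto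
  show ?thesis by (rule that[OF \<zeta> fin[unfolded \<kappa>_def]])
qed

section \<open>The one-dimensional estimate\<close>

(* Replaces Cauchy-Schwarz for integrals; K is optimised in perimeter_deficit_lower_bound. *)
lemma young_weighted:
  fixes x w K :: real
  assumes "0 < w" "0 < K"
  shows "x \<le> K / 2 * (w * x\<^sup>2) + 1 / (2 * K * w)"
proof -
  have "0 \<le> (K * w * x - 1)\<^sup>2 / (2 * K * w)" using assms by simp
  also have "\<dots> = K / 2 * (w * x\<^sup>2) + 1 / (2 * K * w) - x"
    using assms by (simp add: field_simps power2_eq_square)
  finally show ?thesis by simp
qed

text \<open>Here \<open>a\<close> stands for the slice areas of the body, \<open>\<zeta>\<close> for
  the height map into the ball and \<open>D\<close> for P F - 4 pi. The bound \<open>deficit\<close>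
  is imposed on compact subintervals of the open projection, where the integrand is
  continuous.\<close>

locale transport_profile =
  fixes a \<zeta> :: "real \<Rightarrow> real" and \<alpha> \<beta> D :: real
  assumes ab: "\<alpha> < \<beta>"
    and a_pos: "\<And>z. \<alpha> < z \<Longrightarrow> z < \<beta> \<Longrightarrow> 0 < a z"
    and a_out: "\<And>z. z \<le> \<alpha> \<or> \<beta> \<le> z \<Longrightarrow> a z = 0"
    and a_cont: "\<And>z. \<alpha> < z \<Longrightarrow> z < \<beta> \<Longrightarrow> isCont a z"
    and a_bary: "((\<lambda>z. z * a z) has_integral 0) {\<alpha>..\<beta>}"
    and \<zeta>_cont: "continuous_on {\<alpha>..\<beta>} \<zeta>"
    and \<zeta>_ends: "\<zeta> \<alpha> = -1" "\<zeta> \<beta> = 1"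
    and \<zeta>_mono: "\<And>x y. x \<le> y \<Longrightarrow> \<zeta> x \<le> \<zeta> y"
    and \<zeta>_bd: "\<And>z. \<alpha> < z \<Longrightarrow> z < \<beta> \<Longrightarrow> -1 < \<zeta> z \<and> \<zeta> z < 1"
    and \<zeta>_der: "\<And>z. \<alpha> < z \<Longrightarrow> z < \<beta> \<Longrightarrow> (\<zeta> has_real_derivative a z / (pi * (1 - (\<zeta> z)\<^sup>2))) (at z)"
    and deficit: "\<And>u w. \<alpha> < u \<Longrightarrow> u \<le> w \<Longrightarrow> w < \<beta> \<Longrightarrow>
      integral {u..w} (\<lambda>z. a z * defect (a z / (pi * (1 - (\<zeta> z)\<^sup>2)))) \<le> D"
begin

definition p where "p z = a z / (pi * (1 - (\<zeta> z)\<^sup>2))"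

lemma one_minus_sq: "0 < 1 - (\<zeta> z)\<^sup>2" if "\<alpha> < z" "z < \<beta>"
  using \<zeta>_bd[OF that] abs_square_less_1[of "\<zeta> z"] by auto

lemma p_pos: "0 < p z" if "\<alpha> < z" "z < \<beta>"
  unfolding p_def using one_minus_sq[OF that] a_pos[OF that] by simp

lemma a_eq: "a z = p z * (pi * (1 - (\<zeta> z)\<^sup>2))" if "\<alpha> < z" "z < \<beta>"
  unfolding p_def using one_minus_sq[OF that] by simp

lemma \<zeta>_isCont: "isCont \<zeta> z" if "\<alpha> < z" "z < \<beta>"
  using \<zeta>_der[OF that] by (rule DERIV_isCont)

lemma p_cont: "isCont p z" if "\<alpha> < z" "z < \<beta>"
  unfolding p_def using one_minus_sq[OF that] a_cont[OF that] \<zeta>_isCont[OF that]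
  by (intro continuous_intros) auto

lemma continuous_on_inner:
  assumes "\<alpha> < u" "w < \<beta>"
  shows "continuous_on {u..w} a" "continuous_on {u..w} \<zeta>" "continuous_on {u..w} p"
    "continuous_on {u..w} (\<lambda>z. a z * defect (p z))"
proof -
  show 1: "continuous_on {u..w} a" "continuous_on {u..w} \<zeta>" "continuous_on {u..w} p"
    using assms by (auto intro!: continuous_at_imp_continuous_on a_cont \<zeta>_isCont p_cont)
  have "sqrt (p z) \<noteq> 0" if "z \<in> {u..w}" for z using p_pos[of z] that assms by auto
  then show "continuous_on {u..w} (\<lambda>z. a z * defect (p z))"
    unfolding defect_def by (intro continuous_intros 1) auto
qed

text \<open>The product \<zeta> a is the derivative of pi (\<zeta>^2 / 2 - \<zeta>^4 / 4), which
  takes equal values at \<zeta> = -1 and \<zeta> = 1: the image mass is centred because the ball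
  is.\<close>

lemma gap_has_integral: "((\<lambda>z. (\<zeta> z - z) * a z) has_integral 0) {\<alpha>..\<beta>}"
proof -
  let ?E = "\<lambda>z. pi * ((\<zeta> z)\<^sup>2 / 2 - (\<zeta> z) ^ 4 / 4)"
  have "((\<lambda>z. \<zeta> z * a z) has_integral ?E \<beta> - ?E \<alpha>) {\<alpha>..\<beta>}"
  proof (rule fundamental_theorem_of_calculus_interior)
    show "continuous_on {\<alpha>..\<beta>} ?E" by (intro continuous_intros \<zeta>_cont) auto
    fix z assume z: "z \<in> {\<alpha><..<\<beta>}"
    then have "(\<zeta> has_real_derivative p z) (at z)" unfolding p_def using \<zeta>_der[of z] by simp
    then have "(?E has_real_derivative \<zeta> z * (pi * (1 - (\<zeta> z)\<^sup>2)) * p z) (at z)"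
      by (auto intro!: derivative_eq_intros simp: algebra_simps power2_eq_square power3_eq_cube)
    moreover have "\<zeta> z * (pi * (1 - (\<zeta> z)\<^sup>2)) * p z = \<zeta> z * a z"
      using a_eq[of z] z by simp
    ultimately show "(?E has_vector_derivative \<zeta> z * a z) (at z)"
      by (simp add: has_real_derivative_iff_has_vector_derivative)
  qed (use ab in auto)
  from has_integral_diff[OF this a_bary] show ?thesis
    by (simp add: \<zeta>_ends algebra_simps)
qed

text \<open>The value is the volume of the unit ball below height \<zeta> w.\<close>

lemma mass_has_integral:
  assumes "\<alpha> \<le> w" "w \<le> \<beta>"
  shows "(a has_integral pi * (\<zeta> w - \<zeta> w ^ 3 / 3 + 2 / 3)) {\<alpha>..w}"
proof -
  let ?E = "\<lambda>z. pi * (\<zeta> z - (\<zeta> z) ^ 3 / 3)"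
  have "(a has_integral ?E w - ?E \<alpha>) {\<alpha>..w}"
  proof (rule fundamental_theorem_of_calculus_interior[OF assms(1)])
    show "continuous_on {\<alpha>..w} ?E"
      using assms by (intro continuous_intros continuous_on_subset[OF \<zeta>_cont]) auto
    fix z assume "z \<in> {\<alpha><..<w}"
    then have z: "\<alpha> < z" "z < \<beta>" using assms by auto
    then have "(\<zeta> has_real_derivative p z) (at z)" unfolding p_def using \<zeta>_der[of z] by simp
    then have "(?E has_real_derivative p z * (pi * (1 - (\<zeta> z)\<^sup>2))) (at z)"
      by (auto intro!: derivative_eq_intros simp: algebra_simps)
    then show "(?E has_vector_derivative a z) (at z)"
      by (simp add: has_real_derivative_iff_has_vector_derivative a_eq[OF z])
  qed
  then show ?thesis by (simp add: \<zeta>_ends algebra_simps)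
qed

lemma a_int: "(a has_integral 4 * pi / 3) {\<alpha>..\<beta>}"
  using mass_has_integral[of \<beta>] ab by (simp add: \<zeta>_ends mult.commute)

lemma gap_derivative_integral:
  assumes "\<alpha> < u" "u \<le> w" "w < \<beta>"
  shows "((\<lambda>z. p z - 1) has_integral (\<zeta> w - w) - (\<zeta> u - u)) {u..w}"
proof (rule fundamental_theorem_of_calculus[OF assms(2)])
  fix z assume "z \<in> {u..w}"
  then have "((\<lambda>z. \<zeta> z - z) has_real_derivative p z - 1) (at z)"
    unfolding p_def using \<zeta>_der[of z] assms by (auto intro!: derivative_eq_intros)
  then show "((\<lambda>z. \<zeta> z - z) has_vector_derivative p z - 1) (at z within {u..w})"
    by (simp add: has_real_derivative_iff_has_vector_derivative has_vector_derivative_at_within)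
qed

lemma defect_has_integral:
  assumes "\<alpha> < u" "u \<le> w" "w < \<beta>"
  shows "((\<lambda>z. a z * defect (p z)) has_integral integral {u..w} (\<lambda>z. a z * defect (p z))) {u..w}"
    "integral {u..w} (\<lambda>z. a z * defect (p z)) \<le> D"
  using deficit[OF assms] continuous_on_inner(4)[OF assms(1,3)]
  by (auto simp: p_def intro!: integrable_integral integrable_continuous_real)

lemma mass_nonneg: "0 \<le> a z"
  using a_pos[of z] a_out[of z] by force

(* Used with s = 1 for a spike and s = -1 for a dent; the mass hypothesis says that the part of the body
   below b is too small to influence the mean of the gap at order h. *)
lemma gap_point:
  assumes b: "\<alpha> < b" "b < \<beta>" and h: "0 < h" "60 * h\<^sup>2 \<le> 1"
    and mass: "integral {\<alpha>..b} a \<le> 18 * pi * h\<^sup>2"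
    and left: "\<And>z. \<alpha> \<le> z \<Longrightarrow> z \<le> b \<Longrightarrow> s * (\<zeta> z - z) \<le> 3"
  shows "\<exists>y. b \<le> y \<and> y < \<beta> \<and> - (60 * h\<^sup>2) \<le> s * (\<zeta> y - y)"
proof (rule ccontr)
  let ?f = "\<lambda>z. s * (\<zeta> z - z) * a z"
  define X Y where "X = integral {\<alpha>..b} a" and "Y = integral {b..\<beta>} a"
  assume "\<not> ?thesis"
  then have neg: "s * (\<zeta> z - z) \<le> - (60 * h\<^sup>2)" if "b \<le> z" "z < \<beta>" for z
    using that by force
  have "(?f has_integral 0) {\<alpha>..\<beta>}"
    using has_integral_mult_right[OF gap_has_integral, of s] by (simp add: mult.assoc)
  then have ia: "a integrable_on {\<alpha>..\<beta>}" "?f integrable_on {\<alpha>..\<beta>}" "integral {\<alpha>..\<beta>} ?f = 0"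
    using a_int by (auto simp: has_integral_iff)
  have sub: "f integrable_on {\<alpha>..b}" "f integrable_on {b..\<beta>}" if "f integrable_on {\<alpha>..\<beta>}" for f :: "real \<Rightarrow> real"
    using b by (auto intro!: integrable_on_subinterval[OF that])
  have "integral {\<alpha>..b} ?f \<le> integral {\<alpha>..b} (\<lambda>z. 3 * a z)"
    using left mass_nonneg by (intro integral_le sub integrable_on_mult_right ia mult_right_mono) auto
  then have 1: "integral {\<alpha>..b} ?f \<le> 3 * X" by (simp add: X_def)
  have "integral {b..\<beta>} ?f \<le> integral {b..\<beta>} (\<lambda>z. - (60 * h\<^sup>2) * a z)"
  proof (rule integral_le)
    fix z assume z: "z \<in> {b..\<beta>}"
    show "?f z \<le> - (60 * h\<^sup>2) * a z"
    proof (cases "z = \<beta>")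
      case False
      then show ?thesis using neg[of z] z by (intro mult_right_mono mass_nonneg) auto
    qed (simp add: a_out)
  qed (intro sub integrable_on_mult_right ia)+
  then have 2: "integral {b..\<beta>} ?f \<le> - (60 * h\<^sup>2) * Y" by (simp add: Y_def)
  have 3: "X + Y = 4 * pi / 3" "integral {\<alpha>..b} ?f + integral {b..\<beta>} ?f = 0"
    unfolding X_def Y_def
    using Henstock_Kurzweil_Integration.integral_combine[OF _ _ ia(1), of b]
      Henstock_Kurzweil_Integration.integral_combine[OF _ _ ia(2), of b] b a_int ia(3)
    by (simp_all add: integral_unique)
  then have "Y = 4 * pi / 3 - X" by simp
  then have "0 \<le> 3 * X - (60 * h\<^sup>2) * (4 * pi / 3 - X)" using 1 2 3(2) by simp
  \<comment> \<open>As 60 h^2 <= 1, the right-hand side is at most 4 X <= 72 pi h^2, a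
    contradiction; this is why 60 goes with 18.\<close>
  then have "80 * (pi * h\<^sup>2) \<le> 3 * X + (60 * h\<^sup>2) * X" by (simp add: algebra_simps)
  moreover have "(60 * h\<^sup>2) * X \<le> 1 * X"
    unfolding X_def using sub(1)[OF ia(1)] mass_nonneg by (intro mult_right_mono h integral_nonneg) auto
  moreover have "0 < pi * h\<^sup>2" using h by simp
  ultimately show False using mass by (simp add: X_def[symmetric] mult.assoc)
qed

text \<open>Heights run up to 1 + h while \<zeta> stays below 1, so the gap falls from about 0 at
  some y to nearly -h at w. Only p < 1 lets it fall, so \<open>defect_ge_below\<close> applies with
  weight a. The hypotheses \<open>lower\<close>, \<open>upper\<close> and \<open>cone\<close>
  reflect the inner ball, the outer ball and the cone spanned by the spike.\<close>

lemma spike_bound: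
  assumes h: "0 < h" "h \<le> 1 / 100" and K: "0 < K"
    and range: "-1 - h \<le> \<alpha>" "\<beta> = 1 + h"
    and lower: "\<And>z. \<bar>z\<bar> < 1 - h \<Longrightarrow> pi * ((1 - h)\<^sup>2 - z\<^sup>2) \<le> a z"
    and upper: "\<And>z. -1 - h \<le> z \<Longrightarrow> z \<le> 0 \<Longrightarrow> a z \<le> pi * ((1 + h)\<^sup>2 - z\<^sup>2)"
    and cone: "\<And>z. 1 - 2 * h \<le> z \<Longrightarrow> z < \<beta> \<Longrightarrow> pi * (\<beta> - z)\<^sup>2 / (9 * h) \<le> a z"
  shows "19 / 20 * h - 60 * h\<^sup>2 \<le> 2 * K / 3 * D + 1 / (2 * K) * ((ln (2 / h) / (1 - h) + 180) / pi)"
proof -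
  \<comment> \<open>Both points lie at distance h inside the poles of the ball of radius 1 -
    h.\<close>
  define b m where "b = -1 + 2 * h" and "m = 1 - 2 * h"
  have \<alpha>b: "\<alpha> < b"
  proof (rule ccontr)
    assume "\<not> \<alpha> < b"
    then have "a b = 0" by (intro a_out) auto
    moreover have "pi * ((1 - h)\<^sup>2 - b\<^sup>2) \<le> a b" using h by (intro lower) (auto simp: b_def)
    moreover have "(1 - h)\<^sup>2 - b\<^sup>2 = h * (2 - 3 * h)" by (simp add: b_def power2_eq_square algebra_simps)
    ultimately have "pi * (h * (2 - 3 * h)) \<le> 0" by simp
    moreover have "0 < pi * (h * (2 - 3 * h))" using h by simp
    ultimately show False by linarith
  qed
  have b\<beta>: "b < \<beta>" using h range by (simp add: b_def)
  have \<zeta>1: "\<zeta> z \<le> 1" if "z \<le> \<beta>" for z using \<zeta>_mono[OF that] \<zeta>_ends by simp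
  have h2: "60 * h\<^sup>2 \<le> 1" "60 * h\<^sup>2 < 19 / 20 * h"
  proof -
    have "h * h \<le> 1 / 100 * h" using h by (intro mult_right_mono) auto
    then show "60 * h\<^sup>2 \<le> 1" "60 * h\<^sup>2 < 19 / 20 * h" using h unfolding power2_eq_square by linarith+
  qed
  \<comment> \<open>The piece has height at most 3 h and slices of area at most 6 pi h.\<close>
  have mass: "integral {\<alpha>..b} a \<le> 18 * pi * h\<^sup>2"
  proof -
    have "integral {\<alpha>..b} a \<le> integral {\<alpha>..b} (\<lambda>_. pi * (6 * h))"
    proof (rule integral_le)
      fix z assume z: "z \<in> {\<alpha>..b}"
      have "a z \<le> pi * ((1 + h)\<^sup>2 - z\<^sup>2)" using z range h by (intro upper) (auto simp: b_def)
      also have "\<dots> \<le> pi * (6 * h)"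
      proof (rule mult_left_mono)
        have "(1 - 2 * h)\<^sup>2 \<le> (- z)\<^sup>2" using z h by (intro power_mono) (auto simp: b_def)
        moreover have "(1 + h)\<^sup>2 - (1 - 2 * h)\<^sup>2 = 6 * h - 3 * h\<^sup>2" by (simp add: power2_eq_square algebra_simps)
        ultimately show "(1 + h)\<^sup>2 - z\<^sup>2 \<le> 6 * h" using zero_le_power2[of h] unfolding power2_minus by linarith
      qed simp
      finally show "a z \<le> pi * (6 * h)" .
    qed (use has_integral_integrable[OF mass_has_integral[of b]] \<alpha>b b\<beta> in auto)
    also have "\<dots> = (b - \<alpha>) * (pi * (6 * h))" using \<alpha>b by simp
    also have "\<dots> \<le> (3 * h) * (pi * (6 * h))" using range h by (intro mult_right_mono) (auto simp: b_def)
    finally show ?thesis by (simp add: power2_eq_square mult_ac)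
  qed
  have "1 * (\<zeta> z - z) \<le> 3" if "\<alpha> \<le> z" "z \<le> b" for z
    using \<zeta>1[of z] that range h b\<beta> by simp
  from gap_point[OF \<alpha>b b\<beta> h(1) h2(1) mass this]
  obtain y where y: "b \<le> y" "y < \<beta>" "- (60 * h\<^sup>2) \<le> \<zeta> y - y" by auto
  \<comment> \<open>Stopping short of the tip keeps 1/a integrable and sacrifices h/20 of the
    gap.\<close>
  define w where "w = \<beta> - h / 20"
  have w\<beta>: "w < \<beta>" using h by (simp add: w_def)
  have gw: "\<zeta> w - w \<le> - (19 / 20 * h)" using \<zeta>1[of w] h range by (simp add: w_def)
  have yw: "y \<le> w"
  proof (rule ccontr)
    assume "\<not> y \<le> w"
    then have "\<zeta> y - y \<le> - (19 / 20 * h)" using \<zeta>1[of y] y(2) range by (simp add: w_def)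
    then show False using y(3) h2 by simp
  qed
  have \<alpha>y: "\<alpha> < y" using \<alpha>b y(1) by simp
  have inv_cont: "continuous_on {u..v} (\<lambda>z. 1 / a z)" if "\<alpha> < u" "v < \<beta>" for u v
  proof -
    have "a z \<noteq> 0" if "z \<in> {u..v}" for z using a_pos[of z] that \<open>\<alpha> < u\<close> \<open>v < \<beta>\<close> by auto
    then show ?thesis by (intro continuous_intros continuous_on_inner that) auto
  qed
  note inv_int = integrable_continuous_real[OF inv_cont]
  have pw: "- (p z - 1) \<le> 2 * K / 3 * (a z * defect (p z)) + 1 / (2 * K) * (1 / a z)" if z: "z \<in> {y..w}" for z
  proof -
    have zi: "\<alpha> < z" "z < \<beta>" using z \<alpha>y w\<beta> by auto
    note pp = p_pos[OF zi] and ap = a_pos[OF zi]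
    show ?thesis
    proof (cases "p z \<le> 1")
      case True
      have "1 - p z \<le> K / 2 * (a z * (1 - p z)\<^sup>2) + 1 / (2 * K * a z)" by (rule young_weighted[OF ap K])
      also have "K / 2 * (a z * (1 - p z)\<^sup>2) \<le> K / 2 * (a z * (4 / 3 * defect (p z)))"
        using K ap defect_ge_below[OF pp True] by (intro mult_left_mono) auto
      finally show ?thesis by simp
    next
      case False
      have "0 \<le> 2 * K / 3 * (a z * defect (p z))" using K ap defect_nonneg[OF pp] by simp
      moreover have "0 \<le> 1 / (2 * K) * (1 / a z)" using K ap by simp
      ultimately show ?thesis using False by linarith
    qed
  qed
  have "- ((\<zeta> w - w) - (\<zeta> y - y)) \<le> 2 * K / 3 * integral {y..w} (\<lambda>z. a z * defect (p z)) + 1 / (2 * K) * integral {y..w} (\<lambda>z. 1 / a z)"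
  proof (rule has_integral_le)
    show "((\<lambda>z. - (p z - 1)) has_integral - ((\<zeta> w - w) - (\<zeta> y - y))) {y..w}"
      by (intro has_integral_neg gap_derivative_integral \<alpha>y yw w\<beta>)
    show "((\<lambda>z. 2 * K / 3 * (a z * defect (p z)) + 1 / (2 * K) * (1 / a z)) has_integral
      2 * K / 3 * integral {y..w} (\<lambda>z. a z * defect (p z)) + 1 / (2 * K) * integral {y..w} (\<lambda>z. 1 / a z)) {y..w}"
      by (intro has_integral_add has_integral_mult_right defect_has_integral(1) integrable_integral inv_int \<alpha>y yw w\<beta>)
  qed (rule pw)
  also have "\<dots> \<le> 2 * K / 3 * D + 1 / (2 * K) * ((ln (2 / h) / (1 - h) + 180) / pi)"
  proof (intro add_mono mult_left_mono)
    show "integral {y..w} (\<lambda>z. a z * defect (p z)) \<le> D" by (rule defect_has_integral(2)[OF \<alpha>y yw w\<beta>])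
    have bm: "b \<le> m" "m \<le> w" using h range by (auto simp: b_def m_def w_def)
    have "integral {y..w} (\<lambda>z. 1 / a z) \<le> integral {b..w} (\<lambda>z. 1 / a z)"
      using y(1) by (intro integral_subset_le inv_int \<alpha>y w\<beta> \<alpha>b) (auto simp: mass_nonneg)
    also have "\<dots> = integral {b..m} (\<lambda>z. 1 / a z) + integral {m..w} (\<lambda>z. 1 / a z)"
      using Henstock_Kurzweil_Integration.integral_combine[OF bm inv_int[OF \<alpha>b w\<beta>]] by simp
    \<comment> \<open>Comparison with the slices of the ball of radius \<rho> = 1 - h; the logarithm
      arises equally from the two ends, each at distance h from a pole.\<close>
    also have "integral {b..m} (\<lambda>z. 1 / a z) \<le> ln (2 / h) / (1 - h) / pi"
    proof -
      define \<rho> where "\<rho> = 1 - h"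
      have \<rho>: "\<rho> > 0" "m < \<rho>" "- \<rho> < b" using h by (auto simp: \<rho>_def m_def b_def)
      let ?A = "\<lambda>z. (ln (\<rho> + z) - ln (\<rho> - z)) / (2 * pi * \<rho>)"
      have "((\<lambda>z. 1 / (pi * (\<rho>\<^sup>2 - z\<^sup>2))) has_integral ?A m - ?A b) {b..m}"
      proof (rule fundamental_theorem_of_calculus[OF bm(1)])
        fix z assume z: "z \<in> {b..m}"
        have pos: "\<rho> + z > 0" "\<rho> - z > 0" using z \<rho> by auto
        have "((\<lambda>z. ln (\<rho> + z) - ln (\<rho> - z)) has_real_derivative 1 / (\<rho> + z) + 1 / (\<rho> - z)) (at z)"
          using pos by (auto intro!: derivative_eq_intros)
        then have "(?A has_real_derivative (1 / (\<rho> + z) + 1 / (\<rho> - z)) / (2 * pi * \<rho>)) (at z)"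
          by (rule DERIV_cdivide)
        moreover have "(1 / (\<rho> + z) + 1 / (\<rho> - z)) / (2 * pi * \<rho>) = 1 / (pi * (\<rho>\<^sup>2 - z\<^sup>2))"
        proof -
          have "1 / (\<rho> + z) + 1 / (\<rho> - z) = 2 * \<rho> / ((\<rho> + z) * (\<rho> - z))"
            using pos by (simp add: add_frac_eq)
          also have "(\<rho> + z) * (\<rho> - z) = \<rho>\<^sup>2 - z\<^sup>2" by (simp add: power2_eq_square algebra_simps)
          finally show ?thesis using \<rho>(1) by simp
        qed
        ultimately show "(?A has_vector_derivative 1 / (pi * (\<rho>\<^sup>2 - z\<^sup>2))) (at z within {b..m})"
          by (simp add: has_real_derivative_iff_has_vector_derivative has_vector_derivative_at_within)
      qed
      moreover have "1 / a z \<le> 1 / (pi * (\<rho>\<^sup>2 - z\<^sup>2))" if "z \<in> {b..m}" for z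
      proof (rule divide_left_mono)
        have z: "\<bar>z\<bar> < 1 - h" using that h by (auto simp: b_def m_def)
        then show "pi * (\<rho>\<^sup>2 - z\<^sup>2) \<le> a z" unfolding \<rho>_def by (rule lower)
        have "z\<^sup>2 < \<rho>\<^sup>2" using z power_strict_mono[of "\<bar>z\<bar>" \<rho> 2] by (simp add: \<rho>_def)
        then have "0 < pi * (\<rho>\<^sup>2 - z\<^sup>2)" by simp
        then show "0 < a z * (pi * (\<rho>\<^sup>2 - z\<^sup>2))" using \<open>pi * (\<rho>\<^sup>2 - z\<^sup>2) \<le> a z\<close> by simp
      qed simp
      moreover have "m < \<beta>" using bm w\<beta> by simp
      ultimately have "integral {b..m} (\<lambda>z. 1 / a z) \<le> ?A m - ?A b"
        by (intro has_integral_le[OF integrable_integral[OF inv_int[OF \<alpha>b]]])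
      also have "\<dots> = (ln (2 - 3 * h) - ln h) / (pi * \<rho>)"
      proof -
        have e: "\<rho> + m = 2 - 3 * h" "\<rho> - m = h" "\<rho> + b = h" "\<rho> - b = 2 - 3 * h"
          by (auto simp: \<rho>_def m_def b_def)
        have "(X - Y) / (2 * pi * \<rho>) - (Y - X) / (2 * pi * \<rho>) = (X - Y) / (pi * \<rho>)" for X Y
          using \<rho>(1) by (simp add: field_simps)
        then show ?thesis unfolding e .
      qed
      also have "\<dots> \<le> (ln 2 - ln h) / (pi * \<rho>)"
        using \<rho>(1) h by (intro divide_right_mono diff_right_mono) auto
      finally show ?thesis using h by (simp add: \<rho>_def ln_div mult.commute)
    qed
    \<comment> \<open>Comparison with the cone; the primitive (9 h / pi) / (\<beta> - z) at \<beta>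
      - z = h / 20 gives 180 / pi, bounded as h tends to 0.\<close>
    also have "integral {m..w} (\<lambda>z. 1 / a z) \<le> 180 / pi"
    proof -
      let ?A = "\<lambda>z. 9 * h / pi * (1 / (\<beta> - z))"
      have "((\<lambda>z. 9 * h / pi * (1 / (\<beta> - z)\<^sup>2)) has_integral ?A w - ?A m) {m..w}"
      proof (rule fundamental_theorem_of_calculus[OF bm(2)])
        fix z assume z: "z \<in> {m..w}"
        then have "\<beta> - z > 0" using w\<beta> by auto
        then have "(?A has_real_derivative 9 * h / pi * (1 / (\<beta> - z)\<^sup>2)) (at z)"
          by (auto intro!: derivative_eq_intros simp: power2_eq_square)
        then show "(?A has_vector_derivative 9 * h / pi * (1 / (\<beta> - z)\<^sup>2)) (at z within {m..w})"
          by (simp add: has_real_derivative_iff_has_vector_derivative has_vector_derivative_at_within)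
      qed
      moreover have "1 / a z \<le> 9 * h / pi * (1 / (\<beta> - z)\<^sup>2)" if z: "z \<in> {m..w}" for z
      proof -
        have 1: "pi * (\<beta> - z)\<^sup>2 / (9 * h) \<le> a z" using z w\<beta> by (intro cone) (auto simp: m_def)
        have 2: "0 < pi * (\<beta> - z)\<^sup>2 / (9 * h)" using z w\<beta> h by simp
        have "1 / a z \<le> 1 / (pi * (\<beta> - z)\<^sup>2 / (9 * h))"
          by (rule divide_left_mono[OF 1 zero_le_one mult_pos_pos[OF less_le_trans[OF 2 1] 2]])
        then show ?thesis by simp
      qed
      moreover have "\<alpha> < m" using \<alpha>b bm by simp
      ultimately have "integral {m..w} (\<lambda>z. 1 / a z) \<le> ?A w - ?A m"
        by (intro has_integral_le[OF integrable_integral[OF inv_int[OF _ w\<beta>]]])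
      also have "\<dots> \<le> ?A w" using h range by (simp add: m_def)
      also have "\<dots> = 180 / pi" using h by (simp add: w_def)
      finally show ?thesis .
    qed
    finally show "integral {y..w} (\<lambda>z. 1 / a z) \<le> (ln (2 / h) / (1 - h) + 180) / pi"
      by (simp add: add_divide_distrib)
  qed (use K in auto)
  finally show ?thesis using gw y(3) by linarith
qed

text \<open>Heights end at 1 - h while \<zeta> goes on to 1, so the gap must grow, which happens
  where p > 1. Young's inequality is therefore applied to 1 - 1/p with weight W = pi (1 -
  \<zeta>^2), using a = p W. The remaining integral of p / W is that of 1 / (pi (1 - t^2)) over the
  range of \<zeta>.\<close>

lemma dent_bound:
  assumes h: "0 < h" "h \<le> 1 / 100" and K: "0 < K"
    and range: "\<beta> \<le> 1 - h"
  shows "19 / 20 * h - 60 * h\<^sup>2 \<le> 2 * K / 3 * D + 1 / (2 * K) * ((ln (2 / h) / (1 - h) + 180) / pi)"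
proof -
  \<comment> \<open>Both cuts are chosen by the value of \<zeta>, so the mass below b is exactly
    that of a cap of height h, and the logarithms at the end are explicit.\<close>
  obtain b where b: "\<alpha> \<le> b" "b \<le> \<beta>" "\<zeta> b = -1 + h"
    using IVT'[of \<zeta> \<alpha> "-1 + h" \<beta>] \<zeta>_ends \<zeta>_cont ab h by auto
  have \<alpha>b: "\<alpha> < b" using b h \<zeta>_ends by (cases "b = \<alpha>") auto
  have b\<beta>: "b < \<beta>" using b h \<zeta>_ends by (cases "b = \<beta>") auto
  obtain w where w: "\<alpha> \<le> w" "w \<le> \<beta>" "\<zeta> w = 1 - h / 20"
    using IVT'[of \<zeta> \<alpha> "1 - h / 20" \<beta>] \<zeta>_ends \<zeta>_cont ab h by auto
  have w\<beta>: "w < \<beta>" using w h \<zeta>_ends by (cases "w = \<beta>") auto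
  have h2: "60 * h\<^sup>2 \<le> 1" "60 * h\<^sup>2 < 19 / 20 * h"
  proof -
    have "h * h \<le> 1 / 100 * h" using h by (intro mult_right_mono) auto
    then show "60 * h\<^sup>2 \<le> 1" "60 * h\<^sup>2 < 19 / 20 * h" using h unfolding power2_eq_square by linarith+
  qed
  have mass: "integral {\<alpha>..b} a \<le> 18 * pi * h\<^sup>2"
  proof -
    have "integral {\<alpha>..b} a = pi * (\<zeta> b - \<zeta> b ^ 3 / 3 + 2 / 3)"
      using mass_has_integral[OF b(1,2)] by (rule integral_unique)
    also have "\<zeta> b - \<zeta> b ^ 3 / 3 + 2 / 3 = h\<^sup>2 - h ^ 3 / 3"
      unfolding b(3) by (simp add: power2_eq_square power3_eq_cube field_simps)
    also have "pi * (h\<^sup>2 - h ^ 3 / 3) \<le> pi * (18 * h\<^sup>2)"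
    proof (rule mult_left_mono)
      have "0 \<le> h ^ 3" "0 \<le> h\<^sup>2" using h by auto
      then show "h\<^sup>2 - h ^ 3 / 3 \<le> 18 * h\<^sup>2" by linarith
    qed simp
    finally show ?thesis by (simp add: mult_ac)
  qed
  have "(- 1) * (\<zeta> z - z) \<le> 3" if "\<alpha> \<le> z" "z \<le> b" for z
    using \<zeta>_mono[of \<alpha> z] that \<zeta>_ends range h b by simp
  from gap_point[OF \<alpha>b b\<beta> h(1) h2(1) mass this]
  obtain y where y: "b \<le> y" "y < \<beta>" "\<zeta> y - y \<le> 60 * h\<^sup>2" by force
  have gw: "19 / 20 * h \<le> \<zeta> w - w" using w range by simp
  have yw: "y \<le> w"
  proof (rule ccontr)
    assume "\<not> y \<le> w"
    then have "1 - h / 20 \<le> \<zeta> y" using \<zeta>_mono[of w y] w(3) by simp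
    then have "19 / 20 * h \<le> \<zeta> y - y" using y(2) range by simp
    then show False using y(3) h2 by simp
  qed
  have \<alpha>y: "\<alpha> < y" using \<alpha>b y(1) by simp
  let ?L = "\<lambda>z. (ln (1 + \<zeta> z) - ln (1 - \<zeta> z)) / (2 * pi)"
  have pw: "p z - 1 \<le> 2 * K / 3 * (a z * defect (p z)) + 1 / (2 * K) * (p z / (pi * (1 - (\<zeta> z)\<^sup>2)))" if z: "z \<in> {y..w}" for z
  proof -
    have zi: "\<alpha> < z" "z < \<beta>" using z \<alpha>y w\<beta> by auto
    note pp = p_pos[OF zi] and ap = a_pos[OF zi]
    define W where "W = pi * (1 - (\<zeta> z)\<^sup>2)"
    have W: "0 < W" using one_minus_sq[OF zi] by (simp add: W_def)
    have aW: "a z = p z * W" using a_eq[OF zi] by (simp add: W_def)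
    show ?thesis
    proof (cases "p z \<le> 1")
      case False
      have "p z - 1 = p z * (1 - 1 / p z)" using pp by (simp add: field_simps)
      also have "\<dots> \<le> p z * (K / 2 * (W * (1 - 1 / p z)\<^sup>2) + 1 / (2 * K * W))"
        using pp by (intro mult_left_mono young_weighted W K) auto
      also have "\<dots> = K / 2 * (a z * (1 - 1 / p z)\<^sup>2) + 1 / (2 * K) * (p z / W)"
        by (simp add: aW algebra_simps)
      also have "K / 2 * (a z * (1 - 1 / p z)\<^sup>2) \<le> K / 2 * (a z * (4 / 3 * defect (p z)))"
        using K ap False defect_ge_above[of "p z"] by (intro mult_left_mono) auto
      finally show ?thesis by (simp add: W_def)
    next
      case True
      have "0 \<le> 2 * K / 3 * (a z * defect (p z))" using K ap defect_nonneg[OF pp] by simp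
      moreover have "0 \<le> 1 / (2 * K) * (p z / (pi * (1 - (\<zeta> z)\<^sup>2)))" using K pp W unfolding W_def[symmetric] by simp
      ultimately show ?thesis using True by linarith
    qed
  qed
  have Lint: "((\<lambda>z. p z / (pi * (1 - (\<zeta> z)\<^sup>2))) has_integral ?L w - ?L y) {y..w}"
  proof (rule fundamental_theorem_of_calculus[OF yw])
    fix z assume z: "z \<in> {y..w}"
    have zi: "\<alpha> < z" "z < \<beta>" using z \<alpha>y w\<beta> by auto
    have b: "1 + \<zeta> z > 0" "1 - \<zeta> z > 0" using \<zeta>_bd[OF zi] by auto
    have "(\<zeta> has_real_derivative p z) (at z)" unfolding p_def by (rule \<zeta>_der[OF zi])
    then have "((\<lambda>z. ln (1 + \<zeta> z) - ln (1 - \<zeta> z)) has_real_derivative p z / (1 + \<zeta> z) + p z / (1 - \<zeta> z)) (at z)"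
      using b by (auto intro!: derivative_eq_intros)
    then have "(?L has_real_derivative (p z / (1 + \<zeta> z) + p z / (1 - \<zeta> z)) / (2 * pi)) (at z)"
      by (rule DERIV_cdivide)
    moreover have "(p z / (1 + \<zeta> z) + p z / (1 - \<zeta> z)) / (2 * pi) = p z / (pi * (1 - (\<zeta> z)\<^sup>2))"
    proof -
      have "p z / (1 + \<zeta> z) + p z / (1 - \<zeta> z) = 2 * p z / ((1 + \<zeta> z) * (1 - \<zeta> z))"
        using b by (simp add: add_frac_eq algebra_simps)
      also have "(1 + \<zeta> z) * (1 - \<zeta> z) = 1 - (\<zeta> z)\<^sup>2" by (simp add: power2_eq_square algebra_simps)
      finally show ?thesis by simp
    qed
    ultimately show "(?L has_vector_derivative p z / (pi * (1 - (\<zeta> z)\<^sup>2))) (at z within {y..w})"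
      by (simp add: has_real_derivative_iff_has_vector_derivative has_vector_derivative_at_within)
  qed
  have "(\<zeta> w - w) - (\<zeta> y - y) \<le> 2 * K / 3 * integral {y..w} (\<lambda>z. a z * defect (p z)) + 1 / (2 * K) * (?L w - ?L y)"
  proof (rule has_integral_le)
    show "((\<lambda>z. p z - 1) has_integral (\<zeta> w - w) - (\<zeta> y - y)) {y..w}"
      by (intro gap_derivative_integral \<alpha>y yw w\<beta>)
    show "((\<lambda>z. 2 * K / 3 * (a z * defect (p z)) + 1 / (2 * K) * (p z / (pi * (1 - (\<zeta> z)\<^sup>2)))) has_integral
      2 * K / 3 * integral {y..w} (\<lambda>z. a z * defect (p z)) + 1 / (2 * K) * (?L w - ?L y)) {y..w}"
      by (intro has_integral_add has_integral_mult_right defect_has_integral(1) Lint \<alpha>y yw w\<beta>)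
  qed (rule pw)
  also have "\<dots> \<le> 2 * K / 3 * D + 1 / (2 * K) * ((ln (2 / h) / (1 - h) + 180) / pi)"
  proof (intro add_mono mult_left_mono)
    show "integral {y..w} (\<lambda>z. a z * defect (p z)) \<le> D" by (rule defect_has_integral(2)[OF \<alpha>y yw w\<beta>])
    have y1: "h \<le> 1 + \<zeta> y" using \<zeta>_mono[OF y(1)] b(3) by simp
    have y2: "0 < 1 - \<zeta> y" using \<zeta>_bd[OF \<alpha>y y(2)] by simp
    have "?L w - ?L y = (ln (2 - h / 20) - ln (h / 20) - ln (1 + \<zeta> y) + ln (1 - \<zeta> y)) / (2 * pi)"
      unfolding w(3) by (simp add: diff_divide_distrib add_divide_distrib)
    also have "\<dots> \<le> (ln 2 - ln (h / 20) - ln h + ln 2) / (2 * pi)"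
      using h y1 y2 by (intro divide_right_mono add_mono diff_mono) auto
    also have "\<dots> = (2 * ln (2 / h) + ln 20) / (2 * pi)"
      using h by (simp add: ln_div)
    \<comment> \<open>ln 20 <= 19 is far below 360; the larger constant gives the bound the shape it
      has for a spike.\<close>
    also have "\<dots> \<le> (2 * ln (2 / h) + 360) / (2 * pi)"
      using ln_le_minus_one[of 20] by (intro divide_right_mono) auto
    also have "\<dots> = (ln (2 / h) + 180) / pi" by (simp add: field_simps)
    also have "\<dots> \<le> (ln (2 / h) / (1 - h) + 180) / pi"
    proof (intro divide_right_mono add_right_mono)
      have "0 \<le> ln (2 / h)" using h by simp
      then show "ln (2 / h) \<le> ln (2 / h) / (1 - h)"
        using h by (simp add: le_divide_eq mult_left_le)
    qed simp
    finally show "?L w - ?L y \<le> (ln (2 / h) / (1 - h) + 180) / pi" .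
  qed (use K in auto)
  finally show ?thesis using gw y(3) by linarith
qed

end

section \<open>Deficit of a body in normalised position\<close>

lemma norm_pt_sq: "(norm (pt (z, q)))\<^sup>2 = z\<^sup>2 + (norm q)\<^sup>2"
  unfolding power2_norm_eq_inner by (cases q) (simp add: inner_vec_def sum_3 power2_eq_square)

lemma measure_disc_real_prod:
  assumes "0 \<le> r"
  shows "measure lborel (ball (c :: real \<times> real) r) = pi * r\<^sup>2" "measure lborel (cball (c :: real \<times> real) r) = pi * r\<^sup>2"
  using content_ball[OF assms, of c] content_cball[OF assms, of c] by (simp_all add: unit_ball_vol_2 power2_eq_square)

lemma slice_vol_ge_disc:
  assumes "open U" "bounded U" and r: "0 \<le> r" and sub: "\<And>p. norm (pt p) < r \<Longrightarrow> p \<in> U" and z: "\<bar>z\<bar> < r"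
  shows "pi * (r\<^sup>2 - z\<^sup>2) \<le> slice_vol U z"
proof -
  have pos: "0 \<le> r\<^sup>2 - z\<^sup>2" using power_strict_mono[OF z, of 2] by simp
  have "ball 0 (sqrt (r\<^sup>2 - z\<^sup>2)) \<subseteq> slice U z"
  proof
    fix q :: "real \<times> real" assume "q \<in> ball 0 (sqrt (r\<^sup>2 - z\<^sup>2))"
    then have "(norm q)\<^sup>2 < r\<^sup>2 - z\<^sup>2" using real_less_rsqrt real_sqrt_less_iff[of "(norm q)\<^sup>2" "r\<^sup>2 - z\<^sup>2"] by simp
    then have "(norm (pt (z, q)))\<^sup>2 < r\<^sup>2" by (simp add: norm_pt_sq)
    then have "norm (pt (z, q)) < r" by (rule power2_less_imp_less[OF _ r])
    then show "q \<in> slice U z" using sub by (simp add: slice_def)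
  qed
  then have "measure lborel (ball (0 :: real \<times> real) (sqrt (r\<^sup>2 - z\<^sup>2))) \<le> measure lborel (slice U z)"
    using open_slice[OF assms(1)] bounded_slice[OF assms(2)]
    by (intro measure_mono_fmeasurable fmeasurable_lborel_bounded) auto
  then show ?thesis
    using measure_disc_real_prod(1)[of "sqrt (r\<^sup>2 - z\<^sup>2)"] pos by (simp add: slice_vol_def)
qed

lemma slice_vol_le_disc:
  assumes "open U" and r: "0 \<le> r" and sub: "\<And>p. p \<in> U \<Longrightarrow> norm (pt p) \<le> r" and z: "\<bar>z\<bar> \<le> r"
  shows "slice_vol U z \<le> pi * (r\<^sup>2 - z\<^sup>2)"
proof -
  have pos: "0 \<le> r\<^sup>2 - z\<^sup>2" using power_mono[OF z, of 2] by simp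
  have "slice U z \<subseteq> cball 0 (sqrt (r\<^sup>2 - z\<^sup>2))"
  proof
    fix q assume "q \<in> slice U z"
    then have "norm (pt (z, q)) \<le> r" using sub by (simp add: slice_def)
    then have "(norm (pt (z, q)))\<^sup>2 \<le> r\<^sup>2" by (intro power_mono) auto
    then show "q \<in> cball 0 (sqrt (r\<^sup>2 - z\<^sup>2))" by (simp add: norm_pt_sq real_le_rsqrt)
  qed
  then have "measure lborel (slice U z) \<le> measure lborel (cball (0 :: real \<times> real) (sqrt (r\<^sup>2 - z\<^sup>2)))"
    using open_slice[OF assms(1)] by (intro measure_mono_fmeasurable fmeasurable_lborel_bounded) auto
  then show ?thesis
    using measure_disc_real_prod(2)[of "sqrt (r\<^sup>2 - z\<^sup>2)"] pos by (simp add: slice_vol_def)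
qed

lemma nn_integral_slice_vol:
  fixes F :: "(real^3) set"
  assumes F: "convex F" "compact F" "0 \<in> interior F"
  defines "U \<equiv> {p. pt p \<in> interior F}"
  shows "(\<integral>\<^sup>+z. ennreal (slice_vol U z) \<partial>lborel) = ennreal (measure lebesgue F)"
proof -
  note CB = coordinate_body[OF F, folded U_def]
  have "(\<integral>\<^sup>+x\<in>interior F. 1 \<partial>lborel) = (\<integral>\<^sup>+z. 1 * ennreal (slice_vol U z) \<partial>lborel)"
    by (rule nn_integral_coordinate_body[OF CB(1,3,6)]) auto
  moreover have "(\<integral>\<^sup>+x\<in>interior F. 1 \<partial>lborel) = emeasure lborel (interior F)" by simp
  moreover have "emeasure lborel (interior F) = ennreal (measure lebesgue (interior F))"
    using emeasure_bounded_finite[OF bounded_subset[OF compact_imp_bounded[OF F(2)] interior_subset]]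
    by (simp add: emeasure_eq_ennreal_measure)
  moreover have "measure lebesgue (interior F) = measure lebesgue F"
    by (rule measure_interior[OF compact_imp_bounded[OF F(2)] negligible_convex_frontier[OF F(1)]])
  ultimately show ?thesis by simp
qed

text \<open>Dropping the nonnegative excess leaves three times the volume, that is 4 pi. It provides
  the lower bound in the evaluation of \<open>P unit_ball\<close>.\<close>

lemma isoperimetric_inequality:
  fixes F :: "(real^3) set"
  assumes F: "convex F" "compact F" "0 \<in> interior F" and V: "measure lebesgue F = 4 * pi / 3"
  shows "4 * pi \<le> P F"
proof -
  define U where "U = {p. pt p \<in> interior F}"
  note CB = coordinate_body[OF F, folded U_def]
  obtain \<zeta> :: "real \<Rightarrow> real" where
    \<zeta>: "slice_transport U \<zeta>"
    and Pb: "(\<integral>\<^sup>+z. ennreal (3 + defect (transport_rate U \<zeta> z)) * ennreal (slice_vol U z) \<partial>lborel) \<le> ennreal (P F)"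
    by (rule perimeter_ge_transport[OF F V, folded U_def]) (rule that; assumption)
  have "ennreal 3 * ennreal (4 * pi / 3) = (\<integral>\<^sup>+z. ennreal 3 * ennreal (slice_vol U z) \<partial>lborel)"
    unfolding nn_integral_slice_vol[OF F, folded U_def, unfolded V, symmetric]
    using slice_vol_measurable[OF CB(1)] by (intro nn_integral_cmult[symmetric]) simp
  also have "\<dots> \<le> (\<integral>\<^sup>+z. ennreal (3 + defect (transport_rate U \<zeta> z)) * ennreal (slice_vol U z) \<partial>lborel)"
  proof (rule nn_integral_mono)
    fix z :: real
    show "ennreal 3 * ennreal (slice_vol U z) \<le> ennreal (3 + defect (transport_rate U \<zeta> z)) * ennreal (slice_vol U z)"
    proof (cases "z \<in> fst ` U")
      case True
      then have "0 \<le> defect (transport_rate U \<zeta> z)"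
        by (intro defect_nonneg transport_rate_pos[OF CB(1,3) \<zeta>])
      then show ?thesis by (intro mult_right_mono ennreal_leI) auto
    next
      case False
      then have "slice U z = {}" using slice_nonempty[of U z] by blast
      then show ?thesis by (simp add: slice_vol_def)
    qed
  qed
  also have "\<dots> \<le> ennreal (P F)" by (rule Pb)
  also have "ennreal 3 * ennreal (4 * pi / 3) = ennreal (3 * (4 * pi / 3))" by (intro ennreal_mult[symmetric]) auto
  finally show ?thesis using perimeter_finite(2)[OF F] by simp
qed

text \<open>The slices of F are shown to form a \<open>transport_profile\<close> with D = P F - 4
  pi: the vanishing first moment of F gives the centring of \<open>a\<close>, and the two
  alternatives of \<open>contact\<close> select the spike or the dent estimate, which agree in
  form.\<close>

lemma perimeter_deficit_normalized:
  fixes F :: "(real^3) set"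
  assumes F: "convex F" "compact F" and V: "measure lebesgue F = 4 * pi / 3"
    and h: "0 < h" "h \<le> 1 / 100" and inner: "cball 0 (1 - h) \<subseteq> F" and outer: "F \<subseteq> cball 0 (1 + h)"
    and bary: "((\<lambda>x. x $ 1) has_integral 0) F"
    and contact: "axis 1 (1 + h) \<in> F \<or> (\<forall>x\<in>F. x $ 1 \<le> 1 - h)"
    and K: "0 < K"
  shows "19 / 20 * h - 60 * h\<^sup>2 \<le> 2 * K / 3 * (P F - 4 * pi) + 1 / (2 * K) * ((ln (2 / h) / (1 - h) + 180) / pi)"
proof -
  have bi: "ball 0 (1 - h) \<subseteq> interior F"
    using inner by (intro interior_maximal) (auto simp: subset_iff)
  have F0: "0 \<in> interior F" using bi h by auto
  define U where "U = {p. pt p \<in> interior F}"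
  note CB = coordinate_body[OF F F0, folded U_def]
  have ne: "U \<noteq> {}" using CB(4) by blast
  obtain \<alpha> \<beta> where ab: "\<alpha> < \<beta>" "fst ` U = {\<alpha><..<\<beta>}"
    by (rule fst_image_eq_interval[OF CB(1-3) ne]) (rule that)
  obtain \<zeta> :: "real \<Rightarrow> real" where
    \<zeta>: "slice_transport U \<zeta>"
    and Pb: "(\<integral>\<^sup>+z. ennreal (3 + defect (transport_rate U \<zeta> z)) * ennreal (slice_vol U z) \<partial>lborel) \<le> ennreal (P F)"
    by (rule perimeter_ge_transport[OF F F0 V, folded U_def]) (rule that; assumption)
  let ?a = "slice_vol U"
  let ?p = "transport_rate U \<zeta>"
  have am[measurable]: "?a \<in> borel_measurable borel" by (rule slice_vol_measurable[OF CB(1)])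
  have \<zeta>c: "continuous_on UNIV \<zeta>" using \<zeta> by (simp add: slice_transport_def)
  have [measurable]: "\<zeta> \<in> borel_measurable borel" using \<zeta>c by (rule borel_measurable_continuous_onI)
  have a_nn: "0 \<le> ?a z" for z by (simp add: slice_vol_def)
  have a_out: "?a z = 0" if "z \<le> \<alpha> \<or> \<beta> \<le> z" for z
  proof -
    have "z \<notin> fst ` U" using that ab by auto
    then have "slice U z = {}" using slice_nonempty[of U z] by blast
    then show ?thesis by (simp add: slice_vol_def)
  qed
  have a_pos: "0 < ?a z" if "\<alpha> < z" "z < \<beta>" for z
    using that ab by (intro slice_vol_pos CB) auto
  have a_cont: "isCont ?a z" if "\<alpha> < z" "z < \<beta>" for z
    using that ab by (intro isCont_slice_vol CB) auto
  have \<zeta>f: "-1 < \<zeta> z \<and> \<zeta> z < 1" "(\<zeta> has_real_derivative ?p z) (at z)" if "\<alpha> < z" "z < \<beta>" for z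
    using \<zeta> that ab by (auto simp: slice_transport_def)
  have p_pos: "0 < ?p z" if "\<alpha> < z" "z < \<beta>" for z
    using that ab by (intro transport_rate_pos[OF CB(1,3) \<zeta>]) auto
  have norm_U: "norm (pt p) \<le> 1 + h" if "p \<in> U" for p
    using that subsetD[OF subset_trans[OF interior_subset outer], of "pt p"] by (simp add: U_def)
  have fst_le: "\<bar>z\<bar> \<le> 1 + h" if "z \<in> fst ` U" for z
  proof -
    obtain q where "(z, q) \<in> U" using \<open>z \<in> fst ` U\<close> by force
    then have "\<bar>pt (z, q) $ 1\<bar> \<le> 1 + h" using norm_U component_le_norm_cart order_trans by blast
    then show ?thesis by (cases q) simp
  qed
  have \<alpha>lo: "-1 - h \<le> \<alpha>"
  proof (rule field_le_epsilon)
    fix e :: real assume e: "0 < e"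
    define z where "z = min (\<alpha> + e) ((\<alpha> + \<beta>) / 2)"
    have "z \<in> fst ` U" unfolding ab z_def using ab e by auto
    from fst_le[OF this] have "-1 - h \<le> z" by auto
    then show "-1 - h \<le> \<alpha> + e" by (simp add: z_def)
  qed
  have \<beta>_le: "\<beta> \<le> c" if "\<And>z. z \<in> fst ` U \<Longrightarrow> z \<le> c" for c
  proof (rule field_le_epsilon)
    fix e :: real assume e: "0 < e"
    define z where "z = max (\<beta> - e) ((\<alpha> + \<beta>) / 2)"
    have "z \<in> fst ` U" unfolding ab z_def using ab e by auto
    from that[OF this] show "\<beta> \<le> c + e" by (simp add: z_def)
  qed
  note mass = nn_integral_slice_vol[OF F F0, folded U_def, unfolded V]
  have restrict: "(f has_integral I) {\<alpha>..\<beta>}" if "(f has_integral I) UNIV" "\<And>z. z \<le> \<alpha> \<or> \<beta> \<le> z \<Longrightarrow> f z = 0" for f :: "real \<Rightarrow> real" and I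
  proof -
    have "(\<lambda>z. if z \<in> {\<alpha>..\<beta>} then f z else 0) = f" using that(2) by fastforce
    then show ?thesis using that(1) has_integral_restrict_UNIV[of "{\<alpha>..\<beta>}" f I] by simp
  qed
  have a_int: "(?a has_integral 4 * pi / 3) {\<alpha>..\<beta>}"
    by (rule restrict[OF nn_integral_has_integral[OF am a_nn mass] a_out]) auto
  (* The first moment is shifted by 2 to stay with nonnegative integrands. *)
  have "((\<lambda>z. max 0 (z + 2) * ?a z) has_integral 8 * pi / 3) {\<alpha>..\<beta>}"
  proof (rule restrict[OF nn_integral_has_integral])
    have one: "((\<lambda>x. 1) has_integral 4 * pi / 3) F"
      using lmeasurable_compact[OF F(2)] lmeasurable_iff_integrable_on[of F] V
      by (simp add: has_integral_iff lmeasure_integral)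
    have "((\<lambda>x. x $ 1 + 2 * 1) has_integral 0 + 2 * (4 * pi / 3)) F"
      by (intro has_integral_add bary has_integral_mult_right one)
    then have "((\<lambda>x. x $ 1 + 2) has_integral 8 * pi / 3) (interior F)"
    proof (subst has_integral_spike_set_eq[where T=F])
      show "negligible {x \<in> interior F - F. x $ 1 + 2 \<noteq> 0}" using interior_subset[of F] by (simp add: Diff_eq_empty_iff[THEN iffD2] cong: conj_cong)
      show "negligible {x \<in> F - interior F. x $ 1 + 2 \<noteq> 0}"
        by (rule negligible_subset[OF negligible_convex_frontier[OF F(1)]]) (use closure_subset in \<open>auto simp: frontier_def\<close>)
    qed simp
    moreover have pos: "0 \<le> x $ 1 + 2" if "x \<in> interior F" for x
    proof -
      have "norm x \<le> 1 + h" using that outer interior_subset by (auto simp: subset_iff)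
      then show ?thesis using component_le_norm_cart[of x 1] h by linarith
    qed
    ultimately have "(\<integral>\<^sup>+x. ennreal (indicator (interior F) x * (x $ 1 + 2)) \<partial>lborel) = ennreal (8 * pi / 3)"
      by (intro nn_integral_has_integral_lebesgue)
    also have "(\<integral>\<^sup>+x. ennreal (indicator (interior F) x * (x $ 1 + 2)) \<partial>lborel) = (\<integral>\<^sup>+x\<in>interior F. ennreal (max 0 (x $ 1 + 2)) \<partial>lborel)"
      using pos by (intro nn_integral_cong) (auto simp: indicator_def max_def)
    also have "\<dots> = (\<integral>\<^sup>+z. ennreal (max 0 (z + 2)) * ennreal (?a z) \<partial>lborel)"
      by (rule nn_integral_coordinate_body[OF CB(1,3,6)]) auto
    finally show "(\<integral>\<^sup>+z. ennreal (max 0 (z + 2) * ?a z) \<partial>lborel) = ennreal (8 * pi / 3)"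
      by (simp add: ennreal_mult a_nn)
  qed (use a_nn a_out in auto)
  from has_integral_diff[OF this has_integral_mult_right[OF a_int, of 2]]
  have bary': "((\<lambda>z. max 0 (z + 2) * ?a z - 2 * ?a z) has_integral 0) {\<alpha>..\<beta>}" by simp
  have a_bary: "((\<lambda>z. z * ?a z) has_integral 0) {\<alpha>..\<beta>}"
  proof (rule has_integral_eq[OF _ bary'])
    fix z assume "z \<in> {\<alpha>..\<beta>}"
    then have "0 \<le> z + 2" using \<alpha>lo h by auto
    then show "max 0 (z + 2) * ?a z - 2 * ?a z = z * ?a z" by (simp add: algebra_simps)
  qed
  \<comment> \<open>The constant 3 in the transport bound integrates to 4 pi; the excess is
    nonnegative, so its integral may be restricted to a subinterval.\<close>
  have deficit: "integral {u..w} (\<lambda>z. ?a z * defect (?p z)) \<le> P F - 4 * pi" if uw: "\<alpha> < u" "u \<le> w" "w < \<beta>" for u w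
  proof -
    let ?f = "\<lambda>z. ?a z * defect (?p z)"
    have in_ab: "\<alpha> < z" "z < \<beta>" if "z \<in> {u..w}" for z using that uw by auto
    have cp: "isCont ?p z" if "\<alpha> < z" "z < \<beta>" for z
      unfolding transport_rate_def
      using \<zeta>f[OF that] a_cont[OF that] abs_square_less_1[of "\<zeta> z"] DERIV_isCont[OF \<zeta>f(2)[OF that]]
      by (intro continuous_intros) auto
    have c: "continuous_on {u..w} ?a" "continuous_on {u..w} ?p"
      by (intro continuous_at_imp_continuous_on ballI a_cont cp in_ab; assumption)+
    have "sqrt (?p z) \<noteq> 0" if "z \<in> {u..w}" for z by (rule less_imp_neq[OF real_sqrt_gt_zero[OF p_pos[OF in_ab[OF that]]], THEN not_sym])
    then have "continuous_on {u..w} ?f" unfolding defect_def by (intro continuous_intros c) auto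
    then have I: "(?f has_integral integral {u..w} ?f) {u..w}"
      by (intro integrable_integral integrable_continuous_real)
    have nn: "0 \<le> ?f z" if "\<alpha> < z" "z < \<beta>" for z
      using defect_nonneg[OF p_pos[OF that]] a_nn[of z] by simp
    have "(\<integral>\<^sup>+z. ennreal (3 * ?a z) \<partial>lborel) + (\<integral>\<^sup>+z. ennreal (indicator {u..w} z * ?f z) \<partial>lborel)
        = (\<integral>\<^sup>+z. ennreal (3 * ?a z) + ennreal (indicator {u..w} z * ?f z) \<partial>lborel)"
      unfolding defect_def transport_rate_def by (intro nn_integral_add[symmetric]) measurable
    also have "\<dots> \<le> (\<integral>\<^sup>+z. ennreal (3 + defect (?p z)) * ennreal (?a z) \<partial>lborel)"
    proof (rule nn_integral_mono)
      fix z :: real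
      show "ennreal (3 * ?a z) + ennreal (indicator {u..w} z * ?f z) \<le> ennreal (3 + defect (?p z)) * ennreal (?a z)"
      proof (cases "\<alpha> < z \<and> z < \<beta>")
        case True
        then have pp: "0 < ?p z" using p_pos by blast
        have f0: "0 \<le> ?f z" using True nn by blast
        have d0: "0 \<le> defect (?p z)" using defect_nonneg[OF pp] .
        have "ennreal (3 * ?a z) + ennreal (indicator {u..w} z * ?f z) = ennreal (3 * ?a z + indicator {u..w} z * ?f z)"
          using f0 a_nn[of z] by (intro ennreal_plus[symmetric]) (auto simp: indicator_def)
        also have "\<dots> \<le> ennreal ((3 + defect (?p z)) * ?a z)"
          using f0 by (intro ennreal_leI) (auto simp: indicator_def algebra_simps)
        also have "\<dots> = ennreal (3 + defect (?p z)) * ennreal (?a z)"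
          using d0 a_nn[of z] by (intro ennreal_mult) auto
        finally show ?thesis .
      next
        case False
        then have "?a z = 0" using a_out[of z] by auto
        then show ?thesis by simp
      qed
    qed
    also have "\<dots> \<le> ennreal (P F)" by (rule Pb)
    also have "(\<integral>\<^sup>+z. ennreal (indicator {u..w} z * ?f z) \<partial>lborel) = ennreal (integral {u..w} ?f)"
      by (rule nn_integral_has_integral_lebesgue[OF nn[OF in_ab] I])
    also have "(\<integral>\<^sup>+z. ennreal (3 * ?a z) \<partial>lborel) = ennreal (4 * pi)"
    proof -
      have "(\<integral>\<^sup>+z. ennreal (3 * ?a z) \<partial>lborel) = (\<integral>\<^sup>+z. ennreal 3 * ennreal (?a z) \<partial>lborel)"
        by (intro nn_integral_cong ennreal_mult a_nn) simp
      also have "\<dots> = ennreal 3 * ennreal (4 * pi / 3)"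
        unfolding mass[symmetric] by (rule nn_integral_cmult) simp
      also have "\<dots> = ennreal (3 * (4 * pi / 3))" by (intro ennreal_mult[symmetric]) auto
      finally show ?thesis by simp
    qed
    finally have "ennreal (4 * pi) + ennreal (integral {u..w} ?f) \<le> ennreal (P F)" .
    moreover have "0 \<le> integral {u..w} ?f"
      using I nn in_ab by (intro integral_nonneg) (auto simp: has_integral_iff)
    ultimately have "ennreal (4 * pi + integral {u..w} ?f) \<le> ennreal (P F)" by simp
    then show ?thesis using perimeter_finite(2)[OF F F0] by simp
  qed
  interpret tp: transport_profile ?a \<zeta> \<alpha> \<beta> "P F - 4 * pi"
  proof
    show "\<zeta> \<alpha> = -1" "\<zeta> \<beta> = 1"
      using slice_cdf_ends(1,2)[OF CB(1,3) ne ab(2)] \<zeta> by (auto simp: slice_transport_def)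
    show "\<zeta> x \<le> \<zeta> y" if "x \<le> y" for x y using \<zeta> that by (auto simp: slice_transport_def monoD)
    show "continuous_on {\<alpha>..\<beta>} \<zeta>" using \<zeta>c by (rule continuous_on_subset) simp
  qed (use ab(1) a_pos a_out a_cont a_bary \<zeta>f deficit in \<open>unfold transport_rate_def, blast\<close>)+
  from contact show ?thesis
  proof
    assume "\<forall>x\<in>F. x $ 1 \<le> 1 - h"
    then have "z \<le> 1 - h" if "z \<in> fst ` U" for z
      using that interior_subset by (fastforce simp: U_def)
    then have "\<beta> \<le> 1 - h" by (rule \<beta>_le)
    then show ?thesis by (rule tp.dent_bound[OF h K])
  next
    assume apex: "axis 1 (1 + h) \<in> F"
    have pt0: "pt (1 + h, 0) = axis 1 (1 + h)" by (simp add: vec_eq_iff forall_3 axis_def zero_prod_def)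
    have seg: "t *\<^sub>R (1 + h, 0) \<in> U" if t: "0 \<le> t" "t < 1" for t
    proof -
      have "axis 1 (1 + h) - (1 - t) *\<^sub>R (axis 1 (1 + h) - 0) \<in> interior F"
        using t by (intro mem_interior_convex_shrink F(1) F0 apex) auto
      moreover have "axis 1 (1 + h) - (1 - t) *\<^sub>R (axis 1 (1 + h) - 0) = t *\<^sub>R pt (1 + h, 0)"
        by (simp add: pt0 algebra_simps)
      ultimately show ?thesis by (simp add: U_def linear_scale[OF linear_pt, symmetric])
    qed
    have \<beta>: "\<beta> = 1 + h"
    proof (rule antisym)
      show "\<beta> \<le> 1 + h" by (rule \<beta>_le) (use fst_le in fastforce)
      show "1 + h \<le> \<beta>"
      proof (rule ccontr)
        assume less: "\<not> 1 + h \<le> \<beta>"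
        have "0 \<in> fst ` U" using CB(4) by force
        then have "0 < \<beta>" unfolding ab(2) by simp
        then have "(\<beta> / (1 + h)) *\<^sub>R (1 + h, 0) \<in> U" using less h by (intro seg) auto
        then have "\<beta> / (1 + h) * (1 + h) \<in> fst ` U" by force
        then show False unfolding ab(2) using h by simp
      qed
    qed
    have "(\<lambda>n. (1 - inverse (real (Suc n))) *\<^sub>R (1 + h, 0 :: real \<times> real)) \<longlonglongrightarrow> (1 - 0) *\<^sub>R (1 + h, 0)"
      by (intro tendsto_intros LIMSEQ_inverse_real_of_nat)
    moreover have "(1 - inverse (real (Suc n))) *\<^sub>R (1 + h, 0) \<in> U" for n
      by (intro seg) (auto simp: inverse_le_1_iff)
    ultimately have cl: "(1 + h, 0) \<in> closure U"
      unfolding closure_sequential by (intro exI[of _ "\<lambda>n. (1 - inverse (real (Suc n))) *\<^sub>R (1 + h, 0)"]) auto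
    have lower: "pi * ((1 - h)\<^sup>2 - z\<^sup>2) \<le> ?a z" if "\<bar>z\<bar> < 1 - h" for z
      using that bi h by (intro slice_vol_ge_disc CB) (auto simp: U_def)
    have upper: "?a z \<le> pi * ((1 + h)\<^sup>2 - z\<^sup>2)" if "-1 - h \<le> z" "z \<le> 0" for z
      using that h norm_U by (intro slice_vol_le_disc CB) auto
    \<comment> \<open>The cone with apex at height 1 + h over the slice at 1 - 2 h has height 3 h,
      and that slice contains a disc of the inner ball of area at least pi h.\<close>
    have cone: "pi * (\<beta> - z)\<^sup>2 / (9 * h) \<le> ?a z" if z: "1 - 2 * h \<le> z" "z < \<beta>" for z
    proof -
      have "((1 + h - z) / (3 * h))\<^sup>2 * ?a (1 - 2 * h) \<le> ?a z"
        using slice_vol_ratio[OF CB(1-3) cl, of "1 - 2 * h" z] z \<beta> by (simp add: power2_eq_square)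
      moreover have "pi * h \<le> ?a (1 - 2 * h)"
      proof -
        have "pi * ((1 - h)\<^sup>2 - (1 - 2 * h)\<^sup>2) \<le> ?a (1 - 2 * h)" using h by (intro lower) auto
        moreover have "(1 - h)\<^sup>2 - (1 - 2 * h)\<^sup>2 = h * (2 - 3 * h)" by (simp add: power2_eq_square algebra_simps)
        moreover have "pi * (h * 1) \<le> pi * (h * (2 - 3 * h))" using h by (intro mult_left_mono) auto
        ultimately show ?thesis unfolding mult_1_right by (simp only:)
      qed
      then have "((1 + h - z) / (3 * h))\<^sup>2 * (pi * h) \<le> ((1 + h - z) / (3 * h))\<^sup>2 * ?a (1 - 2 * h)"
        by (intro mult_left_mono) auto
      moreover have "((1 + h - z) / (3 * h))\<^sup>2 * (pi * h) = pi * (\<beta> - z)\<^sup>2 / (9 * h)"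
        using h unfolding \<beta> by (simp add: power_divide power2_eq_square)
      ultimately show ?thesis by simp
    qed
    show ?thesis by (rule tp.spike_bound[OF h K \<alpha>lo \<beta> lower upper cone])
  qed
qed

text \<open>K = I / m is the best choice: it turns the last term into m / 2, and the rest is solved
  for the deficit.\<close>

lemma perimeter_deficit_lower_bound:
  fixes F :: "(real^3) set"
  assumes "convex F" "compact F" "measure lebesgue F = 4 * pi / 3"
    and h: "0 < h" "h \<le> 1 / 100" and "cball 0 (1 - h) \<subseteq> F" "F \<subseteq> cball 0 (1 + h)"
    and "((\<lambda>x. x $ 1) has_integral 0) F"
    and "axis 1 (1 + h) \<in> F \<or> (\<forall>x\<in>F. x $ 1 \<le> 1 - h)"
  shows "3 * pi * (19 / 20 * h - 60 * h\<^sup>2)\<^sup>2 / (4 * (ln (2 / h) / (1 - h) + 180)) \<le> P F - 4 * pi"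
proof -
  define m I where "m = 19 / 20 * h - 60 * h\<^sup>2" and "I = (ln (2 / h) / (1 - h) + 180) / pi"
  have "h * h \<le> 1 / 100 * h" using h by (intro mult_right_mono) auto
  then have m: "0 < m" using h unfolding m_def power2_eq_square by linarith
  have "0 \<le> ln (2 / h) / (1 - h)" using h by simp
  then have I: "0 < I" by (simp add: I_def)
  have "0 < I / m" using m I by simp
  from perimeter_deficit_normalized[OF assms this]
  have "m \<le> 2 * (I / m) / 3 * (P F - 4 * pi) + 1 / (2 * (I / m)) * I"
    unfolding m_def[symmetric] I_def[symmetric] .
  then have "m / 2 \<le> 2 * I / (3 * m) * (P F - 4 * pi)" using I m by simp
  then have "3 * m\<^sup>2 / (4 * I) \<le> P F - 4 * pi" using I m by (simp add: field_simps power2_eq_square)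
  then show ?thesis by (simp add: m_def I_def mult_ac)
qed

section \<open>Hausdorff distance to balls and the barycentre\<close>

text \<open>Compactness makes both suprema maxima; a maximiser is what becomes the contact point of
  a spike or a dent.\<close>

lemma hausdorff_dist_upper:
  fixes A B :: "'a::heine_borel set"
  assumes "compact A" "compact B" "A \<noteq> {}" "B \<noteq> {}"
  shows "y \<in> A \<Longrightarrow> infdist y B \<le> hausdorff_dist A B" "y \<in> B \<Longrightarrow> infdist y A \<le> hausdorff_dist A B"
    and "(\<exists>y\<in>A. infdist y B = hausdorff_dist A B) \<or> (\<exists>y\<in>B. infdist y A = hausdorff_dist A B)"
    and "0 \<le> hausdorff_dist A B"
proof -
  have c: "continuous_on S (\<lambda>y. infdist y T)" for S T :: "'a set" by (intro continuous_intros)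
  have *: "\<exists>y\<in>S. infdist y T = (SUP y\<in>S. infdist y T) \<and> (\<forall>z\<in>S. infdist z T \<le> infdist y T)"
    if S: "compact S" "S \<noteq> {}" for S T :: "'a set"
  proof -
    obtain y where y: "y \<in> S" "\<And>z. z \<in> S \<Longrightarrow> infdist z T \<le> infdist y T"
      using continuous_attains_sup[OF S c] by blast
    then have "(SUP y\<in>S. infdist y T) = infdist y T" by (intro cSup_eq_maximum) auto
    then show ?thesis using y by auto
  qed
  obtain y where y: "y \<in> A" "infdist y B = (SUP y\<in>A. infdist y B)" "\<forall>z\<in>A. infdist z B \<le> infdist y B"
    using *[OF assms(1,3), of B] by blast
  obtain z where z: "z \<in> B" "infdist z A = (SUP y\<in>B. infdist y A)" "\<forall>w\<in>B. infdist w A \<le> infdist z A"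
    using *[OF assms(2,4), of A] by blast
  have d: "hausdorff_dist A B = max (infdist y B) (infdist z A)"
    by (simp add: hausdorff_dist_def y(2) z(2))
  show "y \<in> A \<Longrightarrow> infdist y B \<le> hausdorff_dist A B" for y
    using y(3) by (simp add: d le_max_iff_disj)
  show "y \<in> B \<Longrightarrow> infdist y A \<le> hausdorff_dist A B" for y
    using z(3) by (simp add: d le_max_iff_disj)
  show "(\<exists>y\<in>A. infdist y B = hausdorff_dist A B) \<or> (\<exists>y\<in>B. infdist y A = hausdorff_dist A B)"
    using y(1) z(1) by (auto simp: d max_def)
  show "0 \<le> hausdorff_dist A B" by (simp add: d infdist_nonneg le_max_iff_disj)
qed

lemma hausdorff_dist_le:
  assumes "A \<noteq> {}" "B \<noteq> {}" "\<And>y. y \<in> A \<Longrightarrow> infdist y B \<le> r" "\<And>y. y \<in> B \<Longrightarrow> infdist y A \<le> r"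
  shows "hausdorff_dist A B \<le> r"
  unfolding hausdorff_dist_def using assms by (intro max.boundedI cSUP_least) auto

lemma infdist_cball_1_le:
  fixes x y :: "'a::real_inner"
  assumes "norm (y - x) \<le> 1 + r" "0 \<le> r"
  shows "infdist y (cball x 1) \<le> r"
proof (cases "norm (y - x) \<le> 1")
  case True
  then have "y \<in> cball x 1" by (simp add: dist_norm norm_minus_commute)
  then show ?thesis using assms by simp
next
  case False
  define u where "u = x + (1 / norm (y - x)) *\<^sub>R (y - x)"
  have "u \<in> cball x 1" using False by (auto simp: u_def dist_norm)
  then have "infdist y (cball x 1) \<le> dist y u" by (rule infdist_le)
  also have "dist y u = norm (y - x) - 1"
  proof -
    define n where "n = norm (y - x)"
    have n: "1 < n" using False by (simp add: n_def)
    have "y - u = (1 - 1 / n) *\<^sub>R (y - x)" by (simp add: u_def n_def algebra_simps)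
    then have "dist y u = \<bar>1 - 1 / n\<bar> * n" by (simp add: dist_norm n_def)
    also have "\<dots> = n - 1" using n by (simp add: abs_of_nonneg left_diff_distrib)
    finally show ?thesis by (simp add: n_def)
  qed
  finally show ?thesis using assms by simp
qed

text \<open>If a point of the smaller ball were missing from F, a separating hyperplane would leave
  the extreme point of the unit ball in its normal direction at distance more than d from F. A
  maximiser in F yields the spike. A maximiser in the ball yields the dent, with the half-space
  supporting F at the closest point.\<close>

lemma hausdorff_ball_inclusions:
  fixes F :: "'a::euclidean_space set" and x :: 'a
  assumes F: "convex F" "compact F" "F \<noteq> {}"
  defines "d \<equiv> hausdorff_dist F (cball x 1)"
  shows "F \<subseteq> cball x (1 + d)" "cball x (1 - d) \<subseteq> F"
    and "0 < d \<Longrightarrow> \<exists>e. norm e = 1 \<and> (x + (1 + d) *\<^sub>R e \<in> F \<or> (\<forall>y\<in>F. (y - x) \<bullet> e \<le> 1 - d))"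
proof -
  have B: "compact (cball x 1)" "cball x 1 \<noteq> {}" by auto
  note H = hausdorff_dist_upper[OF F(2) B(1) F(3) B(2), folded d_def]
  show sub: "F \<subseteq> cball x (1 + d)"
  proof
    fix y assume "y \<in> F"
    obtain b where b: "b \<in> cball x 1" "infdist y (cball x 1) = dist y b"
      using infdist_attains_inf[of "cball x 1" y] by auto
    have "dist x y \<le> dist x b + dist y b" by (metis dist_triangle dist_commute)
    then show "y \<in> cball x (1 + d)" using H(1)[OF \<open>y \<in> F\<close>] b by simp
  qed
  show "cball x (1 - d) \<subseteq> F"
  proof (rule ccontr)
    assume "\<not> cball x (1 - d) \<subseteq> F"
    then obtain z where "z \<in> cball x (1 - d)" "z \<notin> F" by blast
    then have z: "norm (z - x) \<le> 1 - d" "z \<notin> F" by (auto simp: dist_norm norm_minus_commute)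
    obtain a b where ab: "a \<bullet> z < b" "\<And>y. y \<in> F \<Longrightarrow> b < a \<bullet> y"
      using separating_hyperplane_closed_point[OF F(1) compact_imp_closed[OF F(2)] z(2)] by blast
    have "a \<noteq> 0" using ab F(3) by force
    \<comment> \<open>The unit normal pointing from F towards z; x + n is the extreme point of the
      ball used for the contradiction.\<close>
    define n where "n = (- 1 / norm a) *\<^sub>R a"
    have n: "norm n = 1" using \<open>a \<noteq> 0\<close> by (simp add: n_def)
    have nl: "n \<bullet> y < n \<bullet> z" if "y \<in> F" for y
      using ab(1) ab(2)[OF that] \<open>a \<noteq> 0\<close> by (simp add: n_def divide_strict_right_mono)
    have "x + n \<in> cball x 1" using n by (simp add: dist_norm)
    then have "infdist (x + n) F \<le> d" by (rule H(2))
    moreover obtain y where y: "y \<in> F" "infdist (x + n) F = dist (x + n) y"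
      using infdist_attains_inf[OF compact_imp_closed[OF F(2)] F(3)] by blast
    moreover have "d < n \<bullet> (x + n - y)"
    proof -
      have "n \<bullet> (z - x) \<le> 1 - d" using norm_cauchy_schwarz[of n "z - x"] n z(1) by simp
      moreover have "n \<bullet> n = 1" using n by (simp add: dot_square_norm)
      ultimately show ?thesis using nl[OF y(1)] by (simp add: inner_diff_right inner_add_right)
    qed
    moreover have "n \<bullet> (x + n - y) \<le> dist (x + n) y"
      using norm_cauchy_schwarz[of n "x + n - y"] n by (simp add: dist_norm)
    ultimately show False by linarith
  qed
  assume d: "0 < d"
  from H(3) show "\<exists>e. norm e = 1 \<and> (x + (1 + d) *\<^sub>R e \<in> F \<or> (\<forall>y\<in>F. (y - x) \<bullet> e \<le> 1 - d))"
  proof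
    assume "\<exists>y\<in>F. infdist y (cball x 1) = d"
    then obtain y where y: "y \<in> F" "infdist y (cball x 1) = d" by blast
    have le: "norm (y - x) \<le> 1 + d" using sub y(1) by (auto simp: dist_norm norm_minus_commute)
    have ge: "1 + d \<le> norm (y - x)"
    proof (rule ccontr)
      assume "\<not> 1 + d \<le> norm (y - x)"
      then have "infdist y (cball x 1) \<le> max 0 (norm (y - x) - 1)" by (intro infdist_cball_1_le) auto
      then show False using y(2) d \<open>\<not> 1 + d \<le> norm (y - x)\<close> by (auto simp: max_def split: if_splits)
    qed
    define e where "e = (1 / (1 + d)) *\<^sub>R (y - x)"
    have "norm e = 1" using le ge d by (simp add: e_def)
    moreover have "x + (1 + d) *\<^sub>R e = y" using d by (simp add: e_def)
    ultimately show ?thesis using y(1) by metis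
  next
    assume "\<exists>y\<in>cball x 1. infdist y F = d"
    then obtain w where "w \<in> cball x 1" "infdist w F = d" by blast
    then have w: "norm (w - x) \<le> 1" "infdist w F = d" by (auto simp: dist_norm norm_minus_commute)
    define y0 where "y0 = closest_point F w"
    have cl: "closed F" using F(2) by (rule compact_imp_closed)
    have "dist w y0 = d"
      unfolding y0_def using w(2) infdist_eq_setdist[of w F] setdist_closest_point[OF cl F(3), of w] by simp
    define e where "e = (1 / d) *\<^sub>R (w - y0)"
    have e: "norm e = 1" using \<open>dist w y0 = d\<close> d by (simp add: e_def dist_norm)
    have we: "w - y0 = d *\<^sub>R e" using d by (simp add: e_def)
    have "(y - x) \<bullet> e \<le> 1 - d" if "y \<in> F" for y
    proof -
      have "(w - y0) \<bullet> (y - y0) \<le> 0" unfolding y0_def by (rule closest_point_dot[OF F(1) cl that])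
      then have "e \<bullet> (y - y0) \<le> 0" unfolding we using d by (simp add: mult_le_0_iff)
      moreover have "e \<bullet> (w - x) \<le> 1" using norm_cauchy_schwarz[of e "w - x"] e w(1) by simp
      moreover have "e \<bullet> (w - y0) = d" unfolding we using e by (simp add: dot_square_norm)
      moreover have "(y - x) \<bullet> e = e \<bullet> (y - y0) - e \<bullet> (w - y0) + e \<bullet> (w - x)"
        by (simp add: inner_diff_right inner_commute)
      ultimately show ?thesis by linarith
    qed
    then show ?thesis using e by blast
  qed
qed

(* The factor 3 / (4 * pi) is the inverse volume of the bodies in class_A. *)
definition barycentre :: "(real^3) set \<Rightarrow> real^3" where
  "barycentre F = (\<chi> i. 3 / (4 * pi) * integral F (\<lambda>x. x $ i))"

section \<open>The barycentre as an almost optimal centre\<close>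

lemma unit_ball_translate: "(\<lambda>y. y + x) ` unit_ball = cball x 1"
  unfolding unit_ball_def using cball_translation[of x 0 1] by (simp add: add.commute)

lemma continuous_coordinate: "continuous_on S (\<lambda>x::real^3. x $ i - c)"
  by (intro continuous_intros)

lemma integrable_continuous_compact:
  fixes f :: "'a::euclidean_space \<Rightarrow> real"
  assumes "compact S" "continuous_on S f"
  shows "f integrable_on S"
  using absolutely_integrable_continuous_compact[OF assms] by (rule set_lebesgue_integral_eq_integral(1))

lemma has_integral_const_compact: "compact S \<Longrightarrow> ((\<lambda>x. c) has_integral measure lebesgue S * c) S"
  for S :: "'a::euclidean_space set" and c :: real
proof -
  assume S: "compact S"
  have "((\<lambda>x. 1::real) has_integral measure lebesgue S) S"
    using lmeasurable_compact[OF S] lmeasurable_iff_integrable_on[of S]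
    by (simp add: has_integral_iff lmeasure_integral)
  from has_integral_mult_left[OF this, of c] show ?thesis by simp
qed

text \<open>The reflection y -> 2 x - y preserves the ball and changes the sign of the
  integrand.\<close>

lemma integral_coordinate_cball: "integral (cball x r) (\<lambda>y::real^3. y $ i - x $ i) = 0"
proof -
  let ?g = "\<lambda>y. 1 *\<^sub>R (- y) + 2 *\<^sub>R x"
  have orth: "orthogonal_transformation (uminus :: real^3 \<Rightarrow> real^3)"
    by (simp add: orthogonal_transformation_def linear_uminus)
  have img: "?g ` cball x r = cball x r"
  proof
    show 1: "?g ` cball x r \<subseteq> cball x r"
    proof
      fix y assume "y \<in> ?g ` cball x r"
      then obtain z where z: "z \<in> cball x r" "y = ?g z" by blast
      have "x - y = - (x - z)" by (simp add: z(2) scaleR_2)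
      then have "norm (x - y) = norm (x - z)" by (simp only: norm_minus_cancel)
      then show "y \<in> cball x r" using z(1) by (simp add: dist_norm)
    qed
    show "cball x r \<subseteq> ?g ` cball x r"
    proof
      fix y assume "y \<in> cball x r"
      then have "?g y \<in> cball x r" using 1 by blast
      moreover have "y = ?g (?g y)" by (simp add: scaleR_2)
      ultimately show "y \<in> ?g ` cball x r" by blast
    qed
  qed
  have "integral (?g ` cball x r) (\<lambda>y. y $ i - x $ i) = integral (cball x r) (\<lambda>y. 1^3 * ((?g y) $ i - x $ i))"
    by (rule integral_similarity(2)[OF compact_cball orth zero_less_one continuous_coordinate])
  also have "(\<lambda>y. 1^3 * ((?g y) $ i - x $ i)) = (\<lambda>y. - (y $ i - x $ i))" by (simp add: fun_eq_iff)
  also have "integral (cball x r) (\<lambda>y. - (y $ i - x $ i)) = - integral (cball x r) (\<lambda>y. y $ i - x $ i)"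
    by (rule integral_neg)
  finally show ?thesis unfolding img by linarith
qed

text \<open>The first moment of F about x is minus that of the complement of F in the ball of radius
  1 + d. There the coordinates are at most 1 + d in size, and the volume is 4 pi / 3 times (1 + d)^3
  - 1 <= 7 d. This gives 2 * 7 d per coordinate and 42 d for the sum of three.\<close>

lemma barycentre_close:
  fixes F :: "(real^3) set"
  assumes F: "compact F" "measure lebesgue F = 4 * pi / 3" and sub: "F \<subseteq> cball x (1 + d)" and d: "0 \<le> d" "d \<le> 1"
  shows "norm (barycentre F - x) \<le> 42 * d"
proof -
  have comp: "\<bar>(barycentre F - x) $ i\<bar> \<le> 14 * d" for i
  proof -
    let ?f = "\<lambda>y. y $ i - x $ i" and ?B = "cball x (1 + d)"
    define v where "v = barycentre F $ i - x $ i"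
    have "(\<lambda>y. y $ i - 0) integrable_on F" by (rule integrable_continuous_compact[OF F(1) continuous_coordinate])
    then have "((\<lambda>y. y $ i) has_integral (4 * pi / 3) * barycentre F $ i) F"
      by (simp add: has_integral_iff barycentre_def)
    from has_integral_diff[OF this has_integral_const_compact[OF F(1), of "x $ i"]]
    have 1: "(?f has_integral (4 * pi / 3) * v) F" by (simp only: F(2) v_def right_diff_distrib)
    have 2: "(?f has_integral 0) ?B"
      using integrable_continuous_compact[OF compact_cball continuous_coordinate] integral_coordinate_cball
      by (simp add: has_integral_iff)
    have ns: "negligible (F - ?B)" using sub by (simp add: Diff_eq_empty_iff[THEN iffD2])
    have 3: "(?f has_integral 0 - (4 * pi / 3) * v) (?B - F)"
      by (rule has_integral_setdiff[OF 2 1 ns])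
    have mB: "measure lebesgue ?B = 4 * pi / 3 * (1 + d)^3"
      using content_cball[of "1 + d" x] d by (simp add: unit_ball_vol_3)
    have 4: "((\<lambda>y. c) has_integral 4 * pi / 3 * (1 + d)^3 * c - 4 * pi / 3 * c) (?B - F)" for c
      using has_integral_setdiff[OF has_integral_const_compact[OF compact_cball, of c x "1 + d"] has_integral_const_compact[OF F(1), of c] ns]
      by (simp only: mB F(2))
    have b: "\<bar>y $ i - x $ i\<bar> \<le> 1 + d" if "y \<in> ?B - F" for y
      using that component_le_norm_cart[of "y - x" i] by (auto simp: dist_norm norm_minus_commute)
    have "0 - (4 * pi / 3) * v \<le> 4 * pi / 3 * (1 + d)^3 * (1 + d) - 4 * pi / 3 * (1 + d)"
      by (rule has_integral_le[OF 3 4]) (use b in fastforce)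
    moreover have "4 * pi / 3 * (1 + d)^3 * (- (1 + d)) - 4 * pi / 3 * (- (1 + d)) \<le> 0 - (4 * pi / 3) * v"
      by (rule has_integral_le[OF 4 3]) (use b in fastforce)
    ultimately have "\<bar>(4 * pi / 3) * v\<bar> \<le> (4 * pi / 3) * ((1 + d) * ((1 + d)^3 - 1))"
    proof -
      have e: "k * X * R - k * R = k * (R * (X - 1))" "k * X * (- R) - k * (- R) = - (k * (R * (X - 1)))" for k X R :: real
        by (simp_all add: algebra_simps)
      assume "0 - (4 * pi / 3) * v \<le> 4 * pi / 3 * (1 + d)^3 * (1 + d) - 4 * pi / 3 * (1 + d)"
        "4 * pi / 3 * (1 + d)^3 * (- (1 + d)) - 4 * pi / 3 * (- (1 + d)) \<le> 0 - (4 * pi / 3) * v"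
      then show ?thesis unfolding e by (intro abs_leI) linarith+
    qed
    then have "\<bar>v\<bar> \<le> (1 + d) * ((1 + d)^3 - 1)" by (simp add: abs_mult)
    also have "\<dots> \<le> 2 * (7 * d)"
    proof (intro mult_mono)
      have "d^2 \<le> d" "d^3 \<le> d" using d power_decreasing[of 1 2 d] power_decreasing[of 1 3 d] by auto
      then show "(1 + d)^3 - 1 \<le> 7 * d" by (simp add: power2_eq_square power3_eq_cube algebra_simps)
    qed (use d in \<open>auto intro: one_le_power\<close>)
    finally show ?thesis by (simp add: v_def)
  qed
  have "norm (barycentre F - x) \<le> (\<Sum>i\<in>UNIV. \<bar>(barycentre F - x) $ i\<bar>)" by (rule norm_le_l1_cart)
  also have "\<dots> \<le> (\<Sum>i\<in>(UNIV :: 3 set). 14 * d)" by (intro sum_mono comp)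
  finally show ?thesis by simp
qed

lemma class_A_facts:
  assumes "F \<in> class_A"
  shows "convex F" "compact F" "F \<noteq> {}" "measure lebesgue F = 4 * pi / 3"
  using assms by (auto simp: class_A_def convex_body_def)

text \<open>Moving the centre costs at most 42 d, on top of the distance d itself.\<close>

lemma hausdorff_barycentre_le:
  assumes A: "F \<in> class_A" and d: "hausdorff_dist F (cball x 1) \<le> 1"
  shows "hausdorff_dist F (cball (barycentre F) 1) \<le> 43 * hausdorff_dist F (cball x 1)"
proof -
  define d c where "d = hausdorff_dist F (cball x 1)" and "c = barycentre F"
  note F = class_A_facts[OF A]
  have B: "compact (cball x 1)" "cball x 1 \<noteq> {}" by auto
  note H = hausdorff_dist_upper[OF F(2) B(1) F(3) B(2), folded d_def]
  note sub = hausdorff_ball_inclusions(1)[OF F(1-3), of x, folded d_def]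
  have cx: "norm (c - x) \<le> 42 * d"
    unfolding c_def using d by (intro barycentre_close[OF F(2,4) sub H(4)]) (simp add: d_def)
  have "hausdorff_dist F (cball c 1) \<le> 43 * d"
  proof (rule hausdorff_dist_le)
    fix y assume "y \<in> F"
    then have "norm (y - x) \<le> 1 + d" using sub by (auto simp: dist_norm norm_minus_commute)
    moreover have "norm (y - c) \<le> norm (y - x) + norm (c - x)"
      using norm_triangle_ineq4[of "y - x" "c - x"] by simp
    ultimately show "infdist y (cball c 1) \<le> 43 * d"
      using cx H(4) by (intro infdist_cball_1_le) auto
  next
    fix y assume "y \<in> cball c 1"
    then have "y - (c - x) \<in> cball x 1" by (simp add: dist_norm algebra_simps)
    then have "infdist (y - (c - x)) F \<le> d" by (rule H(2))
    moreover have "infdist y F \<le> infdist (y - (c - x)) F + dist y (y - (c - x))" by (rule infdist_triangle)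
    ultimately show "infdist y F \<le> 43 * d" using cx by (simp add: dist_norm)
  qed (use F(3) in auto)
  then show ?thesis by (simp add: d_def c_def)
qed

lemma hausdorff_asymmetry_bounds:
  assumes A: "F \<in> class_A"
  shows "0 \<le> hausdorff_asymmetry F"
    and "hausdorff_asymmetry F \<le> hausdorff_dist F (cball x 1)"
    and "hausdorff_asymmetry F < 1 \<Longrightarrow> hausdorff_dist F (cball (barycentre F) 1) \<le> 43 * hausdorff_asymmetry F"
proof -
  note F = class_A_facts[OF A]
  have nn: "0 \<le> hausdorff_dist F (cball x 1)" for x
    using hausdorff_dist_upper(4)[OF F(2) compact_cball F(3)] by auto
  have bb: "bdd_below (range (\<lambda>x. hausdorff_dist F (cball x 1)))" using nn by (auto intro!: bdd_belowI)
  have asym: "hausdorff_asymmetry F = (INF x. hausdorff_dist F (cball x 1))"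
    by (simp add: hausdorff_asymmetry_def unit_ball_translate)
  show "0 \<le> hausdorff_asymmetry F" unfolding asym using nn by (intro cINF_greatest) auto
  show "hausdorff_asymmetry F \<le> hausdorff_dist F (cball x 1)" unfolding asym using bb by (intro cINF_lower) auto
  assume l1: "hausdorff_asymmetry F < 1"
  show "hausdorff_dist F (cball (barycentre F) 1) \<le> 43 * hausdorff_asymmetry F"
  proof (rule field_le_epsilon)
    fix e :: real assume e: "0 < e"
    define m where "m = min 1 (hausdorff_asymmetry F + e / 43)"
    have "(INF x. hausdorff_dist F (cball x 1)) < m" using l1 e by (simp add: m_def asym[symmetric])
    then obtain x where x: "hausdorff_dist F (cball x 1) < m" using bb by (auto simp: cINF_less_iff)
    then have "hausdorff_dist F (cball (barycentre F) 1) \<le> 43 * hausdorff_dist F (cball x 1)"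
      by (intro hausdorff_barycentre_le[OF A]) (simp add: m_def)
    also have "\<dots> \<le> 43 * (hausdorff_asymmetry F + e / 43)" using x by (simp add: m_def)
    finally show "hausdorff_dist F (cball (barycentre F) 1) \<le> 43 * hausdorff_asymmetry F + e" by simp
  qed
qed

text \<open>A rigid motion takes the barycentre to the origin and the contact direction to the first
  axis; volume, moments and perimeter are carried over.\<close>

lemma perimeter_deficit_class_A:
  assumes A: "F \<in> class_A"
  defines "h \<equiv> hausdorff_dist F (cball (barycentre F) 1)"
  assumes h: "0 < h" "h \<le> 1 / 100"
  shows "3 * pi * (19 / 20 * h - 60 * h\<^sup>2)\<^sup>2 / (4 * (ln (2 / h) / (1 - h) + 180)) \<le> P F - 4 * pi"
proof -
  note F = class_A_facts[OF A]
  define c where "c = barycentre F"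
  note inc = hausdorff_ball_inclusions[OF F(1-3), of c, folded c_def h_def[folded c_def]]
  obtain e where e: "norm e = 1" "c + (1 + h) *\<^sub>R e \<in> F \<or> (\<forall>y\<in>F. (y - c) \<bullet> e \<le> 1 - h)"
    using inc(3)[OF h(1)] by blast
  obtain Q :: "real^3 \<Rightarrow> real^3" where Q: "orthogonal_transformation Q" "Q e = axis 1 1"
    using orthogonal_transformation_exists_1[of e "axis 1 1 :: real^3"] e(1) by (auto simp: norm_axis_1)
  have lin: "linear Q" using Q(1) by (rule orthogonal_transformation_linear)
  \<comment> \<open>Written with the factor 1 and a trailing translation to fit the similarity
    lemmas at s = 1, used here in both directions.\<close>
  define g where "g x = 1 *\<^sub>R Q x + (- Q c)" for x
  have g: "g x = Q (x - c)" for x by (simp add: g_def linear_diff[OF lin])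
  define G where "G = g ` F"
  have g1: "g x $ 1 = (x - c) \<bullet> e" for x
  proof -
    have "g x $ 1 = Q (x - c) \<bullet> Q e" by (simp add: g Q(2) inner_axis)
    then show ?thesis using Q(1) by (simp add: orthogonal_transformation_def)
  qed
  have ng: "norm (g x) = norm (x - c)" for x using Q(1) by (simp add: g orthogonal_transformation_norm)
  have lini: "linear (inv Q)" using Q(1) by (intro orthogonal_transformation_linear orthogonal_transformation_inv)
  have QR: "Q (inv Q v) = v" "inv Q (Q v) = v" for v
    using orthogonal_transformation_bij[OF Q(1)] by (auto simp: bij_is_inj bij_is_surj surj_f_inv_f)
  have gi: "g (1 *\<^sub>R inv Q y + c) = y" for y by (simp add: g QR)
  have ig: "1 *\<^sub>R inv Q (g x) + c = x" for x by (simp add: g QR)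
  note sim = integral_similarity[OF F(2) Q(1) zero_less_one, of "- Q c", folded g_def G_def]
  have Gc: "compact G" by (rule sim(1)[of "\<lambda>_. 0"]) simp
  have Gconv: "convex G"
  proof -
    have "G = (\<lambda>x. - Q c + x) ` (Q ` F)" by (simp add: G_def g_def image_image add.commute)
    then show ?thesis using F(1) lin by (simp add: convex_linear_image convex_translation_eq)
  qed
  have mG: "measure lebesgue G = 4 * pi / 3"
  proof -
    have "measure lebesgue G = integral G (\<lambda>_. 1)"
      using has_integral_const_compact[OF Gc, of 1] by (simp add: integral_unique)
    also have "\<dots> = integral F (\<lambda>_. 1)" using sim(2)[of "\<lambda>_. 1"] by simp
    also have "\<dots> = 4 * pi / 3" using has_integral_const_compact[OF F(2), of 1] F(4) by (simp add: integral_unique)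
    finally show ?thesis .
  qed
  have bary: "((\<lambda>x. x $ 1) has_integral 0) G"
  proof -
    have "integral G (\<lambda>x. x $ 1) = integral F (\<lambda>x. g x $ 1)"
      using sim(2)[of "\<lambda>x. x $ 1"] by (simp add: continuous_on_component continuous_on_id)
    also have "\<dots> = integral F (\<lambda>x. \<Sum>i\<in>UNIV. (x $ i - c $ i) * e $ i)"
      by (simp add: g1 inner_vec_def)
    also have "\<dots> = (\<Sum>i\<in>UNIV. integral F (\<lambda>x. (x $ i - c $ i) * e $ i))"
      by (intro integral_sum) (auto intro!: integrable_on_mult_left integrable_continuous_compact[OF F(2) continuous_coordinate])
    also have "\<dots> = 0"
    proof (rule sum.neutral, rule ballI)
      fix i :: 3
      have "(\<lambda>y. y $ i - 0) integrable_on F" by (rule integrable_continuous_compact[OF F(2) continuous_coordinate])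
      then have "((\<lambda>y. y $ i) has_integral (4 * pi / 3) * c $ i) F"
        by (simp add: has_integral_iff barycentre_def c_def)
      from has_integral_diff[OF this has_integral_const_compact[OF F(2), of "c $ i"]]
      have "((\<lambda>y. y $ i - c $ i) has_integral 0) F" by (simp add: F(4))
      from integral_unique[OF has_integral_mult_left[OF this, of "e $ i"]]
      show "integral F (\<lambda>x. (x $ i - c $ i) * e $ i) = 0" by (simp only: mult_zero_left)
    qed
    finally have "integral G (\<lambda>x. x $ 1) = 0" .
    moreover have "(\<lambda>x. x $ 1 - 0) integrable_on G" by (rule integrable_continuous_compact[OF Gc continuous_coordinate])
    ultimately show ?thesis by (simp add: has_integral_iff)
  qed
  have inner: "cball 0 (1 - h) \<subseteq> G"
  proof
    fix y assume "y \<in> cball (0 :: real^3) (1 - h)"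
    then have "norm (g (1 *\<^sub>R inv Q y + c)) \<le> 1 - h" unfolding gi by simp
    then have "1 *\<^sub>R inv Q y + c \<in> cball c (1 - h)" unfolding ng by (simp add: dist_norm norm_minus_commute)
    then have "1 *\<^sub>R inv Q y + c \<in> F" using inc(2) by blast
    then have "g (1 *\<^sub>R inv Q y + c) \<in> G" unfolding G_def by (rule imageI)
    then show "y \<in> G" by (simp only: gi)
  qed
  have outer: "G \<subseteq> cball 0 (1 + h)"
  proof
    fix y assume "y \<in> G"
    then obtain x where x: "x \<in> F" "y = g x" by (auto simp: G_def)
    then have "norm (x - c) \<le> 1 + h" using inc(1) by (auto simp: dist_norm norm_minus_commute)
    then show "y \<in> cball 0 (1 + h)" by (simp add: x(2) ng)
  qed
  have contact: "axis 1 (1 + h) \<in> G \<or> (\<forall>x\<in>G. x $ 1 \<le> 1 - h)"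
    using e(2)
  proof
    assume "c + (1 + h) *\<^sub>R e \<in> F"
    then have "g (c + (1 + h) *\<^sub>R e) \<in> G" unfolding G_def by (rule imageI)
    moreover have "g (c + (1 + h) *\<^sub>R e) = axis 1 (1 + h)"
      by (simp add: g linear_scale[OF lin] Q(2) vec_eq_iff axis_def)
    ultimately show ?thesis by simp
  next
    assume "\<forall>y\<in>F. (y - c) \<bullet> e \<le> 1 - h"
    then show ?thesis by (auto simp: G_def g1)
  qed
  have b: "3 * pi * (19 / 20 * h - 60 * h\<^sup>2)\<^sup>2 / (4 * (ln (2 / h) / (1 - h) + 180)) \<le> P G - 4 * pi"
    by (rule perimeter_deficit_lower_bound[OF Gconv Gc mG h inner outer bary contact])
  have "ball 0 (1 - h) \<subseteq> interior G"
    using inner by (intro interior_maximal) (auto simp: subset_iff)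
  then have G0: "0 \<in> interior G" using h by auto
  have "perimeter F \<le> perimeter G"
    using perimeter_similarity_le[OF F(2) Q(1) zero_less_one, of "- Q c"] by (simp add: G_def g_def)
  moreover have "perimeter G \<le> perimeter F"
  proof -
    have "(\<lambda>y. 1 *\<^sub>R inv Q y + c) ` G = F" unfolding G_def image_image ig by simp
    then show ?thesis
      using perimeter_similarity_le[OF Gc orthogonal_transformation_inv[OF Q(1)] zero_less_one, of c] by simp
  qed
  ultimately have "P F = P G" by (simp add: P_def)
  then show ?thesis using b by simp
qed

text \<open>The upper bound is the flow estimate with inscribed radius 1, the lower bound the
  isoperimetric inequality.\<close>

lemma P_unit_ball: "P unit_ball = 4 * pi"
proof -
  have F: "convex unit_ball" "compact unit_ball" "0 \<in> interior unit_ball"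
    by (auto simp: unit_ball_def interior_cball)
  have V: "measure lebesgue unit_ball = 4 * pi / 3"
    using content_cball[of 1 "0 :: real^3"] by (simp add: unit_ball_def unit_ball_vol_3)
  have "perimeter unit_ball \<le> ereal (3 * measure lebesgue unit_ball / 1)"
    by (rule perimeter_convex_le[OF F(1,2)]) (auto simp: unit_ball_def)
  then have "P unit_ball \<le> 4 * pi" unfolding perimeter_finite(1)[OF F] V by simp
  moreover have "4 * pi \<le> P unit_ball" by (rule isoperimetric_inequality[OF F V])
  ultimately show ?thesis by simp
qed

section \<open>Asymptotics\<close>

(* The limit 3 * (19 / 20)^2 / 8 = 0.338... leaves little room above 1 / 3; the loss 19 / 20 stems from
   cutting off the tip at distance h / 20 in spike_bound and dent_bound. *)
lemma profile_asymptotics: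
  defines "b \<equiv> \<lambda>h::real. 3 * (19 / 20 * h - 60 * h\<^sup>2)\<^sup>2 / (16 * (ln (2 / h) / (1 - h) + 180))"
  shows "\<forall>\<^sub>F h in at_right 0. h\<^sup>2 / 3 \<le> b h * ln (b h + 1 / b h)"
proof -
  have "((\<lambda>h. b h * ln (b h + 1 / b h) / h\<^sup>2) \<longlongrightarrow> 3 * (19 / 20)\<^sup>2 / 8) (at_right 0)"
    unfolding b_def by real_asymp
  then have "\<forall>\<^sub>F h in at_right 0. 1 / 3 < b h * ln (b h + 1 / b h) / h\<^sup>2"
    by (rule order_tendstoD) (simp add: power2_eq_square)
  moreover have "\<forall>\<^sub>F h::real in at_right 0. h > 0" by (simp add: eventually_at_right_less)
  ultimately show ?thesis by eventually_elim (simp add: field_simps)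
qed

text \<open>The derivative is ln y + 1 - 2 / (x^2 + 1) with y = x + 1/x. From ln y >= ln 2 + 1 - 2/y
  and ln 2 >= 2/3 it is nonnegative once (2 x + 2) / (x^2 + 1) <= 8/3, which holds by completing a
  square.\<close>

lemma mult_ln_mono:
  fixes s t :: real
  assumes "0 < s" "s \<le> t"
  shows "s * ln (s + 1 / s) \<le> t * ln (t + 1 / t)"
proof (rule DERIV_nonneg_imp_nondecreasing[OF assms(2)])
  fix x assume "s \<le> x" "x \<le> t"
  then have x: "0 < x" using assms by simp
  define y where "y = x + 1 / x"
  have y: "2 \<le> y" 
  proof -
    have "0 \<le> (x - 1)\<^sup>2 / x" using x by simp
    also have "\<dots> = y - 2" using x by (simp add: y_def field_simps power2_eq_square)
    finally show ?thesis by simp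
  qed
  have "((\<lambda>x. x * ln (x + 1 / x)) has_real_derivative ln (x + 1 / x) + x * ((1 - 1 / x\<^sup>2) / (x + 1 / x))) (at x)"
    using x by (auto intro!: derivative_eq_intros simp: add_pos_pos power2_eq_square)
  moreover have "0 \<le> ln (x + 1 / x) + x * ((1 - 1 / x\<^sup>2) / (x + 1 / x))"
  proof -
    have pos: "0 < x\<^sup>2 + 1" by (simp add: add_nonneg_pos)
    have e: "x * ((1 - 1 / x\<^sup>2) / (x + 1 / x)) = 1 - 2 / (x\<^sup>2 + 1)"
    proof -
      have "x + 1 / x = (x\<^sup>2 + 1) / x" "1 - 1 / x\<^sup>2 = (x\<^sup>2 - 1) / x\<^sup>2"
        using x by (simp_all add: field_simps power2_eq_square)
      then have "x * ((1 - 1 / x\<^sup>2) / (x + 1 / x)) = (x\<^sup>2 - 1) / (x\<^sup>2 + 1)"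
        using x by (simp add: power2_eq_square)
      also have "\<dots> = 1 - 2 / (x\<^sup>2 + 1)" using pos by (simp add: field_simps)
      finally show ?thesis .
    qed
    have "ln (2 / y) \<le> 2 / y - 1" using y by (intro ln_le_minus_one) auto
    then have "ln 2 + 1 - 2 / y \<le> ln y" using y by (simp add: ln_div)
    moreover have "2 / y = 2 * x / (x\<^sup>2 + 1)"
      using x pos by (simp add: y_def field_simps power2_eq_square)
    moreover have "2 * x / (x\<^sup>2 + 1) + 2 / (x\<^sup>2 + 1) \<le> 8 / 3"
    proof -
      have "0 \<le> 8 / 3 * (x - 3 / 8)\<^sup>2" by simp
      then have "2 * x + 2 \<le> 8 / 3 * (x\<^sup>2 + 1)" by (simp add: power2_eq_square algebra_simps)
      then show ?thesis using pos by (simp add: add_divide_distrib[symmetric] divide_le_eq)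
    qed
    ultimately show ?thesis
      unfolding y_def[symmetric] e[folded y_def] using ln2_ge_two_thirds by linarith
  qed
  ultimately show "\<exists>d. ((\<lambda>x. x * ln (x + 1 / x)) has_real_derivative d) (at x) \<and> 0 \<le> d" by blast
qed

theorem theorem1:
  fixes F :: "nat \<Rightarrow> (real^3) set"
  assumes "\<And>j. F j \<in> class_A"
    and "(\<lambda>j. hausdorff_asymmetry (F j)) \<longlonglongrightarrow> 0"
  shows "liminf (\<lambda>j. Q_star (F j)) \<ge> ereal (64 / 3 * pi ^ 3) \<and>
         64 / 3 * pi ^ 3 > 16 * pi ^ 3"
proof
  define b :: "real \<Rightarrow> real" where "b h = 3 * (19 / 20 * h - 60 * h\<^sup>2)\<^sup>2 / (16 * (ln (2 / h) / (1 - h) + 180))" for h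
  obtain h0 where h0: "0 < h0" "\<And>h. 0 < h \<Longrightarrow> h < h0 \<Longrightarrow> h\<^sup>2 / 3 \<le> b h * ln (b h + 1 / b h)"
    using profile_asymptotics unfolding b_def[symmetric] eventually_at_right_field by auto
  \<comment> \<open>Dividing by 43 makes the distance h to the ball about the barycentre smaller
    than h0 and at most 1/100.\<close>
  define \<epsilon> where "\<epsilon> = min h0 (1 / 100) / 43"
  have \<epsilon>: "0 < \<epsilon>" "\<epsilon> < 1" "43 * \<epsilon> \<le> h0" "43 * \<epsilon> \<le> 1 / 100" using h0(1) by (auto simp: \<epsilon>_def)
  have bound: "ereal (64 / 3 * pi ^ 3) \<le> Q_star G" if A: "G \<in> class_A" and small: "hausdorff_asymmetry G < \<epsilon>" for G
  proof (cases "is_ball G")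
    case False
    define l h \<delta> where "l = hausdorff_asymmetry G" and "h = hausdorff_dist G (cball (barycentre G) 1)"
      and "\<delta> = iso_deficit G"
    note G = class_A_facts[OF A]
    have lh: "l \<le> h" "h \<le> 43 * l"
      using hausdorff_asymmetry_bounds(2,3)[OF A] small \<epsilon>(2) by (auto simp: l_def h_def)
    \<comment> \<open>At h = 0 the two ball inclusions coincide and force a ball, for which
      \<open>Q_star\<close> is infinite anyway.\<close>
    have "h \<noteq> 0"
    proof
      assume "h = 0"
      then have "G = cball (barycentre G) 1"
        using hausdorff_ball_inclusions(1,2)[OF G(1-3), of "barycentre G"] by (auto simp: h_def)
      then show False using False unfolding is_ball_def by (metis zero_less_one)
    qed
    then have l: "0 < l" using hausdorff_asymmetry_bounds(1)[OF A] lh unfolding l_def by linarith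
    have h: "0 < h" "h < h0" "h \<le> 1 / 100" using l lh small \<epsilon> by (auto simp: l_def)
    have "h * h \<le> 1 / 100 * h" using h by (intro mult_right_mono) auto
    then have "0 < 19 / 20 * h - 60 * h\<^sup>2" using h(1) unfolding power2_eq_square by linarith
    moreover have "0 \<le> ln (2 / h) / (1 - h)" using h by simp
    ultimately have bpos: "0 < b h" unfolding b_def by (intro divide_pos_pos mult_pos_pos zero_less_power) auto
    have "3 * pi * m / (4 * n) = 4 * pi * (3 * m / (16 * n))" for m n :: real
      by (cases "n = 0") (auto simp: field_simps)
    then have "4 * pi * b h \<le> P G - 4 * pi"
      using perimeter_deficit_class_A[OF A, folded h_def, OF h(1,3)] unfolding b_def by (simp only:)
    moreover have "P G - 4 * pi = 4 * pi * \<delta>" by (simp add: \<delta>_def iso_deficit_def P_unit_ball)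
    ultimately have b\<delta>: "b h \<le> \<delta>" by simp
    have PG: "4 * pi \<le> P G" using \<open>P G - 4 * pi = 4 * pi * \<delta>\<close> b\<delta> bpos by (smt (verit) mult_nonneg_nonneg pi_ge_zero)
    have "l\<^sup>2 / 3 \<le> h\<^sup>2 / 3" using l lh(1) by (intro divide_right_mono power_mono) auto
    also have "\<dots> \<le> b h * ln (b h + 1 / b h)" by (rule h0(2)[OF h(1,2)])
    also have "\<dots> \<le> \<delta> * ln (\<delta> + 1 / \<delta>)" by (rule mult_ln_mono[OF bpos b\<delta>])
    \<comment> \<open>With P G >= 4 pi this produces the constant (4 pi)^3 / 3 = 64/3 pi^3.\<close>
    finally have "l\<^sup>2 / 3 * (4 * pi)^3 \<le> \<delta> * ln (\<delta> + 1 / \<delta>) * P G ^ 3"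
      using PG l by (intro mult_mono power_mono) (auto intro: order_trans[of _ "l\<^sup>2 / 3"])
    then have "64 / 3 * pi^3 \<le> \<delta> * ln (\<delta> + 1 / \<delta>) * P G ^ 3 / l\<^sup>2"
      using l by (simp add: le_divide_eq power_mult_distrib mult_ac)
    then show ?thesis using False by (simp add: Q_star_def \<delta>_def l_def)
  qed (simp add: Q_star_def)
  have "\<forall>\<^sub>F j in sequentially. hausdorff_asymmetry (F j) < \<epsilon>"
    using assms(2) \<epsilon>(1) by (rule order_tendstoD(2))
  then show "ereal (64 / 3 * pi ^ 3) \<le> liminf (\<lambda>j. Q_star (F j))"
    by (intro Liminf_bounded) (erule eventually_mono, rule bound[OF assms(1)])
  show "64 / 3 * pi ^ 3 > 16 * pi ^ 3" by simp
qed

end
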